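(* Let $\Omega\subset\mathbb{R}^n$ be a bounded domain with $C^2$ boundary $\partial\Omega$, and let $p:\Omega\to(1,\infty)$ be continuous with $p_-:=\inf_{x\in\Omega}p(x)>n$ (the case $\sup_\Omega p=\infty$ is included). Then for any $\varphi\in W^{1,p}(\Omega)$ such that $\int_\Omega \frac{|\nabla\varphi|^{p}}{p}\,dx<\infty$, there exists a solution $u\in W^{1,p}(\Omega)$ to the Dirichlet problem $$\Delta_p u=\operatorname{div}\left(|\nabla u|^{p-2}\nabla u\right)=0 \ \text{ in }\Omega,\qquad u|_{\partial\Omega}=\varphi,$$ where the boundary condition is interpreted as $u-\varphi\in V^{1,p}_0(\Omega)$.
   Context: For a measurable function $u$ on $\Omega$, $\rho_p(u)=\int_\Omega \frac{|u(x)|^{p(x)}}{p(x)}\,dx$. For a function $u$ whose first-order distributional derivatives are functions, $\rho_{1,p}(u)=\rho_p(u)+\rho_p(|\nabla u|)$, where $|\nabla u|$ is the Euclidean norm of the gradient. $W^{1,p}(\Omega)$ is the space of real-valued Borel measurable functions $u$ on $\Omega$ with such derivatives for which $\rho_{1,p}(\lambda u)<\infty$ for some $\lambda>0$ (functions are identified if they agree a.e.). A set $A\subset W^{1,p}(\Omega)$ is $\rho_{1,p}$-closed if whenever $(u_j)\subset A$, $u\in W^{1,p}(\Omega)$ and $\rho_{1,p}(u_j-u)\to0$, then $u\in A$. $V^{1,p}_0(\Omega)$ is the $\rho_{1,p}$-closure of $C_0^\infty(\Omega)$ in $W^{1,p}(\Omega)$, i.e. the intersection of all $\rho_{1,p}$-closed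 subsets of $W^{1,p}(\Omega)$ containing $C_0^\infty(\Omega)$. The equation $\Delta_p u=0$ is understood weakly: $\int_\Omega |\nabla u|^{p-2}\nabla u\cdot\nabla h\,dx=0$ for all $h\in C_0^\infty(\Omega)$. *)

theory Defs
  imports "HOL-Analysis.Analysis"
begin

text \<open>
  The exponent \<open>p\<close> and all functions on \<open>\<Omega>\<close> are total functions on the ambient Euclidean space;
  every definition below depends only on their values on \<open>\<Omega>\<close>.
\<close>

text \<open>Intended for open \<open>S\<close> only.\<close>

fun C_k_on :: "nat \<Rightarrow> 'a::euclidean_space set \<Rightarrow> ('a \<Rightarrow> real) \<Rightarrow> bool" where
  "C_k_on 0 S f \<longleftrightarrow> continuous_on S f"
| "C_k_on (Suc k) S f \<longleftrightarrow>
     (\<forall>x\<in>S. f differentiable (at x)) \<and>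
     (\<forall>b\<in>Basis. C_k_on k S (\<lambda>x. frechet_derivative f (at x) b))"

definition gradient :: "('a::euclidean_space \<Rightarrow> real) \<Rightarrow> 'a \<Rightarrow> 'a" where
  "gradient f x = (\<Sum>b\<in>Basis. frechet_derivative f (at x) b *\<^sub>R b)"

text \<open>
  Near each boundary point, \<open>\<Omega>\<close> is the open region above the graph of a \<open>C\<^sup>2\<close> function in suitable
  rotated coordinates: \<open>e\<close> is the direction of the last axis, and \<open>\<gamma>\<close> is evaluated only on the
  orthogonal complement of \<open>e\<close>, which plays the role of the space of the first \<open>n - 1\<close> variables.
\<close>

definition C2_boundary :: "'a::euclidean_space set \<Rightarrow> bool" where
  "C2_boundary \<Omega> \<longleftrightarrow>
     (\<forall>z\<in>frontier \<Omega>. \<exists>r>0. \<exists>e \<gamma>. norm e = 1 \<and> C_k_on 2 UNIV \<gamma> \<and>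
        \<Omega> \<inter> ball z r = {x \<in> ball z r. \<gamma> (x - (x \<bullet> e) *\<^sub>R e) < x \<bullet> e})"

text \<open>\<open>C\<^sub>0\<^sup>\<infinity>(\<Omega>)\<close>: the functions are extended by zero outside \<open>\<Omega>\<close>.\<close>

definition test_functions :: "'a::euclidean_space set \<Rightarrow> ('a \<Rightarrow> real) set" where
  "test_functions \<Omega> =
     {h. (\<forall>k. C_k_on k UNIV h) \<and> compact (closure {x. h x \<noteq> 0}) \<and> closure {x. h x \<noteq> 0} \<subseteq> \<Omega>}"

definition locally_integrable_on ::
    "'a::euclidean_space set \<Rightarrow> ('a \<Rightarrow> 'b::{banach, second_countable_topology}) \<Rightarrow> bool" where
  "locally_integrable_on \<Omega> f \<longleftrightarrow> (\<forall>K. compact K \<and> K \<subseteq> \<Omega> \<longrightarrow> set_integrable lborel K f)"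

text \<open>The distributional partial derivatives of \<open>u\<close> on \<open>\<Omega>\<close> are the components of the function \<open>g\<close>.\<close>

definition has_weak_gradient ::
    "'a::euclidean_space set \<Rightarrow> ('a \<Rightarrow> real) \<Rightarrow> ('a \<Rightarrow> 'a) \<Rightarrow> bool" where
  "has_weak_gradient \<Omega> u g \<longleftrightarrow>
     locally_integrable_on \<Omega> u \<and> locally_integrable_on \<Omega> g \<and>
     (\<forall>h\<in>test_functions \<Omega>. \<forall>b\<in>Basis.
        (LINT x:\<Omega>|lborel. u x * frechet_derivative h (at x) b) =
        - (LINT x:\<Omega>|lborel. (g x \<bullet> b) * h x))"

text \<open>
  Unique up to almost everywhere equality on \<open>\<Omega>\<close> when \<open>\<Omega>\<close> is open and a weak gradient exists;
  unspecified if there is none.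
\<close>

definition weak_gradient :: "'a::euclidean_space set \<Rightarrow> ('a \<Rightarrow> real) \<Rightarrow> 'a \<Rightarrow> 'a" where
  "weak_gradient \<Omega> u = (SOME g. has_weak_gradient \<Omega> u g)"

definition rho :: "'a::euclidean_space set \<Rightarrow> ('a \<Rightarrow> real) \<Rightarrow> ('a \<Rightarrow> real) \<Rightarrow> ennreal" where
  "rho \<Omega> p u = (\<integral>\<^sup>+x\<in>\<Omega>. ennreal (\<bar>u x\<bar> powr p x / p x) \<partial>lborel)"

definition rho1 :: "'a::euclidean_space set \<Rightarrow> ('a \<Rightarrow> real) \<Rightarrow> ('a \<Rightarrow> real) \<Rightarrow> ennreal" where
  "rho1 \<Omega> p u = rho \<Omega> p u + rho \<Omega> p (\<lambda>x. norm (weak_gradient \<Omega> u x))"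

text \<open>
  The variable exponent Sobolev space, as a set of functions rather than of almost everywhere
  equivalence classes. Membership is invariant under changing the function on a Borel null
  set in a Borel measurable way, and so is membership in any \<open>rho1_closed\<close> set.
\<close>

definition sobolev :: "'a::euclidean_space set \<Rightarrow> ('a \<Rightarrow> real) \<Rightarrow> ('a \<Rightarrow> real) set" where
  "sobolev \<Omega> p =
     {u. set_borel_measurable borel \<Omega> u \<and> (\<exists>g. has_weak_gradient \<Omega> u g) \<and>
         (\<exists>c>0. rho1 \<Omega> p (\<lambda>x. c * u x) < \<infinity>)}"

definition rho1_closed ::
    "'a::euclidean_space set \<Rightarrow> ('a \<Rightarrow> real) \<Rightarrow> ('a \<Rightarrow> real) set \<Rightarrow> bool" where
  "rho1_closed \<Omega> p A \<longleftrightarrow>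
     A \<subseteq> sobolev \<Omega> p \<and>
     (\<forall>v u. (\<forall>j::nat. v j \<in> A) \<and> u \<in> sobolev \<Omega> p \<and>
            (\<lambda>j. rho1 \<Omega> p (\<lambda>x. v j x - u x)) \<longlonglongrightarrow> 0 \<longrightarrow> u \<in> A)"

definition V0 :: "'a::euclidean_space set \<Rightarrow> ('a \<Rightarrow> real) \<Rightarrow> ('a \<Rightarrow> real) set" where
  "V0 \<Omega> p = \<Inter>{A. rho1_closed \<Omega> p A \<and> test_functions \<Omega> \<subseteq> A}"

text \<open>
  Integrability is required explicitly because the Bochner integral of a non-integrable function
  is \<open>0\<close> by convention. Where the weak gradient vanishes, the integrand is \<open>0\<close>.
\<close>

definition weak_p_harmonic ::
    "'a::euclidean_space set \<Rightarrow> ('a \<Rightarrow> real) \<Rightarrow> ('a \<Rightarrow> real) \<Rightarrow> bool" where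
  "weak_p_harmonic \<Omega> p u \<longleftrightarrow>
     (\<forall>h\<in>test_functions \<Omega>.
        set_integrable lborel \<Omega>
          (\<lambda>x. norm (weak_gradient \<Omega> u x) powr (p x - 2) * (weak_gradient \<Omega> u x \<bullet> gradient h x)) \<and>
        (LINT x:\<Omega>|lborel.
           norm (weak_gradient \<Omega> u x) powr (p x - 2) * (weak_gradient \<Omega> u x \<bullet> gradient h x)) = 0)"

end

theory Submission
  imports Defs
begin

text \<open>
  The solution is found by the direct method: it minimises the Dirichlet modular
  \<open>\<integral> |\<nabla>u|\<^sup>p / p\<close> over all \<open>u = \<phi> + v\<close> with \<open>v\<close> in the space \<open>V0\<close> of zero boundary values. The
  modular of \<open>\<nabla>\<phi>\<close> is finite, so the infimum is finite. Since \<open>p\<close> may be unbounded, neither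
  reflexivity nor invariance of modular convergence under scaling is available, and each of the
  usual steps needs a modular replacement.

  Compactness comes from uniform convexity. The minimal exponent \<open>q = inf p\<close> exceeds 1, so the powers
  \<open>|\<cdot>|\<^sup>r\<close> with \<open>r \<ge> q\<close> are uniformly convex with constants that depend only on \<open>q\<close>
  (\<open>norm_powr_uniform_convexity\<close>). The midpoint of two members of a minimising sequence is again
  admissible, and therefore the halved differences of their gradients tend to 0 in the modular
  (\<open>minimising_sequence_Cauchy\<close>).

  This controls only the gradients. Because \<open>q\<close> exceeds the dimension, the functions themselves are
  controlled uniformly: on a bounded domain a test function is bounded in terms of the \<open>L\<^sup>q\<close> norm of its
  gradient (\<open>test_function_sup_bound\<close>), and smallness of the modular implies smallness in \<open>L\<^sup>q\<close>
  (\<open>modular_small_imp_Lq_small\<close>). Every element of \<open>V0\<close> is a \<open>W\<^sup>1\<^sup>,\<^sup>q\<close> limit of test functions, as this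
  property is preserved by modular limits, and so the bound extends to \<open>V0\<close> (\<open>V0_sup_bound\<close>). The
  minimising sequence thus converges uniformly, and its gradients converge almost everywhere along a
  subsequence.

  The limit must be shown to belong to \<open>V0\<close>, although only halves converge in the modular. This is where
  the closure in the definition of \<open>V0\<close> helps: \<open>V0\<close> is stable under addition (\<open>V0_add\<close>), because
  translates of closed sets are closed. Hence a function belongs to \<open>V0\<close> as soon as its half does
  (\<open>V0_complete\<close>). Fatou's lemma then shows that the limit is a minimiser.

  The Euler-Lagrange equation follows from the tangent inequality for \<open>|\<cdot>|\<^sup>p / p\<close> and dominated
  convergence, since \<open>p\<close> is bounded on the compact support of a test function
  (\<open>first_variation\<close>).
\<close>

section \<open>Smooth functions with compact support\<close>

lemma C_k_on_SucD: "C_k_on (Suc k) UNIV f \<Longrightarrow> C_k_on k UNIV f"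
proof (induction k arbitrary: f)
  case 0
  then show ?case
    by (auto intro!: differentiable_imp_continuous_on simp: differentiable_on_def)
next
  case (Suc k)
  then show ?case by (metis C_k_on.simps(2))
qed

lemma C_k_on_add:
  "C_k_on k UNIV f \<Longrightarrow> C_k_on k UNIV g \<Longrightarrow> C_k_on k UNIV (\<lambda>x. f x + g x)"
proof (induction k arbitrary: f g)
  case 0
  then show ?case by (auto intro!: continuous_intros)
next
  case (Suc k)
  have eq: "frechet_derivative (\<lambda>x. f x + g x) (at x) = 
      (\<lambda>b. frechet_derivative f (at x) b + frechet_derivative g (at x) b)" for x
    using Suc.prems by (intro frechet_derivative_at[symmetric] has_derivative_add)
      (auto simp: frechet_derivative_works[symmetric])
  show ?case using Suc by (auto simp: eq)
qed

lemma C_k_on_const: "C_k_on k UNIV (\<lambda>x. c)"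
  by (induction k arbitrary: c) (auto simp: frechet_derivative_const)

lemma C_k_on_mult:
  "C_k_on k UNIV f \<Longrightarrow> C_k_on k UNIV g \<Longrightarrow> C_k_on k UNIV (\<lambda>x. f x * g x)"
proof (induction k arbitrary: f g)
  case 0
  then show ?case by (auto intro!: continuous_intros)
next
  case (Suc k)
  have eq: "frechet_derivative (\<lambda>x. f x * g x) (at x) = 
      (\<lambda>b. f x * frechet_derivative g (at x) b + frechet_derivative f (at x) b * g x)" for x
    using Suc.prems by (intro frechet_derivative_at[symmetric] has_derivative_mult)
      (auto simp: frechet_derivative_works[symmetric])
  have "C_k_on k UNIV f" "C_k_on k UNIV g"
    using Suc.prems by (blast intro: C_k_on_SucD)+
  then show ?case using Suc by (auto simp: eq intro!: C_k_on_add)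
qed

lemma C_k_on_prod:
  "(\<And>i. i \<in> I \<Longrightarrow> C_k_on k UNIV (f i)) \<Longrightarrow> C_k_on k UNIV (\<lambda>x. \<Prod>i\<in>I. f i x)"
  by (induction I rule: infinite_finite_induct) (auto intro: C_k_on_const C_k_on_mult)

text \<open>
  The factors \<open>t\<^sup>-\<^sup>m\<close> make the family closed under differentiation up to linear combinations, so that
  smoothness of \<open>exp (- 1 / t)\<close> is a single induction over all \<open>m\<close>.
\<close>

definition flat_exp :: "nat \<Rightarrow> real \<Rightarrow> real" where
  "flat_exp m t = (if t > 0 then exp (- 1 / t) / t ^ m else 0)"

lemma flat_exp_tendsto_0: "(flat_exp m \<longlongrightarrow> 0) (at 0)"
proof -
  have "((\<lambda>t. inverse t ^ m / exp (inverse t)) \<longlongrightarrow> 0) (at_right (0::real))"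
    by (rule filterlim_compose[OF tendsto_power_div_exp_0 filterlim_inverse_at_top_right])
  then have "(flat_exp m \<longlongrightarrow> 0) (at_right 0)"
    by (rule Lim_transform_eventually)
      (auto simp: eventually_at_filter flat_exp_def exp_minus field_simps power_divide)
  moreover have "(flat_exp m \<longlongrightarrow> 0) (at_left 0)"
    by (rule Lim_transform_eventually[OF tendsto_const]) (auto simp: eventually_at_filter flat_exp_def)
  ultimately show ?thesis by (simp add: filterlim_split_at)
qed

lemma flat_exp_deriv:
  "(flat_exp m has_real_derivative (flat_exp (m + 2) t - real m * flat_exp (Suc m) t)) (at t)"
proof -
  consider "t > 0" | "t < 0" | "t = 0" by linarith
  then show ?thesis
  proof cases
    case 1
    have "((\<lambda>t. exp (- inverse t) * inverse t ^ m) has_real_derivative 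
      exp (- inverse t) * (inverse t ^ 2) * inverse t ^ m
       - exp (- inverse t) * (real m * inverse t ^ (m - 1) * inverse t ^ 2)) (at t)"
      using 1 by (auto intro!: derivative_eq_intros simp: power2_eq_square)
    moreover have "real m * inverse t ^ (m - 1) * inverse t ^ 2 = real m * inverse t ^ Suc m"
      by (cases m) (auto simp: power2_eq_square)
    moreover have "exp (- inverse t) * (inverse t ^ 2) * inverse t ^ m = flat_exp (m + 2) t"
      using 1 by (simp add: flat_exp_def divide_inverse power_inverse power2_eq_square)
    moreover have "exp (- inverse t) * (real m * inverse t ^ Suc m) = real m * flat_exp (Suc m) t"
      using 1 by (simp add: flat_exp_def divide_inverse power_inverse)
    ultimately have "((\<lambda>t. exp (- inverse t) * inverse t ^ m) has_real_derivative 
      (flat_exp (m + 2) t - real m * flat_exp (Suc m) t)) (at t)"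
      by (simp only:)
    then have D: "((\<lambda>t. exp (- 1 / t) / t ^ m) has_real_derivative 
      (flat_exp (m + 2) t - real m * flat_exp (Suc m) t)) (at t)"
      by (simp add: divide_inverse power_inverse)
    have "eventually (\<lambda>s. s \<in> {0<..}) (nhds t)"
      using 1 by (intro eventually_nhds_in_open) auto
    then have ev: "eventually (\<lambda>s. exp (- 1 / s) / s ^ m = flat_exp m s) (nhds t)"
      by (auto elim!: eventually_mono simp: flat_exp_def)
    show ?thesis using D DERIV_cong_ev[OF refl ev refl] by blast
  next
    case 2
    have D: "((\<lambda>t. 0) has_real_derivative (flat_exp (m + 2) t - real m * flat_exp (Suc m) t)) (at t)"
      using 2 by (auto simp: flat_exp_def)
    have "eventually (\<lambda>s. s \<in> {..<0}) (nhds t)"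
      using 2 by (intro eventually_nhds_in_open) auto
    then have ev: "eventually (\<lambda>s. 0 = flat_exp m s) (nhds t)"
      by (auto elim!: eventually_mono simp: flat_exp_def)
    show ?thesis using D DERIV_cong_ev[OF refl ev refl] by blast
  next
    case 3
    have "((\<lambda>h. (flat_exp m (0 + h) - flat_exp m 0) / h) \<longlongrightarrow> 0) (at 0)"
      by (rule Lim_transform_eventually[OF flat_exp_tendsto_0[of "Suc m"]])
        (auto simp: eventually_at_filter flat_exp_def field_simps)
    then show ?thesis using 3 by (simp add: DERIV_def flat_exp_def)
  qed
qed

text \<open>
  The chain rule is built into the statement: composing with an affine functional keeps the induction
  on \<open>k\<close> going, because the derivative has the same form with larger \<open>m\<close>.
\<close>

lemma C_k_on_flat_exp: "C_k_on k UNIV (\<lambda>x. flat_exp m (x \<bullet> v + d))"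
proof (induction k arbitrary: m)
  case 0
  have "continuous_on UNIV (flat_exp m)"
    by (meson DERIV_isCont continuous_at_imp_continuous_on flat_exp_deriv)
  then show ?case 
    by (auto intro!: continuous_on_compose2[of UNIV "flat_exp m"] continuous_intros)
next
  case (Suc k)
  let ?D = "\<lambda>x. flat_exp (m + 2) (x \<bullet> v + d) - real m * flat_exp (Suc m) (x \<bullet> v + d)"
  have D: "((\<lambda>x. flat_exp m (x \<bullet> v + d)) has_derivative (\<lambda>b. ?D x * (b \<bullet> v))) (at x)" for x
  proof -
    have "(flat_exp m has_derivative (*) (?D x)) (at (x \<bullet> v + d))"
      using flat_exp_deriv[of m "x \<bullet> v + d"] by (simp add: has_field_derivative_def)
    moreover have "((\<lambda>x. x \<bullet> v + d) has_derivative (\<lambda>b. b \<bullet> v)) (at x)"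
      by (auto intro!: derivative_eq_intros)
    ultimately show ?thesis by (rule has_derivative_compose[rotated])
  qed
  have eq: "frechet_derivative (\<lambda>x. flat_exp m (x \<bullet> v + d)) (at x) = (\<lambda>b. ?D x * (b \<bullet> v))" for x
    using frechet_derivative_at[OF D] by simp
  have "C_k_on k UNIV (\<lambda>x. (flat_exp (m + 2) (x \<bullet> v + d) + (- real m) * flat_exp (Suc m) (x \<bullet> v + d)) * (b \<bullet> v))" for b
    by (intro C_k_on_mult C_k_on_add C_k_on_const Suc)
  then show ?case using D by (auto simp: eq differentiable_def)
qed

lemma test_functions_add:
  assumes "h \<in> test_functions S" "k \<in> test_functions S"
  shows "(\<lambda>x. h x + k x) \<in> test_functions S"
proof -
  let ?K = "closure {x. h x \<noteq> 0} \<union> closure {x. k x \<noteq> 0}"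
  have K: "compact ?K" "?K \<subseteq> S" using assms by (auto simp: test_functions_def)
  have "{x. h x + k x \<noteq> 0} \<subseteq> {x. h x \<noteq> 0} \<union> {x. k x \<noteq> 0}" by auto
  then have sub: "closure {x. h x + k x \<noteq> 0} \<subseteq> ?K"
    using closure_mono by (metis closure_Un)
  have "compact (closure {x. h x + k x \<noteq> 0})"
    using compact_Int_closed[OF K(1) closed_closure, of "{x. h x + k x \<noteq> 0}"] sub
    by (simp add: inf.absorb2)
  with K sub assms show ?thesis
    by (auto simp: test_functions_def intro!: C_k_on_add)
qed

lemma test_functions_scale:
  assumes "h \<in> test_functions S"
  shows "(\<lambda>x. c * h x) \<in> test_functions S"
proof (cases "c = 0")
  case False
  then show ?thesis using assms
    by (auto simp: test_functions_def intro!: C_k_on_mult C_k_on_const)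
qed (simp add: test_functions_def C_k_on_const)

text \<open>
  As \<open>j\<close> grows, \<open>flat_exp 0 (j t)\<close> tends to the indicator of \<open>t > 0\<close>, so these smooth functions
  increase to the indicator of the open box.
\<close>

definition bump :: "nat \<Rightarrow> 'a::euclidean_space \<Rightarrow> 'a \<Rightarrow> 'a \<Rightarrow> real" where
  "bump j a c x = (\<Prod>b\<in>Basis. flat_exp 0 (real (Suc j) * (x \<bullet> b - a \<bullet> b)) *
     flat_exp 0 (real (Suc j) * (c \<bullet> b - x \<bullet> b)))"

lemma flat_exp_0_bounds: "0 \<le> flat_exp 0 t" "flat_exp 0 t \<le> 1" "flat_exp 0 t = 0 \<longleftrightarrow> t \<le> 0"
  by (auto simp: flat_exp_def)

lemma bump_bounds: "0 \<le> bump j a c x" "bump j a c x \<le> indicator (box a c) x"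
proof -
  show "0 \<le> bump j a c x"
    unfolding bump_def by (intro prod_nonneg mult_nonneg_nonneg) (auto simp: flat_exp_0_bounds)
  have "bump j a c x \<le> 1"
    unfolding bump_def
    by (intro prod_le_1) (auto simp: flat_exp_0_bounds intro!: mult_le_one)
  moreover have "bump j a c x = 0" if x: "x \<notin> box a c"
  proof -
    obtain b where "b \<in> Basis" "\<not> (a \<bullet> b < x \<bullet> b \<and> x \<bullet> b < c \<bullet> b)"
      using x by (auto simp: mem_box)
    then show ?thesis unfolding bump_def
      by (auto simp: prod_zero_iff flat_exp_0_bounds mult_le_0_iff not_less intro!: bexI[of _ b])
  qed
  ultimately show "bump j a c x \<le> indicator (box a c) x"
    by (auto simp: indicator_def)
qed

lemma bump_tendsto: "(\<lambda>j. bump j a c x) \<longlonglongrightarrow> indicator (box a c) x"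
proof (cases "x \<in> box a c")
  case True
  have lim: "(\<lambda>j. flat_exp 0 (real (Suc j) * t)) \<longlonglongrightarrow> 1" if "t > 0" for t
  proof -
    have "(\<lambda>j. exp (- (inverse (real (Suc j)) * inverse t))) \<longlonglongrightarrow> exp (- (0 * inverse t))"
      by (intro tendsto_intros LIMSEQ_inverse_real_of_nat)
    then have "(\<lambda>j. exp (- 1 / (real (Suc j) * t))) \<longlonglongrightarrow> 1" by (simp add: field_simps)
    moreover have "flat_exp 0 (real (Suc j) * t) = exp (- 1 / (real (Suc j) * t))" for j
      using that by (simp add: flat_exp_def del: of_nat_Suc)
    ultimately show ?thesis by (simp del: of_nat_Suc)
  qed
  have "(\<lambda>j. bump j a c x) \<longlonglongrightarrow> (\<Prod>b\<in>(Basis::'a set). 1 * 1)"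
    unfolding bump_def using True
    by (intro tendsto_prod tendsto_mult lim) (auto simp: mem_box)
  then show ?thesis using True by simp
next
  case False
  then have "bump j a c x = 0" for j
    using bump_bounds[of j a c x] by simp
  then show ?thesis using False by simp
qed

lemma bump_test_function:
  assumes "cbox a c \<subseteq> S"
  shows "bump j a c \<in> test_functions S"
proof -
  have "C_k_on k UNIV (bump j a c)" for k
  proof -
    have "C_k_on k UNIV (\<lambda>x. flat_exp 0 (real (Suc j) * (x \<bullet> b - a \<bullet> b)) *
     flat_exp 0 (real (Suc j) * (c \<bullet> b - x \<bullet> b)))" for b
    proof -
      have "(\<lambda>x. flat_exp 0 (real (Suc j) * (x \<bullet> b - a \<bullet> b))) =
          (\<lambda>x. flat_exp 0 (x \<bullet> (real (Suc j) *\<^sub>R b) + (- real (Suc j) * (a \<bullet> b))))"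
        by (simp add: algebra_simps)
      moreover have "(\<lambda>x. flat_exp 0 (real (Suc j) * (c \<bullet> b - x \<bullet> b))) =
          (\<lambda>x. flat_exp 0 (x \<bullet> (- real (Suc j) *\<^sub>R b) + (real (Suc j) * (c \<bullet> b))))"
        by (simp add: algebra_simps)
      ultimately show ?thesis
        by (intro C_k_on_mult) (simp_all only: C_k_on_flat_exp)
    qed
    then show ?thesis unfolding bump_def by (intro C_k_on_prod) auto
  qed
  moreover have sub: "closure {x. bump j a c x \<noteq> 0} \<subseteq> cbox a c"
  proof (intro closure_minimal subsetI)
    fix x assume "x \<in> {x. bump j a c x \<noteq> 0}"
    then have "x \<in> box a c"
      using bump_bounds[of j a c x] by (cases "x \<in> box a c") auto
    then show "x \<in> cbox a c" using box_subset_cbox by auto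
  qed (rule closed_cbox)
  moreover have "compact (closure {x. bump j a c x \<noteq> 0})"
    using compact_Int_closed[OF compact_cbox closed_closure, of a c "{x. bump j a c x \<noteq> 0}"] sub
    by (simp add: inf.absorb2)
  ultimately show ?thesis using assms by (auto simp: test_functions_def)
qed

section \<open>Uniqueness and linearity of weak gradients\<close>

text \<open>
  The open boxes are an intersection-stable generator of the Borel sets, so vanishing integrals over
  boxes propagate to all Borel sets, where densities are unique.
\<close>

lemma set_integral_box_eq_0_imp_AE_0:
  fixes f :: "'a::euclidean_space \<Rightarrow> 'b::{banach, second_countable_topology}"
  assumes f: "integrable lborel f"
    and box: "\<And>a c. set_lebesgue_integral lborel (box a c) f = 0"
  shows "AE x in lborel. f x = 0"
proof (rule sigma_finite_measure.density_zero[OF sigma_finite_lborel f])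
  have si: "set_integrable lborel A f" if "A \<in> sets lborel" for A
    using f that by (simp add: set_integrable_def integrable_mult_indicator)
  have UNIV0: "set_lebesgue_integral lborel UNIV f = 0"
  proof -
    define B where "B n = box (- (real n *\<^sub>R One)) (real n *\<^sub>R One :: 'a)" for n :: nat
    have U: "(\<Union>n. B n) = UNIV"
      unfolding B_def by (rule UN_box_eq_UNIV)
    have "incseq B"
      by (auto simp: incseq_def B_def subset_box)
    moreover have "B n \<in> sets lborel" for n by (simp add: B_def)
    moreover have "set_integrable lborel (\<Union>n. B n) f" using U si by simp
    ultimately have "(\<lambda>n. set_lebesgue_integral lborel (B n) f) \<longlonglongrightarrow> set_lebesgue_integral lborel (\<Union>n. B n) f"
      by (intro set_integral_cont_up)
    then show ?thesis using U box by (simp add: B_def LIMSEQ_const_iff)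
  qed
  fix A :: "'a set" assume "A \<in> sets lborel"
  then have A: "A \<in> sigma_sets UNIV (range (\<lambda>(a, b). box a b :: 'a set))"
    by (simp add: borel_eq_box)
  have "Int_stable (range (\<lambda>(a, b). box a b :: 'a set))"
    by (auto simp: Int_stable_def box_Int_box)
  moreover have "range (\<lambda>(a, b). box a b :: 'a set) \<subseteq> Pow UNIV" by simp
  ultimately show "set_lebesgue_integral lborel A f = 0" using A
  proof (induction rule: sigma_sets_induct_disjoint)
    case (basic A)
    then show ?case using box by auto
  next
    case empty
    show ?case by (simp add: set_lebesgue_integral_def)
  next
    case (compl A)
    then have A: "A \<in> sets lborel" by (simp add: borel_eq_box)
    have "set_lebesgue_integral lborel (A \<union> (UNIV - A)) f =
       set_lebesgue_integral lborel A f + set_lebesgue_integral lborel (UNIV - A) f"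
      using A by (intro set_integral_Un si) auto
    then show ?case using compl UNIV0 by simp
  next
    case (union A)
    then have A: "A i \<in> sets lborel" for i by (auto simp: borel_eq_box)
    have "set_lebesgue_integral lborel (\<Union>i. A i) f = (\<Sum>i. set_lebesgue_integral lborel (A i) f)"
      using A union(1) by (intro lebesgue_integral_countable_add si) (auto simp: disjoint_family_on_def)
    then show ?case using union by simp
  qed
qed

lemma test_functions_continuous: 
  assumes "h \<in> test_functions S"
  shows "continuous_on UNIV h" "h \<in> borel_measurable borel"
proof -
  have "C_k_on 0 UNIV h" using assms unfolding test_functions_def by blast
  then show "continuous_on UNIV h" by simp
  then show "h \<in> borel_measurable borel" by (rule borel_measurable_continuous_onI)
qed

text \<open>
  Testing with the bumps and letting them tend to the indicator of a box shows that \<open>f\<close> has zero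
  integral over every open box inside a compact box of \<open>S\<close>.
\<close>

lemma fundamental_lemma_of_calculus_of_variations:
  fixes f :: "'a::euclidean_space \<Rightarrow> real"
  assumes "open S" and f: "locally_integrable_on S f"
    and 0: "\<And>h. h \<in> test_functions S \<Longrightarrow> (LINT x:S|lborel. f x * h x) = 0"
  shows "AE x in lborel. x \<in> S \<longrightarrow> f x = 0"
proof -
  have K: "AE x in lborel. x \<in> cbox a c \<longrightarrow> f x = 0" if K: "cbox a c \<subseteq> S" for a c
  proof -
    define F where "F x = indicator (cbox a c) x *\<^sub>R f x" for x
    have F: "integrable lborel F"
      using f K compact_cbox unfolding locally_integrable_on_def set_integrable_def F_def by blast
    have "AE x in lborel. F x = 0"
    proof (rule set_integral_box_eq_0_imp_AE_0[OF F])
      fix a' c' :: 'a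
      have AE: "AE x in lborel. x \<in> cbox a c \<longleftrightarrow> x \<in> box a c"
      proof -
        have "emeasure lborel (cbox a c - box a c) = emeasure lborel (cbox a c) - emeasure lborel (box a c)"
          by (rule emeasure_Diff) (auto simp: emeasure_lborel_box_eq box_subset_cbox)
        also have "\<dots> = 0" by (simp add: emeasure_lborel_box_eq emeasure_lborel_cbox_eq)
        finally have "cbox a c - box a c \<in> null_sets lborel" by auto
        from AE_not_in[OF this] show ?thesis 
          using box_subset_cbox[of a c] by (auto elim!: eventually_mono)
      qed
      obtain a2 c2 where B: "box a c \<inter> box a' c' = box a2 c2" by (rule that[OF box_Int_box])
      have "set_lebesgue_integral lborel (box a' c') F = (LINT x|lborel. indicator (box a2 c2) x *\<^sub>R f x)"
        unfolding set_lebesgue_integral_def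
      proof (rule integral_cong_AE)
        have "(\<lambda>x. indicator (box a2 c2) x *\<^sub>R F x) = (\<lambda>x. indicator (box a2 c2) x *\<^sub>R f x)"
          using B box_subset_cbox[of a c] by (auto simp: F_def fun_eq_iff indicator_def)
        then show "(\<lambda>x. indicator (box a2 c2) x *\<^sub>R f x) \<in> borel_measurable lborel"
          using borel_measurable_integrable[OF F] 
            borel_measurable_scaleR[of "indicator (box a2 c2)" lborel F] by simp
        show "AE x in lborel. indicator (box a' c') x *\<^sub>R F x = indicator (box a2 c2) x *\<^sub>R f x"
          using AE B[symmetric] by (auto simp: F_def indicator_def elim!: eventually_mono)
      qed (use borel_measurable_integrable[OF F] in measurable)
      also have "\<dots> = 0"
      proof (cases "box a2 c2 = {}")
        case False
        have sub: "cbox a2 c2 \<subseteq> cbox a c"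
          using closure_mono[of "box a2 c2" "cbox a c"] B box_subset_cbox[of a c] closure_box[OF False]
          by auto
        have eq: "indicator S x *\<^sub>R (f x * bump j a2 c2 x) = bump j a2 c2 x * F x" for x j
          using bump_bounds[of j a2 c2 x] B box_subset_cbox[of a c] K
          by (cases "x \<in> box a2 c2") (auto simp: F_def indicator_def)
        have "(\<lambda>j. LINT x|lborel. bump j a2 c2 x * F x) \<longlonglongrightarrow> (LINT x|lborel. indicator (box a2 c2) x * F x)"
        proof (rule integral_dominated_convergence)
          show "integrable lborel (\<lambda>x. norm (F x))" using F by simp
          have [measurable]: "F \<in> borel_measurable borel" using borel_measurable_integrable[OF F] by simp
          show "(\<lambda>x. indicat_real (box a2 c2) x * F x) \<in> borel_measurable lborel" by measurable
          have "bump j a2 c2 \<in> borel_measurable borel" for j 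
            using test_functions_continuous(2)[OF bump_test_function[of a2 c2 S]] sub K by blast
          then show "(\<lambda>x. bump j a2 c2 x * F x) \<in> borel_measurable lborel" for j by measurable
          show "AE x in lborel. (\<lambda>j. bump j a2 c2 x * F x) \<longlonglongrightarrow> indicat_real (box a2 c2) x * F x"
            by (intro AE_I2 tendsto_mult bump_tendsto tendsto_const)
          show "AE x in lborel. norm (bump j a2 c2 x * F x) \<le> norm (F x)" for j
          proof (rule AE_I2)
            fix x
            have "bump j a2 c2 x \<le> 1"
              using bump_bounds(2)[of j a2 c2 x] by (rule order_trans) (simp add: indicator_def)
            then show "norm (bump j a2 c2 x * F x) \<le> norm (F x)"
              using bump_bounds(1)[of j a2 c2 x] by (simp add: abs_mult mult_left_le_one_le)
          qed
        qed
        moreover have "(LINT x|lborel. bump j a2 c2 x * F x) = 0" for j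
          using 0[OF bump_test_function[of a2 c2 S j]] sub K unfolding set_lebesgue_integral_def eq by auto
        ultimately have "(LINT x|lborel. indicator (box a2 c2) x * F x) = 0"
          by (simp add: LIMSEQ_const_iff)
        moreover have "indicator (box a2 c2) x * F x = indicator (box a2 c2) x *\<^sub>R f x" for x
          using B box_subset_cbox[of a c] by (auto simp: F_def indicator_def)
        ultimately show ?thesis by simp
      qed simp
      finally show "set_lebesgue_integral lborel (box a' c') F = 0" .
    qed
    then show ?thesis by (auto simp: F_def elim!: eventually_mono)
  qed
  obtain D where D: "countable D" "D \<subseteq> Pow S" "\<And>X. X \<in> D \<Longrightarrow> \<exists>a b. X = cbox a b" "\<Union>D = S"
    using open_countable_Union_open_cbox[OF \<open>open S\<close>] by metis
  have "AE x in lborel. \<forall>X\<in>D. x \<in> X \<longrightarrow> f x = 0"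
    using D by (subst AE_ball_countable) (auto, metis K PowD subset_eq)
  then show ?thesis using D(4) by (auto elim!: eventually_mono)
qed

lemma test_functions_mult:
  assumes "h \<in> test_functions S" "k \<in> test_functions S"
  shows "(\<lambda>x. h x * k x) \<in> test_functions S"
proof -
  have sub: "closure {x. h x * k x \<noteq> 0} \<subseteq> closure {x. h x \<noteq> 0}"
    by (rule closure_mono) auto
  moreover have "compact (closure {x. h x * k x \<noteq> 0})"
    using compact_Int_closed[OF _ closed_closure, of "closure {x. h x \<noteq> 0}" "{x. h x * k x \<noteq> 0}"] 
      sub assms by (simp add: inf.absorb2 test_functions_def)
  ultimately show ?thesis using assms
    by (auto simp: test_functions_def intro!: C_k_on_mult)
qed

lemma test_functions_differentiable: "h \<in> test_functions S \<Longrightarrow> h differentiable (at x)"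
proof -
  assume "h \<in> test_functions S"
  then have "C_k_on (Suc 0) UNIV h" unfolding test_functions_def by blast
  then show ?thesis by simp
qed

lemma gradient_inner:
  fixes h :: "'a::euclidean_space \<Rightarrow> real"
  assumes "h differentiable (at x)"
  shows "gradient h x \<bullet> v = frechet_derivative h (at x) v"
proof -
  interpret bounded_linear "frechet_derivative h (at x)"
    using assms by (simp add: frechet_derivative_works has_derivative_bounded_linear)
  have "frechet_derivative h (at x) v = frechet_derivative h (at x) (\<Sum>b\<in>Basis. (v \<bullet> b) *\<^sub>R b)"
    by (simp add: euclidean_representation)
  also have "\<dots> = (\<Sum>b\<in>Basis. (v \<bullet> b) * frechet_derivative h (at x) b)"
    by (simp add: sum scaleR)
  also have "\<dots> = gradient h x \<bullet> v"
    unfolding gradient_def inner_sum_left by (intro sum.cong) (auto simp: inner_commute)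
  finally show ?thesis by simp
qed

lemma gradient_has_derivative:
  fixes h :: "'a::euclidean_space \<Rightarrow> real"
  assumes "h differentiable (at x)"
  shows "(h has_derivative (\<lambda>v. gradient h x \<bullet> v)) (at x)"
  using assms by (simp add: frechet_derivative_works gradient_inner[OF assms])

lemma gradient_eqI:
  fixes h :: "'a::euclidean_space \<Rightarrow> real"
  assumes "(h has_derivative (\<lambda>v. g \<bullet> v)) (at x)"
  shows "gradient h x = g"
proof -
  have "h differentiable (at x)" using assms by (auto simp: differentiable_def)
  then have "gradient h x \<bullet> v = g \<bullet> v" for v
    using frechet_derivative_at[OF assms] gradient_inner[of h x v] by metis
  then show ?thesis by (metis inner_commute vector_eq_ldot)
qed

lemma gradient_scale:
  assumes "h differentiable (at x)"
  shows "gradient (\<lambda>x. c * h x) x = c *\<^sub>R gradient h x"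
  by (rule gradient_eqI) (auto intro!: derivative_eq_intros gradient_has_derivative assms)

lemma gradient_mult:
  assumes "h differentiable (at x)" "k differentiable (at x)"
  shows "gradient (\<lambda>x. h x * k x) x = h x *\<^sub>R gradient k x + k x *\<^sub>R gradient h x"
  by (rule gradient_eqI) (auto intro!: derivative_eq_intros gradient_has_derivative assms 
      simp: inner_add_left algebra_simps)

lemma continuous_on_gradient:
  assumes "h \<in> test_functions S"
  shows "continuous_on UNIV (gradient h)"
proof -
  have "C_k_on (Suc 0) UNIV h" using assms unfolding test_functions_def by blast
  then show ?thesis unfolding gradient_def[abs_def] by (auto intro!: continuous_intros)
qed

lemma gradient_0_outside_support:
  fixes h :: "'a::euclidean_space \<Rightarrow> real"
  assumes "x \<notin> closure {x. h x \<noteq> 0}"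
  shows "gradient h x = 0"
proof (rule gradient_eqI)
  have "((\<lambda>x. 0) has_derivative (\<lambda>v. 0 \<bullet> v)) (at x)" by simp
  moreover have "open (- closure {x. h x \<noteq> 0})" by auto
  ultimately show "(h has_derivative (\<lambda>v. 0 \<bullet> v)) (at x)"
    by (rule has_derivative_transform_within_open)
      (use assms closure_subset[of "{x. h x \<noteq> 0}"] in auto)
qed

lemma bounded_gradient:
  fixes h :: "'a::euclidean_space \<Rightarrow> real"
  assumes h: "h \<in> test_functions S"
  obtains M where "M > 0" "\<And>x. norm (gradient h x) \<le> M" "\<And>x. \<bar>h x\<bar> \<le> M"
proof -
  let ?K = "closure {x. h x \<noteq> 0}"
  have K: "compact ?K" using h by (simp add: test_functions_def)
  have "compact (gradient h ` ?K)" "compact (h ` ?K)"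
    using K h by (auto intro!: compact_continuous_image 
        continuous_on_subset[OF continuous_on_gradient] continuous_on_subset[OF test_functions_continuous(1)])
  then obtain M N where M: "\<forall>x\<in>?K. norm (gradient h x) \<le> M" "\<forall>x\<in>?K. \<bar>h x\<bar> \<le> N"
    by (fastforce dest!: compact_imp_bounded simp: bounded_iff)
  show ?thesis
  proof (rule that[of "max 1 (max M N)"])
    fix x show "norm (gradient h x) \<le> max 1 (max M N)" "\<bar>h x\<bar> \<le> max 1 (max M N)"
      using M gradient_0_outside_support[of x h] closure_subset[of "{x. h x \<noteq> 0}"]
      by (cases "x \<in> ?K"; force)+
  qed simp
qed

lemma lborel_integral_translate:
  fixes f :: "'a::euclidean_space \<Rightarrow> real"
  shows "(LINT x|lborel. f (x + c)) = (LINT x|lborel. f x)"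
proof (cases "f \<in> borel_measurable borel")
  case True
  then have "(LINT x|distr lborel borel ((+) c). f x) = (LINT x|lborel. f (c + x))"
    by (intro integral_distr) auto
  then show ?thesis by (simp add: lborel_distr_plus add.commute)
next
  case False
  have "(\<lambda>x. f (x + c)) \<notin> borel_measurable borel"
  proof
    assume "(\<lambda>x. f (x + c)) \<in> borel_measurable borel"
    then have "(\<lambda>x. f (x - c + c)) \<in> borel_measurable borel"
      by (rule measurable_compose[rotated]) auto
    with False show False by simp
  qed
  then have "\<not> integrable lborel (\<lambda>x. f (x + c))" "\<not> integrable lborel f"
    using False borel_measurable_integrable by force+
  then show ?thesis by (simp add: not_integrable_integral_eq)
qed

text \<open>
  By translation invariance of Lebesgue measure each difference quotient has integral 0, and the
  quotients are dominated on a fixed ball. Applied to a product of two test functions, this is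
  integration by parts.
\<close>

lemma integral_gradient_test_function:
  fixes h :: "'a::euclidean_space \<Rightarrow> real"
  assumes h: "h \<in> test_functions S" and b: "b \<in> Basis"
  shows "(LINT x|lborel. gradient h x \<bullet> b) = 0"
proof -
  let ?K = "closure {x. h x \<noteq> 0}"
  have "bounded ?K" using h by (auto simp: test_functions_def compact_imp_bounded)
  then obtain R where R: "\<And>x. x \<in> ?K \<Longrightarrow> norm x \<le> R" by (auto simp: bounded_iff)
  obtain M where M: "M > 0" "\<And>x. norm (gradient h x) \<le> M" "\<And>x. \<bar>h x\<bar> \<le> M"
    using bounded_gradient[OF h] by blast
  have [measurable]: "h \<in> borel_measurable borel" "gradient h \<in> borel_measurable borel"
    using test_functions_continuous[OF h] continuous_on_gradient[OF h] 
    by (auto intro: borel_measurable_continuous_onI)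
  have lip: "\<bar>h x - h y\<bar> \<le> M * norm (x - y)" for x y
  proof -
    have "norm (h x - h y) \<le> M * norm (x - y)"
    proof (rule differentiable_bound[where S = UNIV and f' = "\<lambda>x v. gradient h x \<bullet> v"])
      fix x :: 'a
      show "(h has_derivative (\<lambda>v. gradient h x \<bullet> v)) (at x within UNIV)"
        using gradient_has_derivative[OF test_functions_differentiable[OF h]] .
      show "onorm (\<lambda>v. gradient h x \<bullet> v) \<le> M"
        using order_trans[OF Cauchy_Schwarz_ineq2 mult_right_mono[OF M(2) norm_ge_zero]]
        by (intro onorm_le) auto
    qed auto
    then show ?thesis by simp
  qed
  define q where "q n x = real (Suc n) * (h (x + inverse (real (Suc n)) *\<^sub>R b) - h x)" for n x
  have int: "integrable lborel (\<lambda>x. h (x + c))" for c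
  proof -
    have "integrable lborel (\<lambda>x. indicator (cball 0 (R + norm c)) x * M)"
      by (intro integrable_mult_left integrable_real_indicator emeasure_bounded_finite) auto
    then show ?thesis
    proof (rule Bochner_Integration.integrable_bound)
      show "AE x in lborel. norm (h (x + c)) \<le> norm (indicat_real (cball 0 (R + norm c)) x * M)"
      proof (rule AE_I2)
        fix x
        show "norm (h (x + c)) \<le> norm (indicat_real (cball 0 (R + norm c)) x * M)"
        proof (cases "norm x \<le> R + norm c")
          case True
          then show ?thesis using M by simp
        next
          case False
          then have "norm (x + c) > R" using norm_triangle_ineq[of "x + c" "- c"] by simp
          then have "h (x + c) = 0" using R[of "x + c"] closure_subset[of "{x. h x \<noteq> 0}"] by force
          then show ?thesis by simp
        qed
      qed
    qed measurable
  qed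
  have "(LINT x|lborel. q n x) = 0" for n
    unfolding q_def using int[of 0] int[of "inverse (real (Suc n)) *\<^sub>R b"]
    by (simp add: lborel_integral_translate)
  moreover have "(\<lambda>n. LINT x|lborel. q n x) \<longlonglongrightarrow> (LINT x|lborel. gradient h x \<bullet> b)"
  proof (rule integral_dominated_convergence)
    show "integrable lborel (\<lambda>x. indicator (cball 0 (R + 1)) x * M :: real)"
      by (intro integrable_mult_left integrable_real_indicator emeasure_bounded_finite) auto
    show "AE x in lborel. (\<lambda>n. q n x) \<longlonglongrightarrow> gradient h x \<bullet> b"
    proof (rule AE_I2)
      fix x
      have "((\<lambda>t. h (x + t *\<^sub>R b)) has_derivative (\<lambda>t. gradient h x \<bullet> (t *\<^sub>R b))) (at 0)"
        by (rule has_derivative_compose[where g = h and s = UNIV, simplified, 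
              of "\<lambda>t. x + t *\<^sub>R b" "\<lambda>t. t *\<^sub>R b" 0 "\<lambda>v. gradient h x \<bullet> v"])
          (auto intro!: derivative_eq_intros gradient_has_derivative test_functions_differentiable[OF h])
      then have "((\<lambda>t. h (x + t *\<^sub>R b)) has_real_derivative gradient h x \<bullet> b) (at 0)"
        unfolding has_field_derivative_def
        by (rule has_derivative_eq_rhs) (simp add: fun_eq_iff mult.commute)
      then have "((\<lambda>t. (h (x + t *\<^sub>R b) - h x) / t) \<longlongrightarrow> gradient h x \<bullet> b) (at 0)"
        by (simp add: DERIV_def)
      moreover have "filterlim (\<lambda>n. inverse (real (Suc n))) (at 0) sequentially"
        using LIMSEQ_inverse_real_of_nat by (auto simp: filterlim_at)
      ultimately have "(\<lambda>n. (h (x + inverse (real (Suc n)) *\<^sub>R b) - h x) / inverse (real (Suc n))) 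
         \<longlonglongrightarrow> gradient h x \<bullet> b"
        by (rule filterlim_compose)
      then show "(\<lambda>n. q n x) \<longlonglongrightarrow> gradient h x \<bullet> b"
        by (simp add: q_def field_simps)
    qed
    show "AE x in lborel. norm (q n x) \<le> indicat_real (cball 0 (R + 1)) x * M" for n
    proof (rule AE_I2)
      fix x
      let ?y = "x + inverse (real (Suc n)) *\<^sub>R b"
      have nb: "norm (inverse (real (Suc n)) *\<^sub>R b) = inverse (real (Suc n))" 
        using b by simp
      show "norm (q n x) \<le> indicat_real (cball 0 (R + 1)) x * M"
      proof (cases "norm x \<le> R + 1")
        case True
        have "\<bar>h ?y - h x\<bar> \<le> M * inverse (real (Suc n))"
          using lip[of ?y x] nb by simp
        then have "real (Suc n) * \<bar>h ?y - h x\<bar> \<le> real (Suc n) * (M * inverse (real (Suc n)))"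
          by (intro mult_left_mono) auto
        also have "\<dots> = M" by (simp del: of_nat_Suc)
        finally show ?thesis using True by (simp add: q_def abs_mult del: of_nat_Suc)
      next
        case False
        have "inverse (real (Suc n)) \<le> 1" by (simp add: field_simps)
        then have "norm ?y > R" "norm x > R" 
          using False norm_triangle_ineq[of ?y "- (inverse (real (Suc n)) *\<^sub>R b)"] nb by (auto simp del: of_nat_Suc)
        then have "h ?y = 0" "h x = 0" 
          using R[of ?y] R[of x] closure_subset[of "{x. h x \<noteq> 0}"] by force+
        then show ?thesis using M(1) by (simp add: q_def)
      qed
    qed
  qed (unfold q_def, measurable)
  ultimately show ?thesis by (simp add: LIMSEQ_const_iff)
qed

lemma test_functions_support:
  assumes "h \<in> test_functions S"
  shows "compact (closure {x. h x \<noteq> 0})" "closure {x. h x \<noteq> 0} \<subseteq> S"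
  using assms by (simp_all add: test_functions_def)

lemma locally_integrable_on_mult_continuous:
  fixes u :: "'a::euclidean_space \<Rightarrow> real" and k :: "'a \<Rightarrow> real"
  assumes u: "locally_integrable_on S u" and K: "compact K" "K \<subseteq> S"
    and k: "continuous_on UNIV k" "\<And>x. x \<notin> K \<Longrightarrow> k x = 0"
  shows "set_integrable lborel S (\<lambda>x. u x * k x)"
proof -
  have [measurable]: "k \<in> borel_measurable borel" 
    using k(1) by (rule borel_measurable_continuous_onI)
  obtain M where M: "\<And>x. x \<in> K \<Longrightarrow> \<bar>k x\<bar> \<le> M"
    using compact_imp_bounded[OF compact_continuous_image[OF continuous_on_subset[OF k(1)] K(1)]]
    by (auto simp: bounded_iff)
  have uK: "integrable lborel (\<lambda>x. indicator K x *\<^sub>R u x)"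
    using u K by (auto simp: locally_integrable_on_def set_integrable_def)
  have "integrable lborel (\<lambda>x. (indicator K x *\<^sub>R u x) * k x)"
  proof (rule Bochner_Integration.integrable_bound)
    show "integrable lborel (\<lambda>x. (indicator K x *\<^sub>R u x) * M)" using uK by simp
    show "(\<lambda>x. (indicator K x *\<^sub>R u x) * k x) \<in> borel_measurable lborel"
      using borel_measurable_integrable[OF uK] by measurable
    show "AE x in lborel. norm ((indicator K x *\<^sub>R u x) * k x) \<le> norm ((indicator K x *\<^sub>R u x) * M)"
    proof (rule AE_I2)
      fix x
      show "norm ((indicator K x *\<^sub>R u x) * k x) \<le> norm ((indicator K x *\<^sub>R u x) * M)"
        using M[of x] by (cases "x \<in> K") (auto simp: abs_mult intro!: mult_left_mono)
    qed
  qed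
  moreover have "(\<lambda>x. (indicator K x *\<^sub>R u x) * k x) = (\<lambda>x. indicator S x *\<^sub>R (u x * k x))"
    using K k(2) by (auto simp: fun_eq_iff indicator_def)
  ultimately show ?thesis by (simp add: set_integrable_def)
qed

lemma locally_integrable_on_add:
  "locally_integrable_on S u \<Longrightarrow> locally_integrable_on S v \<Longrightarrow> locally_integrable_on S (\<lambda>x. u x + v x)"
  by (auto simp: locally_integrable_on_def set_integrable_def scaleR_add_right)

lemma locally_integrable_on_scale:
  "locally_integrable_on S u \<Longrightarrow> locally_integrable_on S (\<lambda>x. (c::real) *\<^sub>R u x)"
  unfolding locally_integrable_on_def set_integrable_def scaleR_left_commute[of _ c]
  by (intro allI impI integrable_scaleR_right) blast

lemma locally_integrable_on_inner:
  fixes u :: "'a::euclidean_space \<Rightarrow> 'b::euclidean_space"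
  assumes "locally_integrable_on S u"
  shows "locally_integrable_on S (\<lambda>x. u x \<bullet> b)"
  using assms
  unfolding locally_integrable_on_def set_integrable_def
proof (intro allI impI)
  fix K :: "'a set" 
  assume "\<forall>K. compact K \<and> K \<subseteq> S \<longrightarrow> integrable lborel (\<lambda>x. indicat_real K x *\<^sub>R u x)" "compact K \<and> K \<subseteq> S"
  then have "integrable lborel (\<lambda>x. (indicat_real K x *\<^sub>R u x) \<bullet> b)"
    by (intro integrable_inner_left) blast
  then show "integrable lborel (\<lambda>x. indicat_real K x *\<^sub>R (u x \<bullet> b))" by simp
qed

lemma set_integrable_mult_gradient:
  fixes u :: "'a::euclidean_space \<Rightarrow> real"
  assumes "locally_integrable_on S u" "h \<in> test_functions S" 
  shows "set_integrable lborel S (\<lambda>x. u x * (gradient h x \<bullet> b))"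
proof (rule locally_integrable_on_mult_continuous[OF assms(1)])
  show "compact (closure {x. h x \<noteq> 0})" "closure {x. h x \<noteq> 0} \<subseteq> S" 
    using assms(2) by (auto simp: test_functions_def)
qed (auto intro!: continuous_intros continuous_on_gradient[OF assms(2)] simp: gradient_0_outside_support)

lemma set_integrable_inner_mult_test_function:
  fixes g :: "'a::euclidean_space \<Rightarrow> 'a"
  assumes "locally_integrable_on S g" "h \<in> test_functions S" 
  shows "set_integrable lborel S (\<lambda>x. (g x \<bullet> b) * h x)"
proof (rule locally_integrable_on_mult_continuous[OF locally_integrable_on_inner[OF assms(1)]])
  show "compact (closure {x. h x \<noteq> 0})" "closure {x. h x \<noteq> 0} \<subseteq> S" 
    using assms(2) by (auto simp: test_functions_def)
  show "h x = 0" if "x \<notin> closure {x. h x \<noteq> 0}" for x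
    using that closure_subset[of "{x. h x \<noteq> 0}"] by auto
qed (rule test_functions_continuous(1)[OF assms(2)])

text \<open>Replaces the Frechet derivative by the gradient vector, which is easier to bound.\<close>

lemma has_weak_gradient_alt:
  fixes u :: "'a::euclidean_space \<Rightarrow> real"
  shows "has_weak_gradient S u g \<longleftrightarrow>
     locally_integrable_on S u \<and> locally_integrable_on S g \<and>
     (\<forall>h\<in>test_functions S. \<forall>b\<in>Basis.
        (LINT x:S|lborel. u x * (gradient h x \<bullet> b)) = - (LINT x:S|lborel. (g x \<bullet> b) * h x))"
  unfolding has_weak_gradient_def
  by (intro conj_cong refl ball_cong) (simp only: gradient_inner[OF test_functions_differentiable])

lemma has_weak_gradient_add:
  fixes u v :: "'a::euclidean_space \<Rightarrow> real"
  assumes "has_weak_gradient S u g" "has_weak_gradient S v k"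
  shows "has_weak_gradient S (\<lambda>x. u x + v x) (\<lambda>x. g x + k x)"
  unfolding has_weak_gradient_alt
proof (intro conjI ballI)
  have u: "locally_integrable_on S u" "locally_integrable_on S g" 
    and v: "locally_integrable_on S v" "locally_integrable_on S k"
    using assms by (simp_all add: has_weak_gradient_def)
  show "locally_integrable_on S (\<lambda>x. u x + v x)" "locally_integrable_on S (\<lambda>x. g x + k x)"
    using u v by (simp_all add: locally_integrable_on_add)
  fix h :: "'a \<Rightarrow> real" and b :: 'a assume h: "h \<in> test_functions S" and b: "b \<in> Basis"
  have "(LINT x:S|lborel. (u x + v x) * (gradient h x \<bullet> b)) =
    (LINT x:S|lborel. u x * (gradient h x \<bullet> b)) + (LINT x:S|lborel. v x * (gradient h x \<bullet> b))"
    unfolding distrib_right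
    by (rule set_integral_add(2)[OF set_integrable_mult_gradient[OF u(1) h] set_integrable_mult_gradient[OF v(1) h]])
  also have "(LINT x:S|lborel. u x * (gradient h x \<bullet> b)) = - (LINT x:S|lborel. (g x \<bullet> b) * h x)"
    using assms(1) h b unfolding has_weak_gradient_alt by blast
  also have "(LINT x:S|lborel. v x * (gradient h x \<bullet> b)) = - (LINT x:S|lborel. (k x \<bullet> b) * h x)"
    using assms(2) h b unfolding has_weak_gradient_alt by blast
  also have "- (LINT x:S|lborel. (g x \<bullet> b) * h x) + - (LINT x:S|lborel. (k x \<bullet> b) * h x)
     = - (LINT x:S|lborel. (g x \<bullet> b) * h x + (k x \<bullet> b) * h x)"
    by (simp only: set_integral_add(2)[OF set_integrable_inner_mult_test_function[OF u(2) h] 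
          set_integrable_inner_mult_test_function[OF v(2) h]] minus_add_distrib)
  also have "\<dots> = - (LINT x:S|lborel. ((g x + k x) \<bullet> b) * h x)"
    by (simp only: inner_add_left distrib_right)
  finally show "(LINT x:S|lborel. (u x + v x) * (gradient h x \<bullet> b)) 
    = - (LINT x:S|lborel. ((g x + k x) \<bullet> b) * h x)" .
qed

lemma has_weak_gradient_scale:
  fixes u :: "'a::euclidean_space \<Rightarrow> real"
  assumes "has_weak_gradient S u g"
  shows "has_weak_gradient S (\<lambda>x. c * u x) (\<lambda>x. c *\<^sub>R g x)"
  unfolding has_weak_gradient_alt
proof (intro conjI ballI)
  show "locally_integrable_on S (\<lambda>x. c * u x)" "locally_integrable_on S (\<lambda>x. c *\<^sub>R g x)"
    using assms locally_integrable_on_scale[of S u c] locally_integrable_on_scale[of S g c]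
    by (simp_all add: has_weak_gradient_def)
  fix h :: "'a \<Rightarrow> real" and b :: 'a assume "h \<in> test_functions S" and "b \<in> Basis"
  then have "(LINT x:S|lborel. u x * (gradient h x \<bullet> b)) = - (LINT x:S|lborel. (g x \<bullet> b) * h x)"
    using assms unfolding has_weak_gradient_alt by blast
  then show "(LINT x:S|lborel. c * u x * (gradient h x \<bullet> b)) = - (LINT x:S|lborel. (c *\<^sub>R g x \<bullet> b) * h x)"
    by (simp add: mult.assoc)
qed

lemma has_weak_gradient_test_function:
  fixes u :: "'a::euclidean_space \<Rightarrow> real"
  assumes u: "u \<in> test_functions S"
  shows "has_weak_gradient S u (gradient u)"
proof -
  have li: "locally_integrable_on S f" if "continuous_on UNIV f" for f :: "'a \<Rightarrow> 'b::euclidean_space"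
    unfolding locally_integrable_on_def set_integrable_def
    by (auto intro!: borel_integrable_compact continuous_on_subset[OF that])
  show ?thesis unfolding has_weak_gradient_alt
  proof (intro conjI ballI li test_functions_continuous[OF u] continuous_on_gradient[OF u])
    fix h :: "'a \<Rightarrow> real" and b :: 'a assume h: "h \<in> test_functions S" and b: "b \<in> Basis"
    have S: "u x = 0 \<and> gradient u x = 0" if "x \<notin> S" for x
      using that u closure_subset[of "{x. u x \<noteq> 0}"] gradient_0_outside_support[of x u]
      unfolding test_functions_def by blast
    have "(LINT x:S|lborel. u x * (gradient h x \<bullet> b)) + (LINT x:S|lborel. (gradient u x \<bullet> b) * h x)
      = (LINT x:S|lborel. u x * (gradient h x \<bullet> b) + (gradient u x \<bullet> b) * h x)"
      by (rule set_integral_add(2)[symmetric, OF set_integrable_mult_gradient[OF li h] 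
            set_integrable_inner_mult_test_function[OF li h]])
        (rule test_functions_continuous(1)[OF u] continuous_on_gradient[OF u])+
    also have "\<dots> = (LINT x|lborel. gradient (\<lambda>x. u x * h x) x \<bullet> b)"
      unfolding set_lebesgue_integral_def
    proof (rule Bochner_Integration.integral_cong)
      fix x
      show "indicat_real S x *\<^sub>R (u x * (gradient h x \<bullet> b) + gradient u x \<bullet> b * h x) =
         gradient (\<lambda>x. u x * h x) x \<bullet> b"
        using S[of x] gradient_mult[OF test_functions_differentiable[OF u] test_functions_differentiable[OF h], of x]
        by (cases "x \<in> S") (auto simp: inner_add_left)
    qed simp
    also have "\<dots> = 0"
      by (rule integral_gradient_test_function[OF test_functions_mult[OF u h] b])
    finally show "(LINT x:S|lborel. u x * (gradient h x \<bullet> b)) = - (LINT x:S|lborel. (gradient u x \<bullet> b) * h x)"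
      by linarith
  qed
qed

lemma has_weak_gradient_unique:
  fixes u :: "'a::euclidean_space \<Rightarrow> real"
  assumes "open S" and g: "has_weak_gradient S u g" and k: "has_weak_gradient S u k"
  shows "AE x in lborel. x \<in> S \<longrightarrow> g x = k x"
proof -
  have "has_weak_gradient S (\<lambda>x. u x + (-1) * u x) (\<lambda>x. g x + (-1) *\<^sub>R k x)"
    by (rule has_weak_gradient_add[OF g has_weak_gradient_scale[OF k]])
  moreover have "(\<lambda>x. u x + (-1) * u x) = (\<lambda>x. 0)" "(\<lambda>x. g x + (-1) *\<^sub>R k x) = (\<lambda>x. g x - k x)"
    by auto
  ultimately have 0: "has_weak_gradient S (\<lambda>x. 0) (\<lambda>x. g x - k x)" by simp
  have "AE x in lborel. \<forall>b\<in>Basis. x \<in> S \<longrightarrow> (g x - k x) \<bullet> b = 0"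
  proof (rule AE_ball_countable[THEN iffD2])
    show "\<forall>b\<in>Basis. AE x in lborel. x \<in> S \<longrightarrow> (g x - k x) \<bullet> b = 0"
    proof
      fix b :: 'a assume "b \<in> Basis"
      show "AE x in lborel. x \<in> S \<longrightarrow> (g x - k x) \<bullet> b = 0"
      proof (rule fundamental_lemma_of_calculus_of_variations[OF \<open>open S\<close>])
        show "locally_integrable_on S (\<lambda>x. (g x - k x) \<bullet> b)"
          by (rule locally_integrable_on_inner) (use 0 in \<open>simp add: has_weak_gradient_def\<close>)
        fix h assume "h \<in> test_functions S"
        then have "(LINT x:S|lborel. 0 * (gradient h x \<bullet> b)) = - (LINT x:S|lborel. ((g x - k x) \<bullet> b) * h x)"
          using 0 \<open>b \<in> Basis\<close> unfolding has_weak_gradient_alt by blast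
        then show "(LINT x:S|lborel. ((g x - k x) \<bullet> b) * h x) = 0"
          by (simp add: set_lebesgue_integral_def)
      qed
    qed
  qed (rule countable_finite[OF finite_Basis])
  then show ?thesis
  proof (rule eventually_mono, intro impI)
    fix x assume "\<forall>b\<in>Basis. x \<in> S \<longrightarrow> (g x - k x) \<bullet> b = 0" "x \<in> S"
    then show "g x = k x" using euclidean_eqI[of "g x" "k x"] by (auto simp: inner_diff_left)
  qed
qed

lemma has_weak_gradient_weak_gradient:
  assumes "\<exists>g. has_weak_gradient S u g"
  shows "has_weak_gradient S u (weak_gradient S u)"
  using assms unfolding weak_gradient_def by (rule someI_ex)

lemma weak_gradient_AE_eq:
  fixes u :: "'a::euclidean_space \<Rightarrow> real"
  assumes "open S" and g: "has_weak_gradient S u g"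
  shows "AE x in lborel. x \<in> S \<longrightarrow> weak_gradient S u x = g x"
  by (rule has_weak_gradient_unique[OF \<open>open S\<close> _ g]) (rule has_weak_gradient_weak_gradient, rule exI, rule g)

section \<open>Pointwise inequalities for powers of the norm\<close>

lemma powr_two_scale:
  fixes p :: real
  assumes "x \<ge> 0"
  shows "x powr (p - 2) * x\<^sup>2 = x powr p" and "x powr (p - 2) * x = x powr (p - 1)"
    and "x powr (p - 1) * x = x powr p"
proof -
  have "x powr (p - 2) * x\<^sup>2 = x powr p \<and> x powr (p - 2) * x = x powr (p - 1) \<and> x powr (p - 1) * x = x powr p"
  proof (cases "x = 0")
    case False
    then have x: "x > 0" using assms by simp
    have "x powr (p - 2) * x powr 2 = x powr p" "x powr (p - 2) * x powr 1 = x powr (p - 1)"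
      "x powr (p - 1) * x powr 1 = x powr p"
      unfolding powr_add[symmetric] by simp_all
    with x show ?thesis by simp
  qed simp
  then show "x powr (p - 2) * x\<^sup>2 = x powr p" and "x powr (p - 2) * x = x powr (p - 1)"
    and "x powr (p - 1) * x = x powr p" by blast+
qed

text \<open>Young's inequality in the form that yields the tangent inequality for the power of the norm.\<close>

lemma Young_powr:
  fixes a b p :: real
  assumes "p > 1" "a \<ge> 0" "b \<ge> 0"
  shows "b powr (p - 1) * a \<le> a powr p / p + (1 - 1 / p) * b powr p"
proof (cases "a = 0 \<or> b = 0")
  case True
  then show ?thesis using assms by auto
next
  case False
  have "(a powr p) powr (1 / p) * (b powr p) powr (1 - 1 / p) \<le> 1 / p * a powr p + (1 - 1 / p) * b powr p"
    using assms False by (intro Youngs_inequality_0) auto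
  moreover have "(a powr p) powr (1 / p) = a" using assms by (simp add: powr_powr)
  moreover have "(b powr p) powr (1 - 1 / p) = b powr (p - 1)" 
    using assms by (simp add: powr_powr algebra_simps)
  ultimately show ?thesis by (simp add: mult.commute)
qed

text \<open>
  Convexity of \<open>|\<cdot>|\<^sup>p / p\<close>, expressed through its gradient \<open>|b|\<^sup>p\<^sup>-\<^sup>2 b\<close>. It gives midpoint convexity here
  and the Euler-Lagrange equation later.
\<close>

lemma norm_powr_tangent:
  fixes a b :: "'a::real_inner"
  assumes p: "p > (1::real)"
  shows "norm b powr p / p - norm a powr p / p \<le> norm b powr (p - 2) * (b \<bullet> (b - a))"
proof -
  have "norm b powr (p - 2) * (b \<bullet> a) \<le> norm b powr (p - 2) * (norm b * norm a)"
    by (intro mult_left_mono norm_cauchy_schwarz) auto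
  also have "\<dots> = norm b powr (p - 1) * norm a"
    using powr_two_scale(2)[of "norm b" p] by (simp add: mult.assoc[symmetric])
  also have "\<dots> \<le> norm a powr p / p + (1 - 1 / p) * norm b powr p"
    using p by (intro Young_powr) auto
  finally have "norm b powr (p - 2) * (b \<bullet> a) \<le> norm a powr p / p + norm b powr p - norm b powr p / p"
    by (simp add: algebra_simps)
  moreover have "norm b powr (p - 2) * (b \<bullet> b) = norm b powr p"
    using powr_two_scale(1)[of "norm b" p] by (simp add: power2_norm_eq_inner)
  ultimately show ?thesis by (simp add: inner_diff_right algebra_simps)
qed

lemma norm_powr_midpoint:
  fixes a b :: "'a::real_inner"
  assumes p: "p > (1::real)"
  shows "norm ((1/2) *\<^sub>R (a + b)) powr p \<le> (norm a powr p + norm b powr p) / 2"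
proof -
  let ?m = "(1/2) *\<^sub>R (a + b)"
  have "(norm ?m powr p / p - norm a powr p / p) + (norm ?m powr p / p - norm b powr p / p)
     \<le> norm ?m powr (p - 2) * (?m \<bullet> (?m - a)) + norm ?m powr (p - 2) * (?m \<bullet> (?m - b))"
    by (intro add_mono norm_powr_tangent p)
  also have "\<dots> = norm ?m powr (p - 2) * (?m \<bullet> ((?m - a) + (?m - b)))"
    by (simp only: inner_add_right distrib_left)
  also have "(?m - a) + (?m - b) = 0"
    by (simp add: algebra_simps flip: scaleR_add_left)
  finally have "(2 * norm ?m powr p) / p \<le> (norm a powr p + norm b powr p) / p"
    by (simp add: add_divide_distrib)
  then show ?thesis using p by (simp add: divide_le_cancel)
qed

lemma norm_add_powr_le:
  fixes a b :: "'a::real_inner"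
  assumes r: "r > (1::real)"
  shows "norm (a + b) powr r \<le> 2 powr r * (norm a powr r + norm b powr r)"
proof -
  have "norm (a + b) powr r = 2 powr r * norm ((1/2) *\<^sub>R (a + b)) powr r"
    by (simp add: powr_divide)
  also have "\<dots> \<le> 2 powr r * ((norm a powr r + norm b powr r) / 2)"
    using r by (intro mult_left_mono norm_powr_midpoint) auto
  also have "\<dots> \<le> 2 powr r * (norm a powr r + norm b powr r)"
    by (intro mult_left_mono) auto
  finally show ?thesis .
qed

text \<open>
  The factor \<open>1 / p\<close> of the modular is harmless: the constants depend only on the smaller exponent \<open>q\<close>,
  however large \<open>p\<close> is.
\<close>

lemma powr_le_smaller_exponent:
  fixes t :: real
  assumes "0 < q" "q \<le> p" "0 \<le> t"
  shows "t powr q \<le> q * (t powr p / p) + 1"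
proof (cases "t = 0")
  case True
  then show ?thesis by simp
next
  case False
  have "(t powr p) powr (q / p) * 1 powr (1 - q / p) \<le> q / p * t powr p + (1 - q / p) * 1"
    using assms False by (intro Youngs_inequality_0) auto
  moreover have "(t powr p) powr (q / p) = t powr q" using assms by (simp add: powr_powr)
  moreover have "q / p * t powr p = q * (t powr p / p)" "0 \<le> q / p" using assms by auto
  ultimately show ?thesis unfolding powr_one_eq_one mult_1_right by linarith
qed

text \<open>A substitute for Hoelder's inequality: the free weight \<open>e\<close> is chosen later, pointwise.\<close>

lemma Young_weight:
  fixes a e q :: real
  assumes "a \<ge> 0" "e > 0" "q \<ge> 1"
  shows "a \<le> e + e powr (1 - q) * a powr q"
proof (cases "a \<le> e")
  case False
  then have a: "a > 0" "e \<le> a" using assms by auto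
  have "a = e powr (1 - q) * (a * e powr (q - 1))"
  proof -
    have "e powr (1 - q) * e powr (q - 1) = 1" using assms by (simp add: powr_add[symmetric])
    then show ?thesis by (metis mult.left_commute mult.right_neutral)
  qed
  also have "\<dots> \<le> e powr (1 - q) * (a * a powr (q - 1))"
    using a assms by (intro mult_left_mono powr_mono2) auto
  also have "a * a powr (q - 1) = a powr q"
    using powr_two_scale(3)[of a q] a by (simp add: mult.commute)
  finally show ?thesis using assms by simp
qed (auto intro: add_increasing2)

lemma powr_diff_lower:
  fixes u v M p :: real
  assumes p: "1 < p" "p \<le> 2" and u: "0 < u" "u \<le> v" "v \<le> M"
  shows "(p - 1) * M powr (p - 2) * (v - u) \<le> v powr (p - 1) - u powr (p - 1)"
proof (cases "u = v")
  case False
  have D: "((\<lambda>x. x powr (p - 1)) has_real_derivative (p - 1) * z powr (p - 2)) (at z)" if "u \<le> z" for z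
    using that u by (auto intro!: derivative_eq_intros)
  have "u < v" using False u by simp
  from MVT2[OF this D] obtain z where z: "u < z" "z < v" 
    "v powr (p - 1) - u powr (p - 1) = (v - u) * ((p - 1) * z powr (p - 2))" by blast
  have "M powr (p - 2) \<le> z powr (p - 2)"
    using z u p by (intro powr_mono2') auto
  then have "(v - u) * ((p - 1) * M powr (p - 2)) \<le> (v - u) * ((p - 1) * z powr (p - 2))"
    using u p by (intro mult_left_mono) auto
  then show ?thesis using z by (simp add: mult_ac)
qed simp

text \<open>
  For \<open>p \<le> 2\<close> the second derivative \<open>p (p - 1) x\<^sup>p\<^sup>-\<^sup>2\<close> is smallest at the right end \<open>M\<close> of the interval,
  which gives the quadratic gain.
\<close>

lemma powr_strong_convexity:
  fixes x s M p :: real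
  assumes p: "1 < p" "p \<le> 2" and x: "0 \<le> x" "x \<le> M" and s: "0 \<le> s" "s \<le> M" and M: "M > 0"
  shows "s powr p + p * s powr (p - 1) * (x - s) + p * (p - 1) / 2 * M powr (p - 2) * (x - s)\<^sup>2 \<le> x powr p"
proof -
  define k where "k = p * (p - 1) / 2"
  have k: "k \<le> p - 1" "k \<le> 1" "k > 0" 
  proof -
    have "p * (p - 1) \<le> 2 * (p - 1)" "p * (p - 1) \<le> 2 * 1" using p by (intro mult_mono; simp)+
    then show "k \<le> p - 1" "k \<le> 1" by (simp_all add: k_def)
    show "k > 0" using p by (simp add: k_def)
  qed
  have mono: "M powr (p - 2) * y\<^sup>2 \<le> y powr p" if "0 \<le> y" "y \<le> M" for y
  proof (cases "y = 0")
    case False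
    then have "M powr (p - 2) \<le> y powr (p - 2)" using that p by (intro powr_mono2') auto
    then have "M powr (p - 2) * y\<^sup>2 \<le> y powr (p - 2) * y\<^sup>2" by (intro mult_right_mono) auto
    then show ?thesis using powr_two_scale(1)[of y p] that by simp
  qed simp
  consider "s = 0" | "s > 0" "x = 0" | "s > 0" "x > 0" using x s by linarith
  then have "s powr p + p * s powr (p - 1) * (x - s) + k * M powr (p - 2) * (x - s)\<^sup>2 \<le> x powr p"
  proof cases
    case 1
    have "k * (M powr (p - 2) * x\<^sup>2) \<le> 1 * x powr p"
      using k mono[OF x] by (intro mult_mono) auto
    then show ?thesis using 1 by (simp add: mult_ac)
  next
    case 2
    have "k * (M powr (p - 2) * s\<^sup>2) \<le> (p - 1) * s powr p"
      using k mono[OF s] p by (intro mult_mono) auto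
    moreover have "s powr (p - 1) * s = s powr p" using s by (intro powr_two_scale)
    ultimately show ?thesis using 2 by (simp add: algebra_simps)
  next
    case 3
    define g where "g x = x powr p - p * s powr (p - 1) * (x - s) - k * M powr (p - 2) * (x - s)\<^sup>2" for x
    define g' where "g' x = p * (x powr (p - 1) - s powr (p - 1) - (p - 1) * M powr (p - 2) * (x - s))" for x
    have D: "(g has_real_derivative g' z) (at z)" if "z > 0" for z
      unfolding g_def g'_def using that
      by (auto intro!: derivative_eq_intros simp: k_def field_simps)
    have sgn1: "0 \<le> g' z" if "s \<le> z" "z \<le> M" for z
      using powr_diff_lower[OF p 3(1) that] p unfolding g'_def by simp
    have sgn2: "g' z \<le> 0" if "0 < z" "z \<le> s" for z
    proof -
      have "z powr (p - 1) - s powr (p - 1) - (p - 1) * M powr (p - 2) * (z - s) \<le> 0"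
        using powr_diff_lower[OF p that s(2)] by (simp add: algebra_simps)
      then show ?thesis using p unfolding g'_def by (simp add: mult_nonneg_nonpos)
    qed
    have "g s \<le> g x"
    proof (cases s x rule: linorder_cases)
      case less
      then obtain z where "s < z" "z < x" "g x - g s = (x - s) * g' z"
        using MVT2[of s x g g'] D 3 by auto
      then show ?thesis using sgn1[of z] less x mult_nonneg_nonneg[of "x - s" "g' z"] by linarith
    next
      case greater
      then obtain z where "x < z" "z < s" "g s - g x = (s - x) * g' z"
        using MVT2[of x s g g'] D 3 by auto
      then show ?thesis using sgn2[of z] greater 3 mult_nonneg_nonpos[of "s - x" "g' z"] by linarith
    qed simp
    then show ?thesis by (simp add: g_def)
  qed
  then show ?thesis by (simp add: k_def)
qed

lemma norm_powr_parallelogram: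
  fixes a b :: "'a::real_inner"
  shows "(norm ((1/2) *\<^sub>R (a - b)))\<^sup>2 + (norm ((1/2) *\<^sub>R (a + b)))\<^sup>2 = ((norm a)\<^sup>2 + (norm b)\<^sup>2) / 2"
  by (simp add: power2_norm_eq_inner inner_add_left inner_add_right inner_diff_left inner_diff_right
      inner_commute field_simps)

text \<open>
  With \<open>x\<close> and \<open>y\<close> the squared norms of half the difference and half the sum, the parallelogram law
  evaluates \<open>x + y\<close>; superadditivity and then convexity of \<open>t\<^sup>p\<^sup>/\<^sup>2\<close> do the rest.
\<close>

lemma Clarkson_ge_2:
  fixes a b :: "'a::real_inner"
  assumes p: "2 \<le> (p::real)"
  shows "norm ((1/2) *\<^sub>R (a - b)) powr p + norm ((1/2) *\<^sub>R (a + b)) powr p \<le> (norm a powr p + norm b powr p) / 2"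
proof -
  define x where "x = (norm ((1/2) *\<^sub>R (a - b)))\<^sup>2"
  define y where "y = (norm ((1/2) *\<^sub>R (a + b)))\<^sup>2"
  have sq: "t powr p = (t\<^sup>2) powr (p / 2)" if "t \<ge> 0" for t :: real
    using that by (cases "t = 0") (auto simp: powr_powr simp flip: powr_numeral)
  have xy: "x \<ge> 0" "y \<ge> 0" "x + y = ((norm a)\<^sup>2 + (norm b)\<^sup>2) / 2"
    using norm_powr_parallelogram[of a b] by (auto simp: x_def y_def)
  have mul: "z powr (p / 2) \<le> (x + y) powr (p / 2 - 1) * z" if "0 \<le> z" "z \<le> x + y" for z
  proof -
    have "z powr (p / 2) = z powr (p / 2 - 1) * z"
      using powr_two_scale(3)[of z "p / 2"] that by simp
    also have "\<dots> \<le> (x + y) powr (p / 2 - 1) * z"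
      using that p by (intro mult_right_mono powr_mono2) auto
    finally show ?thesis .
  qed
  have "x powr (p / 2) + y powr (p / 2) \<le> (x + y) powr (p / 2 - 1) * x + (x + y) powr (p / 2 - 1) * y"
    using xy by (intro add_mono mul) auto
  also have "\<dots> = (x + y) powr (p / 2)"
    using powr_two_scale(3)[of "x + y" "p / 2"] xy(1,2) by (simp add: distrib_left)
  also have "\<dots> \<le> (((norm a)\<^sup>2) powr (p / 2) + ((norm b)\<^sup>2) powr (p / 2)) / 2"
  proof (cases "p = 2")
    case False
    then show ?thesis
      using norm_powr_midpoint[of "p / 2" "(norm a)\<^sup>2" "(norm b)\<^sup>2"] p unfolding xy(3) by simp
  qed (use xy in auto)
  finally show ?thesis by (simp add: sq x_def y_def)
qed

text \<open>
  The scalar inequality is used twice. Comparing \<open>|a|\<close> and \<open>|b|\<close> with their mean \<open>s\<close> accounts for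
  different lengths, comparing \<open>s\<close> with \<open>|(a + b) / 2|\<close> accounts for different directions, and the
  parallelogram law adds up the two gains.
\<close>

lemma norm_powr_strong_convexity:
  fixes a b :: "'a::real_inner"
  assumes p: "1 < (p::real)" "p \<le> 2" and M: "M = max (norm a) (norm b)" "M > 0"
  shows "p * (p - 1) / 2 * M powr (p - 2) * (norm ((1/2) *\<^sub>R (a - b)))\<^sup>2
     \<le> (norm a powr p + norm b powr p) / 2 - norm ((1/2) *\<^sub>R (a + b)) powr p"
proof -
  define k where "k = p * (p - 1) / 2 * M powr (p - 2)"
  define A where "A = norm a"
  define B where "B = norm b"
  define N where "N = norm ((1/2) *\<^sub>R (a + b))"
  define s where "s = (A + B) / 2"
  define E where "E = k * ((A - B) / 2)\<^sup>2"
  define Q where "Q = 2 * k * N * (s - N) + k * (s - N)\<^sup>2"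
  have N: "0 \<le> N" "N \<le> s" "s \<le> M" "0 \<le> A" "0 \<le> B" "A \<le> M" "B \<le> M"
    using M norm_triangle_ineq[of a b] by (auto simp: N_def s_def A_def B_def)
  then have s0: "0 \<le> s" by linarith
  have sc: "s powr p + p * s powr (p - 1) * (x - s) + k * (x - s)\<^sup>2 \<le> x powr p" 
    if "0 \<le> x" "x \<le> M" "0 \<le> s" "s \<le> M" for x s
    using powr_strong_convexity[OF p that(1,2,3,4) M(2)] unfolding k_def by simp
  have "(s powr p + p * s powr (p - 1) * (A - s) + k * (A - s)\<^sup>2) +
        (s powr p + p * s powr (p - 1) * (B - s) + k * (B - s)\<^sup>2) \<le> A powr p + B powr p"
    using N s0 by (intro add_mono sc) auto
  moreover have "p * s powr (p - 1) * (A - s) + p * s powr (p - 1) * (B - s) = 0"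
    by (simp add: s_def algebra_simps)
  moreover have "(A - s)\<^sup>2 = ((A - B) / 2)\<^sup>2" "(B - s)\<^sup>2 = ((A - B) / 2)\<^sup>2"
    by (simp_all add: s_def power2_eq_square field_simps)
  ultimately have 1: "2 * s powr p + 2 * E \<le> A powr p + B powr p" unfolding E_def by simp
  have "2 * (p * (p - 1) / 2 * M powr (p - 2)) * N \<le> p * N powr (p - 1)"
  proof (cases "N = 0")
    case False
    then have "M powr (p - 2) \<le> N powr (p - 2)" using N p by (intro powr_mono2') auto
    then have "(p * (p - 1)) * M powr (p - 2) * N \<le> (p * 1) * N powr (p - 2) * N"
      using p N by (intro mult_mono mult_right_mono) auto
    also have "\<dots> = p * N powr (p - 1)"
      using powr_two_scale(2)[of N p] N by (simp add: mult.assoc)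
    finally show ?thesis by simp
  qed simp
  then have "2 * k * N * (s - N) \<le> p * N powr (p - 1) * (s - N)"
    unfolding k_def using N by (intro mult_right_mono) auto
  with sc[of s N] N s0 have 2: "N powr p + Q \<le> s powr p" unfolding Q_def by simp
  have arith: "t \<le> u / 2 - n" if "qq + e = t" "2 * v + 2 * e \<le> u" "n + qq \<le> v" for t u n qq e v :: real
    using that by linarith
  have "Q + E = k * (s\<^sup>2 + ((A - B) / 2)\<^sup>2 - N\<^sup>2)"
    unfolding Q_def E_def by (simp add: power2_eq_square algebra_simps)
  also have "s\<^sup>2 + ((A - B) / 2)\<^sup>2 = (A\<^sup>2 + B\<^sup>2) / 2"
    by (simp add: s_def power2_eq_square field_simps)
  also have "(A\<^sup>2 + B\<^sup>2) / 2 - N\<^sup>2 = (norm ((1/2) *\<^sub>R (a - b)))\<^sup>2"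
    using norm_powr_parallelogram[of a b] unfolding A_def B_def N_def by linarith
  finally have "k * (norm ((1/2) *\<^sub>R (a - b)))\<^sup>2 \<le> (A powr p + B powr p) / 2 - N powr p"
    by (rule arith[OF _ 1 2])
  then show ?thesis unfolding k_def A_def B_def N_def .
qed

text \<open>
  The constant must not depend on the exponent. For \<open>p \<ge> 2\<close> Clarkson's inequality holds with constant 1.
  For \<open>p < 2\<close>, either half the difference is small compared with \<open>max |a| |b|\<close> and is absorbed by
  the first term, or it is comparable with it and the quadratic gain controls it, with a constant that
  degenerates only as \<open>q\<close> tends to 1.
\<close>

lemma norm_powr_uniform_convexity:
  assumes q: "1 < (q::real)" and e: "0 < e" "e < 1"
  obtains C where "C > 0" "\<And>p a (b::'a::real_inner). q \<le> p \<Longrightarrow> 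
    norm ((1/2) *\<^sub>R (a - b)) powr p \<le> e * (norm a powr p + norm b powr p)
       + C * ((norm a powr p + norm b powr p) / 2 - norm ((1/2) *\<^sub>R (a + b)) powr p)"
proof (rule that[of "max 1 (2 / ((q - 1) * e\<^sup>2))"])
  fix p and a b :: 'a assume p: "q \<le> p"
  define C where "C = max 1 (2 / ((q - 1) * e\<^sup>2))"
  define X where "X = norm a powr p + norm b powr p"
  define D where "D = X / 2 - norm ((1/2) *\<^sub>R (a + b)) powr p"
  define d where "d = norm ((1/2) *\<^sub>R (a - b))"
  have X: "X \<ge> 0" "D \<ge> 0" using norm_powr_midpoint[of p a b] p q by (auto simp: X_def D_def)
  have "d powr p \<le> e * X + C * D"
  proof (cases "p \<ge> 2")
    case True
    have "d powr p \<le> 1 * D" using Clarkson_ge_2[OF True, of a b] unfolding d_def D_def X_def by (simp only: mult_1_left le_diff_eq)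
    also have "\<dots> \<le> C * D" using X by (intro mult_right_mono) (auto simp: C_def)
    finally show ?thesis using X e by (simp add: add_increasing)
  next
    case False
    show ?thesis
    proof (cases "a = 0 \<and> b = 0")
      case True
      then have "d = 0" by (simp add: d_def)
      then show ?thesis using X e by (simp add: C_def)
    next
      case nz: False
      define M where "M = max (norm a) (norm b)"
      have M: "M > 0" using nz by (auto simp: M_def less_max_iff_disj)
      have d: "0 \<le> d" "d \<le> M"
        using norm_triangle_ineq4[of a b] by (auto simp: d_def M_def)
      have MX: "M powr p \<le> X" by (auto simp: X_def M_def max_def)
      show ?thesis
      proof (cases "d \<le> e * M")
        case True
        have "d powr p = d powr (p - 1) * d" using powr_two_scale(3)[of d p] d by simp
        also have "\<dots> \<le> M powr (p - 1) * (e * M)"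
          using True d p q M by (intro mult_mono powr_mono2) auto
        also have "\<dots> = e * M powr p" using powr_two_scale(3)[of M p] M by simp
        also have "\<dots> \<le> e * X" using MX e by (intro mult_left_mono) auto
        finally show ?thesis using X by (simp add: C_def add_increasing2)
      next
        case False
        have "d powr p \<le> M powr p" using d p q by (intro powr_mono2) auto
        also have "\<dots> = M powr (p - 2) * M\<^sup>2" using powr_two_scale(1)[of M p] M by simp
        also have "\<dots> \<le> M powr (p - 2) * (d / e)\<^sup>2"
          using False e M by (intro mult_left_mono power_mono) (auto simp: field_simps)
        also have "\<dots> = (2 / ((q - 1) * e\<^sup>2)) * ((q - 1) / 2 * M powr (p - 2) * d\<^sup>2)"
          using q by (simp add: power_divide)
        also have "\<dots> \<le> C * D"
        proof (rule mult_mono)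
          have "(q - 1) \<le> p * (p - 1)" using p q mult_mono[of 1 p "q - 1" "p - 1"] by auto
          then have "(q - 1) / 2 * M powr (p - 2) * d\<^sup>2 \<le> p * (p - 1) / 2 * M powr (p - 2) * d\<^sup>2"
            by (intro mult_right_mono) auto
          also have "\<dots> \<le> D"
            unfolding D_def d_def X_def using norm_powr_strong_convexity[OF _ _ M_def M] p q \<open>\<not> p \<ge> 2\<close> by auto
          finally show "(q - 1) / 2 * M powr (p - 2) * d\<^sup>2 \<le> D" .
        qed (use q in \<open>auto simp: C_def\<close>)
        finally show ?thesis using X e by (simp add: add_increasing)
      qed
    qed
  qed
  then show "norm ((1/2) *\<^sub>R (a - b)) powr p \<le> e * (norm a powr p + norm b powr p)
       + max 1 (2 / ((q - 1) * e\<^sup>2)) * ((norm a powr p + norm b powr p) / 2 - norm ((1/2) *\<^sub>R (a + b)) powr p)"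
    by (simp add: C_def X_def D_def d_def)
qed auto

text \<open>
  At \<open>a = 0\<close> with \<open>r < 2\<close> the factor \<open>|\<cdot>|\<^sup>r\<^sup>-\<^sup>2\<close> is singular; there the product is bounded by
  \<open>|t g|\<^sup>r\<^sup>-\<^sup>1 |g|\<close>, which vanishes in the limit because \<open>r > 1\<close>.
\<close>

lemma flux_continuous:
  fixes a g :: "'a::real_inner"
  assumes r: "r > (1::real)"
  shows "((\<lambda>t. norm (a + t *\<^sub>R g) powr (r - 2) * ((a + t *\<^sub>R g) \<bullet> g)) \<longlongrightarrow> norm a powr (r - 2) * (a \<bullet> g)) (at 0)"
proof -
  have lim: "((\<lambda>t. a + t *\<^sub>R g) \<longlongrightarrow> a + 0 *\<^sub>R g) (at 0)" by (intro tendsto_intros)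
  then have lim: "((\<lambda>t. a + t *\<^sub>R g) \<longlongrightarrow> a) (at 0)" by simp
  show ?thesis
  proof (cases "a = 0")
    case False
    then show ?thesis by (intro tendsto_intros lim) auto
  next
    case True
    have "((\<lambda>t. norm (a + t *\<^sub>R g) powr (r - 1) * norm g) \<longlongrightarrow> 0 * norm g) (at 0)"
    proof (intro tendsto_mult tendsto_const)
      have "((\<lambda>t. norm (a + t *\<^sub>R g)) \<longlongrightarrow> 0) (at 0)" using tendsto_norm[OF lim] True by simp
      then show "((\<lambda>t. norm (a + t *\<^sub>R g) powr (r - 1)) \<longlongrightarrow> 0) (at 0)"
        using r by (intro tendsto_zero_powrI[where b = "r - 1"] tendsto_const) auto
    qed
    then have "((\<lambda>t. norm (a + t *\<^sub>R g) powr (r - 1) * norm g) \<longlongrightarrow> 0) (at 0)" by simp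
    then have "((\<lambda>t. norm (a + t *\<^sub>R g) powr (r - 2) * ((a + t *\<^sub>R g) \<bullet> g)) \<longlongrightarrow> 0) (at 0)"
    proof (rule Lim_null_comparison[rotated])
      show "\<forall>\<^sub>F t in at 0. norm (norm (a + t *\<^sub>R g) powr (r - 2) * ((a + t *\<^sub>R g) \<bullet> g)) \<le> norm (a + t *\<^sub>R g) powr (r - 1) * norm g"
      proof (rule always_eventually, rule allI)
        fix t
        have "norm (norm (a + t *\<^sub>R g) powr (r - 2) * ((a + t *\<^sub>R g) \<bullet> g)) \<le> norm (a + t *\<^sub>R g) powr (r - 2) * (norm (a + t *\<^sub>R g) * norm g)"
          unfolding real_norm_def abs_mult
          using Cauchy_Schwarz_ineq2[of "a + t *\<^sub>R g" g] by (auto intro!: mult_left_mono)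
        also have "\<dots> = norm (a + t *\<^sub>R g) powr (r - 1) * norm g"
          using powr_two_scale(2)[of "norm (a + t *\<^sub>R g)" r] by (simp add: mult.assoc[symmetric])
        finally show "norm (norm (a + t *\<^sub>R g) powr (r - 2) * ((a + t *\<^sub>R g) \<bullet> g)) \<le> norm (a + t *\<^sub>R g) powr (r - 1) * norm g" .
      qed
    qed
    then show ?thesis using True by simp
  qed
qed

section \<open>The supremum bound for test functions\<close>

lemma nn_integral_lborel_affine:
  fixes f :: "'a::euclidean_space \<Rightarrow> ennreal"
  assumes f[measurable]: "f \<in> borel_measurable borel" and t: "t > 0"
  shows "(\<integral>\<^sup>+w. f (x + t *\<^sub>R w) \<partial>lborel) * ennreal (t ^ DIM('a)) = (\<integral>\<^sup>+y. f y \<partial>lborel)"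
proof -
  have "(\<integral>\<^sup>+y. f y \<partial>lborel) = (\<integral>\<^sup>+y. f y \<partial>density (distr lborel borel (\<lambda>w. x + t *\<^sub>R w)) (\<lambda>_. \<bar>t\<bar>^DIM('a)))"
    using lborel_affine[of t x] t by simp
  also have "\<dots> = (\<integral>\<^sup>+w. ennreal (\<bar>t\<bar>^DIM('a)) * f (x + t *\<^sub>R w) \<partial>lborel)"
    by (simp add: nn_integral_density nn_integral_distr)
  also have "\<dots> = ennreal (\<bar>t\<bar>^DIM('a)) * (\<integral>\<^sup>+w. f (x + t *\<^sub>R w) \<partial>lborel)"
    by (rule nn_integral_cmult) measurable
  finally show ?thesis using t by (simp add: mult.commute)
qed

lemma nn_integral_powr_0_1:
  assumes "s < 1"
  shows "(\<integral>\<^sup>+t. ennreal (t powr (- s)) * indicator {0..1} t \<partial>lborel) = ennreal (1 / (1 - s))"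
proof -
  have "((\<lambda>t. t powr (- s)) has_integral (1 powr (- s + 1) / (- s + 1))) {0..1::real}"
    using assms by (intro has_integral_powr_from_0) auto
  then show ?thesis
    by (intro nn_integral_has_integral_lebesgue') auto
qed

lemma test_function_le_line_integral:
  fixes h :: "'a::euclidean_space \<Rightarrow> real"
  assumes h: "h \<in> test_functions S" and w: "h (x + w) = 0"
  shows "ennreal \<bar>h x\<bar> \<le> (\<integral>\<^sup>+t. ennreal (norm w * norm (gradient h (x + t *\<^sub>R w))) * indicator {0..1} t \<partial>lborel)"
proof -
  define f where "f t = gradient h (x + t *\<^sub>R w) \<bullet> w" for t
  have D: "((\<lambda>t. h (x + t *\<^sub>R w)) has_real_derivative f t) (at t)" for t
  proof -
    have "((\<lambda>t. h (x + t *\<^sub>R w)) has_derivative (\<lambda>s. gradient h (x + t *\<^sub>R w) \<bullet> (s *\<^sub>R w))) (at t)"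
      by (rule has_derivative_compose[where g = h and s = UNIV, simplified, 
            of "\<lambda>t. x + t *\<^sub>R w" "\<lambda>t. t *\<^sub>R w" t "\<lambda>v. gradient h (x + t *\<^sub>R w) \<bullet> v"])
        (auto intro!: derivative_eq_intros gradient_has_derivative test_functions_differentiable[OF h])
    then show ?thesis
      unfolding has_field_derivative_def f_def
      by (rule has_derivative_eq_rhs) (simp add: fun_eq_iff mult.commute)
  qed
  have cont: "continuous_on UNIV f"
    unfolding f_def by (intro continuous_intros continuous_on_compose2[OF continuous_on_gradient[OF h]]) auto
  have int: "has_bochner_integral lborel (\<lambda>t. f t * indicator {0..1} t) (h (x + 1 *\<^sub>R w) - h (x + 0 *\<^sub>R w))"
    by (rule has_bochner_integral_FTC_Icc_real)
      (use D cont in \<open>auto simp: continuous_on_eq_continuous_at\<close>)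
  have "ennreal (norm (LINT t|lborel. f t * indicator {0..1} t)) \<le> (\<integral>\<^sup>+t. ennreal (norm (f t * indicator {0..1} t)) \<partial>lborel)"
    using int by (intro integral_norm_bound_ennreal) (auto simp: has_bochner_integral_iff)
  also have "\<dots> \<le> (\<integral>\<^sup>+t. ennreal (norm w * norm (gradient h (x + t *\<^sub>R w))) * indicator {0..1} t \<partial>lborel)"
  proof (rule nn_integral_mono)
    fix t
    have "\<bar>f t\<bar> \<le> norm w * norm (gradient h (x + t *\<^sub>R w))"
      unfolding f_def using Cauchy_Schwarz_ineq2[of "gradient h (x + t *\<^sub>R w)" w] by (simp add: mult.commute)
    then show "ennreal (norm (f t * indicator {0..1} t))
        \<le> ennreal (norm w * norm (gradient h (x + t *\<^sub>R w))) * indicator {0..1} t"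
      by (auto simp: indicator_def intro!: ennreal_leI)
  qed
  also have "(LINT t|lborel. f t * indicator {0..1} t) = - h x"
    using int w by (simp add: has_bochner_integral_iff)
  finally show ?thesis by simp
qed

text \<open>
  A Morrey estimate. Join \<open>x\<close> to the points \<open>x + w\<close> of a ball outside the domain, where \<open>h\<close> vanishes:
  \<open>|h x|\<close> is at most the integral of \<open>|w| |\<nabla>h (x + t w)|\<close> over \<open>t\<close>. After averaging over \<open>w\<close>, the
  substitution \<open>y = x + t w\<close> costs a factor \<open>t\<^sup>-\<^sup>n\<close>. Young's inequality with weight \<open>e t\<^sup>-\<^sup>s\<close>, \<open>s = n / q\<close>,
  balances both terms at \<open>t\<^sup>-\<^sup>s\<close>, which is integrable at 0 exactly because \<open>q > n\<close>.
\<close>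

lemma test_function_sup_bound:
  fixes S :: "'a::euclidean_space set"
  assumes "bounded S" and q: "q > real DIM('a)"
  obtains C where "C > 0" 
    "\<And>h x e I. h \<in> test_functions S \<Longrightarrow> e > 0 \<Longrightarrow> I \<ge> 0 \<Longrightarrow> 
       (\<integral>\<^sup>+y. ennreal (norm (gradient h y) powr q) \<partial>lborel) \<le> ennreal I \<Longrightarrow>
       \<bar>h x\<bar> \<le> C * (e + e powr (1 - q) * I)"
proof -
  obtain R0 where R0: "R0 > 0" "S \<subseteq> ball 0 R0"
    using bounded_subset_ballD[OF \<open>bounded S\<close>, of 0] by blast
  define R where "R = 2 * R0"
  obtain b :: 'a where b: "b \<in> Basis" using nonempty_Basis by blast
  \<comment> \<open>Every vector of \<open>D\<close> is longer than the diameter of \<open>S\<close>, so it leads from \<open>S\<close> out of \<open>S\<close>.\<close>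
  define D where "D = ball ((2 * R) *\<^sub>R b) R"
  define m where "m = measure lborel D"
  have R: "R > 0" using R0 by (simp add: R_def)
  have m: "m > 0"
    unfolding m_def D_def using R content_ball_pos[of R "(2 * R) *\<^sub>R b"] by simp
  have "emeasure lborel D < \<infinity>" unfolding D_def by (intro emeasure_bounded_finite) simp
  then have emm: "emeasure lborel D = ennreal m"
    unfolding m_def by (intro emeasure_eq_ennreal_measure) (simp add: less_top)
  have wD: "norm w > R \<and> norm w < 3 * R" if "w \<in> D" for w
  proof -
    have "norm ((2 * R) *\<^sub>R b) = 2 * R" using b R by simp
    moreover have "norm ((2 * R) *\<^sub>R b - w) < R" using that by (simp add: D_def dist_norm)
    ultimately show ?thesis
      using norm_triangle_ineq2[of "(2 * R) *\<^sub>R b" w] norm_triangle_ineq3[of "(2 * R) *\<^sub>R b" w] by linarith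
  qed
  define n where "n = DIM('a)"
  define s where "s = real n / q"
  have n: "n \<ge> 1" by (simp add: n_def DIM_positive Suc_leI)
  have "1 \<le> real n" using n by simp
  also have "real n < q" using q by (simp add: n_def)
  finally have q1: "q > 1" .
  have s: "s < 1" "s * q = real n" using q q1 by (auto simp: s_def n_def)
  define C where "C = 3 * R / (1 - s) * max 1 (1 / m)"
  have "C > 0" using R s by (simp add: C_def)
  moreover have "\<bar>h x\<bar> \<le> C * (e + e powr (1 - q) * I)"
    if h: "h \<in> test_functions S" and e: "e > 0" and I: "I \<ge> 0"
      "(\<integral>\<^sup>+y. ennreal (norm (gradient h y) powr q) \<partial>lborel) \<le> ennreal I" for h x e I
  proof (cases "x \<in> S")
    case False
    then have "h x = 0" using h closure_subset[of "{x. h x \<noteq> 0}"] unfolding test_functions_def by blast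
    then show ?thesis using \<open>C > 0\<close> e I by simp
  next
    case True
    have [measurable]: "gradient h \<in> borel_measurable borel"
      by (rule borel_measurable_continuous_onI[OF continuous_on_gradient[OF h]])
    have Dm [measurable]: "D \<in> sets borel" by (simp add: D_def)
    \<comment> \<open>The Young weight that equalises the powers of \<open>t\<close> in both terms.\<close>
    define et where "et t = e * t powr (- s)" for t
    define G where "G t w = norm (gradient h (x + t *\<^sub>R w))" for t w
    have [measurable]: "(\<lambda>(w, t). G t w) \<in> borel_measurable (lborel \<Otimes>\<^sub>M lborel)" "G t \<in> borel_measurable borel" for t
      unfolding G_def by measurable
    have Gm [measurable]: "(\<lambda>p. G (snd p) (fst p)) \<in> borel_measurable (lborel \<Otimes>\<^sub>M lborel)"
      unfolding G_def by measurable
    have [measurable]: "et \<in> borel_measurable borel" unfolding et_def by measurable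
    define \<Phi> where "\<Phi> w t = ennreal (3 * R * (et t + et t powr (1 - q) * G t w powr q)) 
       * indicator {0<..1} t * indicator D w" for w t
    have AE0: "AE t in lborel. t \<noteq> (0::real)" by (rule AE_lborel_singleton)
    have ptw: "ennreal \<bar>h x\<bar> * indicator D w \<le> (\<integral>\<^sup>+t. \<Phi> w t \<partial>lborel)" for w
    proof (cases "w \<in> D")
      case w: True
      have "x + w \<notin> S"
      proof
        assume "x + w \<in> S"
        then have "norm (x + w) < R0" "norm x < R0" using R0 True by (auto simp: subset_eq)
        then show False using wD[OF w] norm_triangle_ineq4[of "x + w" x] by (simp add: R_def)
      qed
      then have "h (x + w) = 0" 
        using h closure_subset[of "{x. h x \<noteq> 0}"] unfolding test_functions_def by blast
      from test_function_le_line_integral[OF h this]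
      have "ennreal \<bar>h x\<bar> \<le> (\<integral>\<^sup>+t. ennreal (norm w * G t w) * indicator {0..1} t \<partial>lborel)"
        by (simp add: G_def)
      also have "\<dots> \<le> (\<integral>\<^sup>+t. \<Phi> w t \<partial>lborel)"
      proof (rule nn_integral_mono_AE, rule eventually_mono[OF AE0])
        fix t :: real assume "t \<noteq> 0"
        show "ennreal (norm w * G t w) * indicator {0..1} t \<le> \<Phi> w t"
        proof (cases "t \<in> {0<..1}")
          case t: True
          have "norm w * G t w \<le> (3 * R) * (et t + et t powr (1 - q) * G t w powr q)"
            using wD[OF w] Young_weight[of "G t w" "et t" q] q1 e t R
            by (intro mult_mono) (auto simp: G_def et_def)
          then show ?thesis using t w by (simp add: \<Phi>_def ennreal_leI)
        qed (use \<open>t \<noteq> 0\<close> in \<open>auto simp: indicator_def\<close>)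
      qed
      finally show ?thesis using w by simp
    qed simp
    have inner: "(\<integral>\<^sup>+w. \<Phi> w t \<partial>lborel) \<le> ennreal (3 * R * (e * m + e powr (1 - q) * I) * t powr (- s)) * indicator {0..1} t" for t
    proof (cases "t \<in> {0<..1}")
      case t: True
      have et: "et t > 0" using e t by (simp add: et_def)
      have "(\<integral>\<^sup>+w. \<Phi> w t \<partial>lborel) \<le> (\<integral>\<^sup>+w. ennreal (3 * R * et t) * indicator D w + 
             ennreal (3 * R * et t powr (1 - q)) * ennreal (G t w powr q) \<partial>lborel)"
        using t R et
        by (intro nn_integral_mono)
          (auto simp: \<Phi>_def indicator_def ennreal_mult[symmetric] ennreal_plus[symmetric] distrib_left mult_ac
            simp del: ennreal_plus intro!: ennreal_leI)
      also have "\<dots> = ennreal (3 * R * et t) * ennreal m + ennreal (3 * R * et t powr (1 - q)) * (\<integral>\<^sup>+w. ennreal (G t w powr q) \<partial>lborel)"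
        by (simp add: nn_integral_add nn_integral_cmult nn_integral_cmult_indicator emm)
      also have "(\<integral>\<^sup>+w. ennreal (G t w powr q) \<partial>lborel) \<le> ennreal (I * t powr (- real n))"
      proof -
        have "(\<integral>\<^sup>+w. ennreal (G t w powr q) \<partial>lborel) * ennreal (t ^ n) \<le> ennreal I"
          using nn_integral_lborel_affine[of "\<lambda>y. ennreal (norm (gradient h y) powr q)" t x] t I(2)
          by (simp add: G_def n_def)
        then have "(\<integral>\<^sup>+w. ennreal (G t w powr q) \<partial>lborel) * ennreal (t ^ n) * ennreal (t powr (- real n)) 
            \<le> ennreal I * ennreal (t powr (- real n))"
          by (rule mult_right_mono) simp
        moreover have "ennreal (t ^ n) * ennreal (t powr (- real n)) = 1"
          using t by (simp add: ennreal_mult[symmetric] powr_minus powr_realpow)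
        ultimately show ?thesis using I by (simp add: mult.assoc ennreal_mult)
      qed
      also have "ennreal (3 * R * et t) * ennreal m + ennreal (3 * R * et t powr (1 - q)) * ennreal (I * t powr (- real n))
         = ennreal (3 * R * (et t * m + et t powr (1 - q) * (I * t powr (- real n))))"
        using R et m I by (simp add: ennreal_mult[symmetric] ennreal_plus[symmetric] algebra_simps del: ennreal_plus)
      also have "et t powr (1 - q) * (I * t powr (- real n)) = e powr (1 - q) * I * t powr (- s)"
      proof -
        have "et t powr (1 - q) = e powr (1 - q) * t powr (- s * (1 - q))"
          using e t by (simp add: et_def powr_mult powr_powr)
        moreover have "t powr (- s * (1 - q)) * t powr (- real n) = t powr (- s)"
          using s(2) by (simp add: powr_add[symmetric] algebra_simps)
        ultimately show ?thesis by (simp add: mult_ac)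
      qed
      also have "ennreal (3 * R * (et t * m + e powr (1 - q) * I * t powr (- s))) = 
          ennreal (3 * R * (e * m + e powr (1 - q) * I) * t powr (- s))"
        by (simp add: et_def algebra_simps)
      finally show ?thesis using t by (simp add: add_left_mono mult_left_mono)
    qed (simp add: \<Phi>_def)
    have "ennreal (\<bar>h x\<bar> * m) = (\<integral>\<^sup>+w. ennreal \<bar>h x\<bar> * indicator D w \<partial>lborel)"
      using m by (simp add: nn_integral_cmult_indicator emm ennreal_mult)
    also have "\<dots> \<le> (\<integral>\<^sup>+w. \<integral>\<^sup>+t. \<Phi> w t \<partial>lborel \<partial>lborel)"
      by (intro nn_integral_mono ptw)
    also have "\<dots> = (\<integral>\<^sup>+t. \<integral>\<^sup>+w. \<Phi> w t \<partial>lborel \<partial>lborel)"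
      by (rule lborel_pair.Fubini') (simp add: \<Phi>_def split_beta', measurable)
    also have "\<dots> \<le> (\<integral>\<^sup>+t. ennreal (3 * R * (e * m + e powr (1 - q) * I)) * (ennreal (t powr (- s)) * indicator {0..1} t) \<partial>lborel)"
      using inner R e m I by (intro nn_integral_mono) (simp add: ennreal_mult mult.assoc)
    also have "\<dots> = ennreal (3 * R * (e * m + e powr (1 - q) * I)) * ennreal (1 / (1 - s))"
      by (simp add: nn_integral_cmult nn_integral_powr_0_1[OF s(1)])
    also have "\<dots> = ennreal (3 * R * (e * m + e powr (1 - q) * I) * (1 / (1 - s)))"
      using R e m I s by (intro ennreal_mult[symmetric]) auto
    finally have "\<bar>h x\<bar> * m \<le> 3 * R * (e * m + e powr (1 - q) * I) * (1 / (1 - s))"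
      using R e m I s by (simp add: ennreal_le_iff)
    then have "\<bar>h x\<bar> \<le> 3 * R * (e * m + e powr (1 - q) * I) * (1 / (1 - s)) / m"
      using m by (subst pos_le_divide_eq) auto
    also have "\<dots> = 3 * R / (1 - s) * (e * 1 + e powr (1 - q) * I * (1 / m))"
      using m s by (simp add: field_simps)
    also have "\<dots> \<le> 3 * R / (1 - s) * (e * max 1 (1 / m) + e powr (1 - q) * I * max 1 (1 / m))"
      using R s e I by (intro mult_left_mono add_mono) auto
    also have "\<dots> = C * (e + e powr (1 - q) * I)"
      unfolding C_def by (simp only: distrib_left distrib_right mult.assoc mult.commute mult.left_commute)
    finally show ?thesis .
  qed
  ultimately show ?thesis by (rule that)
qed

section \<open>The modular and the variable exponent Sobolev space\<close>

text \<open>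
  The lower bound \<open>q\<close> of the exponent is a parameter, so that it can serve as a constant exponent
  throughout.
\<close>

locale variable_exponent =
  fixes \<Omega> :: "'a::euclidean_space set" and p :: "'a \<Rightarrow> real" and q :: real
  assumes open_dom: "open \<Omega>" and bounded_dom: "bounded \<Omega>"
    and continuous_p: "continuous_on \<Omega> p"
    and p_ge: "\<And>x. x \<in> \<Omega> \<Longrightarrow> q \<le> p x"
    and q_gt: "real DIM('a) < q"
begin

abbreviation M :: "'a measure" where "M \<equiv> restrict_space lborel \<Omega>"

abbreviation wg :: "('a \<Rightarrow> real) \<Rightarrow> 'a \<Rightarrow> 'a" where "wg \<equiv> weak_gradient \<Omega>"

text \<open>
  The modular of vector-valued functions covers both summands of \<open>rho1\<close>. Integrating over the
  restricted space makes the behaviour outside the domain irrelevant.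
\<close>

definition modular :: "('a \<Rightarrow> 'b::euclidean_space) \<Rightarrow> ennreal" where
  "modular f = (\<integral>\<^sup>+x. ennreal (norm (f x) powr p x / p x) \<partial>M)"

lemma sets_dom [measurable, simp]: "\<Omega> \<in> sets borel" "\<Omega> \<in> sets lborel"
  using open_dom by auto

lemma space_M [simp]: "space M = \<Omega>"
  by (simp add: space_restrict_space)

sublocale finite_measure M
proof
  have "emeasure lborel \<Omega> < \<infinity>" using bounded_dom by (rule emeasure_bounded_finite)
  then show "emeasure M (space M) \<noteq> \<infinity>" by (simp add: emeasure_restrict_space)
qed

lemma q_gt_1: "q > 1"
proof -
  have "1 \<le> real DIM('a)" using DIM_positive[where 'a='a] by linarith
  then show ?thesis using q_gt by linarith
qed

lemma p_gt_1: "x \<in> \<Omega> \<Longrightarrow> p x > 1"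
  using p_ge[of x] q_gt_1 by linarith

lemma p_pos: "x \<in> \<Omega> \<Longrightarrow> p x > 0"
  using p_gt_1[of x] by linarith

lemma AE_M_iff: "(AE x in M. P x) \<longleftrightarrow> (AE x in lborel. x \<in> \<Omega> \<longrightarrow> P x)"
  by (rule AE_restrict_space_iff) simp

lemma measurable_p [measurable]: "p \<in> borel_measurable M"
proof -
  have "p \<in> borel_measurable (restrict_space borel \<Omega>)"
    by (rule borel_measurable_continuous_on_restrict[OF continuous_p])
  moreover have "sets (restrict_space borel \<Omega>) = sets M"
    by (rule sets_restrict_space_cong) simp
  ultimately show ?thesis
    using measurable_cong_sets[of "restrict_space borel \<Omega>" M borel borel] by simp
qed

lemma rho_eq_modular: "rho \<Omega> p u = modular u"
  unfolding rho_def modular_def by (subst nn_integral_restrict_space) auto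

lemma rho_norm_eq_modular: "rho \<Omega> p (\<lambda>x. norm (g x)) = modular g"
  unfolding rho_def modular_def by (subst nn_integral_restrict_space) auto

lemma integral_M: "(LINT x:\<Omega>|lborel. f x) = (LINT x|M. f x)"
  for f :: "'a \<Rightarrow> 'b::{banach, second_countable_topology}"
  unfolding set_lebesgue_integral_def by (subst integral_restrict_space) auto

lemma integrable_M: "set_integrable lborel \<Omega> f \<longleftrightarrow> integrable M f"
  for f :: "'a \<Rightarrow> 'b::{banach, second_countable_topology}"
  unfolding set_integrable_def by (subst integrable_restrict_space) auto

lemma measurable_M_iff: 
  "f \<in> borel_measurable M \<longleftrightarrow> (\<lambda>x. indicator \<Omega> x *\<^sub>R f x) \<in> borel_measurable borel"
  for f :: "'a \<Rightarrow> 'b::real_normed_vector"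
  by (subst borel_measurable_restrict_space_iff) auto

lemma set_borel_measurable_M: "set_borel_measurable borel \<Omega> f \<longleftrightarrow> f \<in> borel_measurable M"
  for f :: "'a \<Rightarrow> 'b::real_normed_vector"
  unfolding set_borel_measurable_def measurable_M_iff ..

text \<open>An open set is a countable union of compact boxes, and the function is measurable on each of them.\<close>

lemma locally_integrable_measurable:
  fixes f :: "'a \<Rightarrow> 'b::{banach, second_countable_topology}"
  assumes "locally_integrable_on \<Omega> f"
  shows "f \<in> borel_measurable M"
proof -
  obtain D where D: "countable D" "D \<subseteq> Pow \<Omega>" "\<And>X. X \<in> D \<Longrightarrow> \<exists>a b. X = cbox a b" "\<Union>D = \<Omega>"
    using open_countable_Union_open_cbox[OF open_dom] by metis
  then have DP: "X \<subseteq> \<Omega>" if "X \<in> D" for X using that by blast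
  show ?thesis
  proof (rule measurable_piecewise_restrict[OF D(1)])
    show "X \<inter> space M \<in> sets M" if "X \<in> D" for X
      using DP[OF that] D(3)[OF that] by (auto simp: sets_restrict_space_iff)
    show "space M \<subseteq> \<Union>D" using D(4) by simp
    fix X assume X: "X \<in> D"
    then obtain a b where ab: "X = cbox a b" using D(3) by blast
    have "set_integrable lborel X f"
      using assms DP[OF X] ab compact_cbox unfolding locally_integrable_on_def by blast
    then have "(\<lambda>x. indicator X x *\<^sub>R f x) \<in> borel_measurable lborel"
      unfolding set_integrable_def by (rule borel_measurable_integrable)
    then have "f \<in> borel_measurable (restrict_space lborel X)"
      using ab by (subst borel_measurable_restrict_space_iff) auto
    moreover have "restrict_space M X = restrict_space lborel X"
      using DP[OF X] ab by (subst restrict_restrict_space) (auto simp: Int_absorb1)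
    ultimately show "f \<in> borel_measurable (restrict_space M X)" by simp
  qed
qed

lemma integrable_imp_locally_integrable:
  fixes f :: "'a \<Rightarrow> 'b::{banach, second_countable_topology}"
  assumes "integrable M f"
  shows "locally_integrable_on \<Omega> f"
  unfolding locally_integrable_on_def
proof (intro allI impI)
  fix K assume K: "compact K \<and> K \<subseteq> \<Omega>"
  have "set_integrable lborel \<Omega> f" using assms by (rule integrable_M[THEN iffD2])
  then show "set_integrable lborel K f"
    by (rule set_integrable_subset) (use K in \<open>simp_all add: borel_compact\<close>)
qed

lemma modular_cong_AE: "AE x in M. f x = g x \<Longrightarrow> modular f = modular g"
  unfolding modular_def by (intro nn_integral_cong_AE) auto

lemma modular_mono_AE:
  fixes f :: "'a \<Rightarrow> 'b::euclidean_space" and g :: "'a \<Rightarrow> 'c::euclidean_space"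
  assumes "AE x in M. norm (f x) \<le> norm (g x)"
  shows "modular f \<le> modular g"
  unfolding modular_def
proof (rule nn_integral_mono_AE)
  have "AE x in M. x \<in> \<Omega>" by (simp add: AE_M_iff)
  with assms show "AE x in M. ennreal (norm (f x) powr p x / p x) \<le> ennreal (norm (g x) powr p x / p x)"
  proof eventually_elim
    case (elim x)
    then show ?case using p_pos[of x]
      by (intro ennreal_leI divide_right_mono powr_mono2) auto
  qed
qed

lemma modular_scale_mono:
  fixes f :: "'a \<Rightarrow> 'b::euclidean_space"
  assumes "\<bar>c\<bar> \<le> \<bar>d\<bar>"
  shows "modular (\<lambda>x. c *\<^sub>R f x) \<le> modular (\<lambda>x. d *\<^sub>R f x)"
  using assms by (intro modular_mono_AE AE_I2) (auto intro!: mult_right_mono)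

lemma modular_midpoint:
  fixes f g :: "'a \<Rightarrow> 'b::euclidean_space"
  assumes [measurable]: "f \<in> borel_measurable M" "g \<in> borel_measurable M"
  shows "modular (\<lambda>x. (1/2) *\<^sub>R (f x + g x)) \<le> modular f + modular g"
proof -
  have "modular (\<lambda>x. (1/2) *\<^sub>R (f x + g x)) \<le>
    (\<integral>\<^sup>+x. ennreal (norm (f x) powr p x / p x) + ennreal (norm (g x) powr p x / p x) \<partial>M)"
    unfolding modular_def
  proof (rule nn_integral_mono)
    fix x assume "x \<in> space M"
    then have p: "p x > 1" "p x > 0" using p_gt_1 p_pos by auto
    have "norm ((1/2) *\<^sub>R (f x + g x)) powr p x / p x \<le> ((norm (f x) powr p x + norm (g x) powr p x) / 2) / p x"
      using p by (intro divide_right_mono norm_powr_midpoint) auto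
    also have "\<dots> \<le> norm (f x) powr p x / p x + norm (g x) powr p x / p x"
      using p by (simp add: field_simps)
    finally show "ennreal (norm ((1/2) *\<^sub>R (f x + g x)) powr p x / p x)
       \<le> ennreal (norm (f x) powr p x / p x) + ennreal (norm (g x) powr p x / p x)"
      using p by (simp add: ennreal_plus[symmetric] ennreal_leI del: ennreal_plus)
  qed
  also have "\<dots> = modular f + modular g"
    unfolding modular_def by (rule nn_integral_add) measurable
  finally show ?thesis .
qed

lemma modular_add_finite:
  fixes f g :: "'a \<Rightarrow> 'b::euclidean_space"
  assumes [measurable]: "f \<in> borel_measurable M" "g \<in> borel_measurable M"
    and c: "c > 0" "modular (\<lambda>x. c *\<^sub>R f x) < \<infinity>" and d: "d > 0" "modular (\<lambda>x. d *\<^sub>R g x) < \<infinity>"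
    and e: "0 \<le> e" "e \<le> min c d / 2"
  shows "modular (\<lambda>x. e *\<^sub>R (f x + g x)) < \<infinity>"
proof -
  have "modular (\<lambda>x. e *\<^sub>R (f x + g x)) = modular (\<lambda>x. (1/2) *\<^sub>R ((2 * e) *\<^sub>R f x + (2 * e) *\<^sub>R g x))"
    by (simp add: scaleR_add_right)
  also have "\<dots> \<le> modular (\<lambda>x. (2 * e) *\<^sub>R f x) + modular (\<lambda>x. (2 * e) *\<^sub>R g x)"
    by (rule modular_midpoint) measurable
  also have "\<dots> \<le> modular (\<lambda>x. c *\<^sub>R f x) + modular (\<lambda>x. d *\<^sub>R g x)"
    using c d e by (intro add_mono modular_scale_mono) auto
  also have "\<dots> < \<infinity>" using c d by simp
  finally show ?thesis .
qed

lemma modular_Fatou: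
  fixes f :: "nat \<Rightarrow> 'a \<Rightarrow> 'b::euclidean_space"
  assumes [measurable]: "\<And>k. f k \<in> borel_measurable M" "g \<in> borel_measurable M"
    and lim: "AE x in M. (\<lambda>k. f k x) \<longlonglongrightarrow> g x" and le: "\<forall>\<^sub>F k in sequentially. modular (f k) \<le> B"
  shows "modular g \<le> B"
proof -
  have "modular g \<le> (\<integral>\<^sup>+x. liminf (\<lambda>k. ennreal (norm (f k x) powr p x / p x)) \<partial>M)"
    unfolding modular_def
  proof (rule nn_integral_mono_AE)
    have "AE x in M. x \<in> \<Omega>" by (simp add: AE_M_iff)
    with lim show "AE x in M. ennreal (norm (g x) powr p x / p x) \<le> liminf (\<lambda>k. ennreal (norm (f k x) powr p x / p x))"
    proof eventually_elim
      case (elim x)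
      then have "(\<lambda>k. ennreal (norm (f k x) powr p x / p x)) \<longlonglongrightarrow> ennreal (norm (g x) powr p x / p x)"
        using p_pos[of x] by (intro tendsto_ennrealI tendsto_divide tendsto_powr' tendsto_norm tendsto_const) auto
      from lim_imp_Liminf[OF _ this] show ?case by simp
    qed
  qed
  also have "\<dots> \<le> liminf (\<lambda>k. \<integral>\<^sup>+x. ennreal (norm (f k x) powr p x / p x) \<partial>M)"
    by (rule nn_integral_liminf) measurable
  also have "\<dots> \<le> B"
    using Liminf_mono[OF le[unfolded modular_def]] by (simp add: Liminf_const)
  finally show ?thesis .
qed

text \<open>
  Where \<open>p\<close> is very large the modular hardly sees values below 1, but as \<open>p\<close> is finite the set
  \<open>p > P\<close> has small measure for large \<open>P\<close>, and there \<open>t\<^sup>q \<le> q t\<^sup>p / p + 1\<close> suffices. On the set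
  \<open>p \<le> P\<close>, values above a threshold \<open>r\<close> are controlled by the modular with a factor depending on
  \<open>r\<close> and \<open>P\<close>.
\<close>

lemma modular_small_imp_Lq_small:
  assumes "e > 0"
  obtains d :: real where "d > 0" 
    "\<And>f :: 'a \<Rightarrow> 'b::euclidean_space. f \<in> borel_measurable M \<Longrightarrow> modular f \<le> ennreal d \<Longrightarrow> 
       (\<integral>\<^sup>+x. ennreal (norm (f x) powr q) \<partial>M) \<le> ennreal e"
proof -
  define m where "m = measure M \<Omega>"
  have m0: "m \<ge> 0" and em: "emeasure M \<Omega> = ennreal m" by (auto simp: m_def emeasure_eq_measure)
  have q: "q > 1" by (rule q_gt_1)
  obtain P :: nat where P: "measure M {x \<in> \<Omega>. p x > real P} < e / 4" "P \<ge> 1"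
  proof -
    have "(\<lambda>n. measure M {x \<in> \<Omega>. p x > real n}) \<longlonglongrightarrow> measure M (\<Inter>n. {x \<in> \<Omega>. p x > real n})"
    proof (rule finite_Lim_measure_decseq)
      show "range (\<lambda>n. {x \<in> \<Omega>. p x > real n}) \<subseteq> sets M"
        using measurable_p by (auto simp: borel_measurable_iff_greater)
    qed (auto simp: decseq_def)
    moreover have "(\<Inter>n. {x \<in> \<Omega>. p x > real n}) = {}"
    proof -
      have "\<exists>n. \<not> p x > real n" for x using real_arch_simple[of "p x"] by (auto simp: not_less)
      then show ?thesis by blast
    qed
    ultimately have "\<forall>\<^sub>F n in sequentially. measure M {x \<in> \<Omega>. p x > real n} < e / 4"
      using assms by (intro order_tendstoD(2)) auto
    then have "\<forall>\<^sub>F n in sequentially. measure M {x \<in> \<Omega>. p x > real n} < e / 4 \<and> n \<ge> 1"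
      using eventually_ge_at_top[of 1] by eventually_elim simp
    then obtain n where "measure M {x \<in> \<Omega>. p x > real n} < e / 4 \<and> n \<ge> 1"
      using eventually_happens'[OF sequentially_bot] by blast
    then show ?thesis by (intro that[of n]) auto
  qed
  define E where "E = {x \<in> \<Omega>. p x > real P}"
  have E [measurable]: "E \<in> sets M"
    using measurable_p by (auto simp: E_def borel_measurable_iff_greater)
  \<comment> \<open>With the constants below, each of the three terms of the pointwise bound contributes at most \<open>e / 4\<close>.\<close>
  define r where "r = min 1 (e / (4 * (m + 1)))"
  have r: "0 < r" "r \<le> 1" using assms m0 by (auto simp: r_def)
  have rm: "r * m \<le> e / 4"
  proof -
    have "r * m \<le> e / (4 * (m + 1)) * (m + 1)"
      using assms m0 by (intro mult_mono) (auto simp: r_def)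
    also have "\<dots> = e / 4" using m0 by (simp add: field_simps)
    finally show ?thesis .
  qed
  define C where "C = max q (real P * r powr (- real P))"
  have C: "C > 0" "q \<le> C" using q by (auto simp: C_def)
  define d where "d = e / (4 * C)"
  show ?thesis
  proof (rule that[of d])
    show "d > 0" using assms C by (simp add: d_def)
    fix f :: "'a \<Rightarrow> 'b" assume [measurable]: "f \<in> borel_measurable M" and f: "modular f \<le> ennreal d"
    have ptw: "norm (f x) powr q \<le> r + indicator E x + C * (norm (f x) powr p x / p x)" if x: "x \<in> \<Omega>" for x
    proof -
      define t where "t = norm (f x)"
      have t: "t \<ge> 0" and px: "q \<le> p x" "p x > 0" using p_ge[OF x] p_pos[OF x] by (auto simp: t_def)
      have N: "0 \<le> t powr p x / p x" using px by auto
      consider "x \<in> E" | "x \<notin> E" "t \<le> r" | "x \<notin> E" "t > r" by linarith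
      then have "t powr q \<le> r + indicator E x + C * (t powr p x / p x)"
      proof cases
        case 1
        have "t powr q \<le> q * (t powr p x / p x) + 1"
          using q px t by (intro powr_le_smaller_exponent) auto
        also have "\<dots> \<le> C * (t powr p x / p x) + 1"
          using C N by (intro add_mono mult_right_mono) auto
        finally show ?thesis using 1 r by simp
      next
        case 2
        have "t powr q \<le> r powr q" using 2 t q by (intro powr_mono2) auto
        also have "\<dots> \<le> r powr 1" using r q by (intro powr_mono') auto
        also have "\<dots> = r" using r by simp
        finally have "t powr q \<le> r" .
        moreover have "0 \<le> C * (t powr p x / p x)" using N C by (intro mult_nonneg_nonneg) auto
        ultimately show ?thesis using 2(1) by simp
      next
        case 3
        have pP: "p x \<le> real P" using 3 x by (auto simp: E_def)
        have "t powr q \<le> r powr (- real P) * t powr p x"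
        proof (cases "t \<ge> 1")
          case True
          have "t powr q \<le> t powr p x" using True px by (intro powr_mono) auto
          also have "\<dots> \<le> r powr (- real P) * t powr p x"
          proof -
            have "r powr 0 \<le> r powr (- real P)" using r by (intro powr_mono') auto
            then have "1 * t powr p x \<le> r powr (- real P) * t powr p x"
              using r by (intro mult_right_mono) auto
            then show ?thesis by simp
          qed
          finally show ?thesis .
        next
          case False
          have "t powr q \<le> 1" using False t q powr_le1 by auto
          also have "1 = r powr (- real P) * r powr (real P)" using r by (simp add: powr_add[symmetric])
          also have "\<dots> \<le> r powr (- real P) * r powr p x"
            using r pP by (intro mult_left_mono powr_mono') auto
          also have "\<dots> \<le> r powr (- real P) * t powr p x"
            using 3 r px by (intro mult_left_mono powr_mono2) auto
          finally show ?thesis .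
        qed
        also have "\<dots> = (p x * r powr (- real P)) * (t powr p x / p x)"
          using px by simp
        also have "\<dots> \<le> (real P * r powr (- real P)) * (t powr p x / p x)"
          using pP N by (intro mult_right_mono) auto
        also have "\<dots> \<le> C * (t powr p x / p x)"
          using N by (intro mult_right_mono) (auto simp: C_def)
        finally have "t powr q \<le> C * (t powr p x / p x)" .
        moreover have "0 \<le> r + indicat_real E x" using r by simp
        ultimately show ?thesis by linarith
      qed
      then show ?thesis by (simp add: t_def)
    qed
    have "(\<integral>\<^sup>+x. ennreal (norm (f x) powr q) \<partial>M) \<le>
      (\<integral>\<^sup>+x. ennreal r + indicator E x + ennreal C * ennreal (norm (f x) powr p x / p x) \<partial>M)"
    proof (rule nn_integral_mono)
      fix x assume "x \<in> space M"
      then have x: "x \<in> \<Omega>" by simp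
      define z where "z = norm (f x) powr p x / p x"
      have z: "0 \<le> z" using p_pos[OF x] by (simp add: z_def)
      have "ennreal (norm (f x) powr q) \<le> ennreal (r + indicator E x + C * z)"
        using ptw[OF x] unfolding z_def by (rule ennreal_leI)
      also have "\<dots> = ennreal r + ennreal (indicator E x) + ennreal C * ennreal z"
        using r C z by (simp add: ennreal_mult)
      also have "\<dots> = ennreal r + indicator E x + ennreal C * ennreal (norm (f x) powr p x / p x)"
        by (simp add: z_def ennreal_indicator)
      finally show "ennreal (norm (f x) powr q) \<le> ennreal r + indicator E x + ennreal C * ennreal (norm (f x) powr p x / p x)" .
    qed
    also have "\<dots> = ennreal r * ennreal m + emeasure M E + ennreal C * modular f"
      unfolding modular_def by (simp add: nn_integral_add nn_integral_cmult em)
    also have "\<dots> \<le> ennreal (r * m) + ennreal (e / 4) + ennreal C * ennreal d"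
      using P(1) r m0 f by (intro add_mono mult_left_mono)
        (auto simp: ennreal_mult emeasure_eq_measure E_def intro!: ennreal_leI)
    also have "\<dots> = ennreal (r * m + e / 4 + C * d)"
    proof -
      have "0 \<le> r * m" "0 \<le> d" "0 \<le> C * d" "0 \<le> e / 4" using r m0 assms C by (auto simp: d_def)
      then show ?thesis using C by (simp add: ennreal_mult del: times_divide_eq_right)
    qed
    also have "\<dots> \<le> ennreal e"
      using rm C assms by (intro ennreal_leI) (simp add: d_def)
    finally show "(\<integral>\<^sup>+x. ennreal (norm (f x) powr q) \<partial>M) \<le> ennreal e" .
  qed
qed


subsection \<open>The Sobolev space is a vector space\<close>

lemma wg_AE_eq:
  assumes "has_weak_gradient \<Omega> u g"
  shows "AE x in M. wg u x = g x"
  unfolding AE_M_iff by (rule weak_gradient_AE_eq[OF open_dom assms])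

lemma has_weak_gradient_measurable:
  assumes "has_weak_gradient \<Omega> u g"
  shows "u \<in> borel_measurable M" "g \<in> borel_measurable M"
  using assms by (auto simp: has_weak_gradient_def locally_integrable_measurable)

text \<open>
  Weak gradients are unique almost everywhere, so \<open>rho1\<close> may be computed with any of them instead of the
  chosen one.
\<close>

lemma rho1_eq:
  assumes "has_weak_gradient \<Omega> u g"
  shows "rho1 \<Omega> p u = modular u + modular g"
  unfolding rho1_def rho_eq_modular[of u] rho_norm_eq_modular
  using modular_cong_AE[OF wg_AE_eq[OF assms]] by simp

lemma sobolevD:
  assumes "u \<in> sobolev \<Omega> p"
  shows "has_weak_gradient \<Omega> u (wg u)" "u \<in> borel_measurable M" "wg u \<in> borel_measurable M"
    and "\<exists>c>0. modular (\<lambda>x. c *\<^sub>R u x) < \<infinity> \<and> modular (\<lambda>x. c *\<^sub>R wg u x) < \<infinity>"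
proof -
  show wg: "has_weak_gradient \<Omega> u (wg u)"
    using assms by (intro has_weak_gradient_weak_gradient) (auto simp: sobolev_def)
  then show "u \<in> borel_measurable M" "wg u \<in> borel_measurable M"
    by (auto dest: has_weak_gradient_measurable)
  obtain c where c: "c > 0" "rho1 \<Omega> p (\<lambda>x. c * u x) < \<infinity>"
    using assms by (auto simp: sobolev_def)
  then show "\<exists>c>0. modular (\<lambda>x. c *\<^sub>R u x) < \<infinity> \<and> modular (\<lambda>x. c *\<^sub>R wg u x) < \<infinity>"
    using rho1_eq[OF has_weak_gradient_scale[OF wg, of c]] by (auto intro!: exI[of _ c])
qed

lemma sobolevI:
  assumes wg: "has_weak_gradient \<Omega> u g" and c: "c > 0" "modular (\<lambda>x. c *\<^sub>R u x) < \<infinity>" "modular (\<lambda>x. c *\<^sub>R g x) < \<infinity>"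
  shows "u \<in> sobolev \<Omega> p"
  using assms rho1_eq[OF has_weak_gradient_scale[OF wg, of c]] has_weak_gradient_measurable[OF wg]
  by (auto simp: sobolev_def set_borel_measurable_M intro!: exI[of _ c])

lemma sobolev_add:
  assumes u: "u \<in> sobolev \<Omega> p" and v: "v \<in> sobolev \<Omega> p"
  shows "(\<lambda>x. u x + v x) \<in> sobolev \<Omega> p"
proof -
  obtain c where c: "c > 0" "modular (\<lambda>x. c *\<^sub>R u x) < \<infinity>" "modular (\<lambda>x. c *\<^sub>R wg u x) < \<infinity>"
    using sobolevD(4)[OF u] by blast
  obtain d where d: "d > 0" "modular (\<lambda>x. d *\<^sub>R v x) < \<infinity>" "modular (\<lambda>x. d *\<^sub>R wg v x) < \<infinity>"
    using sobolevD(4)[OF v] by blast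
  show ?thesis
  proof (rule sobolevI[OF has_weak_gradient_add[OF sobolevD(1)[OF u] sobolevD(1)[OF v]]])
    show "0 < min c d / 2" using c d by simp
    show "modular (\<lambda>x. (min c d / 2) *\<^sub>R (u x + v x)) < \<infinity>"
      using c d by (intro modular_add_finite[of _ _ c d] sobolevD[OF u] sobolevD[OF v]) auto
    show "modular (\<lambda>x. (min c d / 2) *\<^sub>R (wg u x + wg v x)) < \<infinity>"
      using c d by (intro modular_add_finite[of _ _ c d] sobolevD[OF u] sobolevD[OF v]) auto
  qed
qed

lemma sobolev_scale:
  assumes u: "u \<in> sobolev \<Omega> p"
  shows "(\<lambda>x. a * u x) \<in> sobolev \<Omega> p"
proof -
  obtain c where c: "c > 0" "modular (\<lambda>x. c *\<^sub>R u x) < \<infinity>" "modular (\<lambda>x. c *\<^sub>R wg u x) < \<infinity>"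
    using sobolevD(4)[OF u] by blast
  define d where "d = c / (\<bar>a\<bar> + 1)"
  have d0: "d > 0" using c by (simp add: d_def add_nonneg_pos)
  have "d * \<bar>a\<bar> \<le> d * (\<bar>a\<bar> + 1)" using d0 by (intro mult_left_mono) auto
  also have "\<dots> = c" by (simp add: d_def add_nonneg_pos less_imp_neq[symmetric])
  finally have d: "d > 0" "\<bar>d * a\<bar> \<le> \<bar>c\<bar>" using c d0 by (simp_all add: abs_mult)
  have le: "modular (\<lambda>x. d *\<^sub>R (a *\<^sub>R f x)) \<le> modular (\<lambda>x. c *\<^sub>R f x)" for f :: "'a \<Rightarrow> 'b::euclidean_space"
    using modular_scale_mono[OF d(2), of f] by simp
  show ?thesis
  proof (rule sobolevI[OF has_weak_gradient_scale[OF sobolevD(1)[OF u]] d(1)])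
    show "modular (\<lambda>x. d *\<^sub>R (a * u x)) < \<infinity>" "modular (\<lambda>x. d *\<^sub>R (a *\<^sub>R wg u x)) < \<infinity>"
      using le_less_trans[OF le c(2)] le_less_trans[OF le c(3)] by simp_all
  qed
qed

lemma sobolev_diff:
  assumes u: "u \<in> sobolev \<Omega> p" and v: "v \<in> sobolev \<Omega> p"
  shows "(\<lambda>x. u x - v x) \<in> sobolev \<Omega> p"
  using sobolev_add[OF u sobolev_scale[OF v, of "-1"]] by simp

lemma has_weak_gradient_diff:
  fixes u v :: "'a \<Rightarrow> real"
  assumes "has_weak_gradient \<Omega> u g" "has_weak_gradient \<Omega> v k"
  shows "has_weak_gradient \<Omega> (\<lambda>x. u x - v x) (\<lambda>x. g x - k x)"
  using has_weak_gradient_add[OF assms(1) has_weak_gradient_scale[OF assms(2), of "-1"]] by simp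

lemma bounded_support_modular_finite:
  fixes f :: "'a \<Rightarrow> 'b::euclidean_space"
  assumes K: "compact K" "K \<subseteq> \<Omega>" and f: "\<And>x. x \<in> \<Omega> \<Longrightarrow> x \<notin> K \<Longrightarrow> f x = 0" "\<And>x. norm (f x) \<le> B"
  shows "modular f < \<infinity>"
proof -
  have "bounded (p ` K)"
    using compact_imp_bounded[OF compact_continuous_image[OF continuous_on_subset[OF continuous_p K(2)] K(1)]] .
  then obtain P where "\<forall>y\<in>p ` K. norm y \<le> P" unfolding bounded_iff by blast
  then have P: "p x \<le> P" if "x \<in> K" for x using that by (auto dest: abs_le_D1)
  have "modular f \<le> (\<integral>\<^sup>+x. ennreal (max 1 B powr P) \<partial>M)"
    unfolding modular_def
  proof (rule nn_integral_mono)
    fix x assume "x \<in> space M"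
    then have x: "x \<in> \<Omega>" by simp
    have "norm (f x) powr p x / p x \<le> max 1 B powr P"
    proof (cases "x \<in> K")
      case True
      have "norm (f x) powr p x / p x \<le> norm (f x) powr p x / 1"
        using p_gt_1[OF x] by (intro divide_left_mono) auto
      also have "\<dots> \<le> max 1 B powr p x"
        using f(2)[of x] p_pos[OF x] by (simp add: powr_mono2)
      also have "\<dots> \<le> max 1 B powr P" using P[OF True] by (intro powr_mono) auto
      finally show ?thesis .
    qed (use f(1)[OF x] in simp)
    then show "ennreal (norm (f x) powr p x / p x) \<le> ennreal (max 1 B powr P)" by (rule ennreal_leI)
  qed
  also have "\<dots> < \<infinity>" by (simp add: ennreal_mult_less_top emeasure_eq_measure)
  finally show ?thesis .
qed

lemma test_functions_subset_sobolev: "test_functions \<Omega> \<subseteq> sobolev \<Omega> p"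
proof (rule subsetI)
  fix h :: "'a \<Rightarrow> real" assume h: "h \<in> test_functions \<Omega>"
  have K: "compact (closure {x. h x \<noteq> 0})" "closure {x. h x \<noteq> 0} \<subseteq> \<Omega>" 
    using h by (rule test_functions_support)+
  obtain B where B: "B > 0" "\<And>x. norm (gradient h x) \<le> B" "\<And>x. \<bar>h x\<bar> \<le> B"
    using bounded_gradient[OF h] by blast
  have h0: "h x = 0" if "x \<notin> closure {x. h x \<noteq> 0}" for x
    using that closure_subset[of "{x. h x \<noteq> 0}"] by blast
  show "h \<in> sobolev \<Omega> p"
  proof (rule sobolevI[OF has_weak_gradient_test_function[OF h], of 1])
    show "modular (\<lambda>x. 1 *\<^sub>R h x) < \<infinity>"
      unfolding scaleR_one
      by (rule bounded_support_modular_finite[OF K, of _ B]) (rule h0, assumption, unfold real_norm_def, rule B(3))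
    show "modular (\<lambda>x. 1 *\<^sub>R gradient h x) < \<infinity>"
      unfolding scaleR_one
      by (rule bounded_support_modular_finite[OF K, of _ B]) (rule gradient_0_outside_support, assumption, rule B(2))
  qed simp
qed

section \<open>The space of zero boundary values\<close>

lemma rho1_closedD:
  assumes "rho1_closed \<Omega> p A" "\<And>j::nat. v j \<in> A" "u \<in> sobolev \<Omega> p" 
    "(\<lambda>j. rho1 \<Omega> p (\<lambda>x. v j x - u x)) \<longlonglongrightarrow> 0"
  shows "u \<in> A"
proof -
  have "\<forall>v u. (\<forall>j::nat. v j \<in> A) \<and> u \<in> sobolev \<Omega> p \<and> 
      (\<lambda>j. rho1 \<Omega> p (\<lambda>x. v j x - u x)) \<longlonglongrightarrow> 0 \<longrightarrow> u \<in> A"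
    using assms(1) unfolding rho1_closed_def by (rule conjunct2)
  from this[rule_format, of v u] show ?thesis using assms(2-4) by simp
qed

lemma V0_closed: "rho1_closed \<Omega> p (V0 \<Omega> p)"
proof -
  have S: "rho1_closed \<Omega> p (sobolev \<Omega> p)" unfolding rho1_closed_def by blast
  show ?thesis unfolding rho1_closed_def
  proof (intro conjI allI impI)
    show "V0 \<Omega> p \<subseteq> sobolev \<Omega> p"
      unfolding V0_def by (rule Inter_lower) (simp add: S test_functions_subset_sobolev)
    fix v u assume *: "(\<forall>j::nat. v j \<in> V0 \<Omega> p) \<and> u \<in> sobolev \<Omega> p \<and> (\<lambda>j. rho1 \<Omega> p (\<lambda>x. v j x - u x)) \<longlonglongrightarrow> 0"
    show "u \<in> V0 \<Omega> p"
      unfolding V0_def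
    proof (rule InterI)
      fix A assume A: "A \<in> {A. rho1_closed \<Omega> p A \<and> test_functions \<Omega> \<subseteq> A}"
      then have "V0 \<Omega> p \<subseteq> A" unfolding V0_def by (rule Inter_lower)
      with * have "\<And>j. v j \<in> A" by blast
      with A * show "u \<in> A" by (intro rho1_closedD[of A v u]) simp_all
    qed
  qed
qed

lemma V0_sobolev: "v \<in> V0 \<Omega> p \<Longrightarrow> v \<in> sobolev \<Omega> p"
  using V0_closed unfolding rho1_closed_def by blast

lemma V0_limit:
  assumes "\<And>j::nat. v j \<in> V0 \<Omega> p" "u \<in> sobolev \<Omega> p" "(\<lambda>j. rho1 \<Omega> p (\<lambda>x. v j x - u x)) \<longlonglongrightarrow> 0"
  shows "u \<in> V0 \<Omega> p"
  by (rule rho1_closedD[OF V0_closed assms])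

lemma test_functions_subset_V0: "test_functions \<Omega> \<subseteq> V0 \<Omega> p"
  unfolding V0_def by blast

text \<open>
  Properties of test functions that survive modular limits hold on \<open>V0\<close>. As \<open>V0\<close> is an intersection of
  closed sets, its elements are not given as limits of sequences of test functions, and this
  principle takes the place of approximation.
\<close>

lemma V0_induct [consumes 1, case_names test limit]:
  assumes "v \<in> V0 \<Omega> p"
    and "\<And>h. h \<in> test_functions \<Omega> \<Longrightarrow> Q h"
    and "\<And>v u. (\<And>j::nat. v j \<in> sobolev \<Omega> p) \<Longrightarrow> (\<And>j. Q (v j)) \<Longrightarrow> u \<in> sobolev \<Omega> p \<Longrightarrow>
            (\<lambda>j. rho1 \<Omega> p (\<lambda>x. v j x - u x)) \<longlonglongrightarrow> 0 \<Longrightarrow> Q u"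
  shows "Q v"
proof -
  have "rho1_closed \<Omega> p {v \<in> sobolev \<Omega> p. Q v}"
    unfolding rho1_closed_def
  proof (intro conjI allI impI)
    fix v u assume *: "(\<forall>j::nat. v j \<in> {v \<in> sobolev \<Omega> p. Q v}) \<and> u \<in> sobolev \<Omega> p 
      \<and> (\<lambda>j. rho1 \<Omega> p (\<lambda>x. v j x - u x)) \<longlonglongrightarrow> 0"
    then have "Q u" by (intro assms(3)[of v u]) auto
    with * show "u \<in> {v \<in> sobolev \<Omega> p. Q v}" by simp
  qed auto
  moreover have "test_functions \<Omega> \<subseteq> {v \<in> sobolev \<Omega> p. Q v}"
    using test_functions_subset_sobolev assms(2) by auto
  ultimately have "V0 \<Omega> p \<subseteq> {v \<in> sobolev \<Omega> p. Q v}" unfolding V0_def by blast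
  with assms(1) show ?thesis by blast
qed

text \<open>
  Modular convergence is translation invariant, so one summand can be moved through the closure while the
  other is fixed, first with a test function fixed and then with an arbitrary element of \<open>V0\<close>.
\<close>

lemma V0_add:
  assumes v: "v \<in> V0 \<Omega> p" and w: "w \<in> V0 \<Omega> p"
  shows "(\<lambda>x. v x + w x) \<in> V0 \<Omega> p"
proof -
  have lim: "(\<lambda>x. k x + u x) \<in> V0 \<Omega> p"
    if "\<And>j::nat. (\<lambda>x. k x + f j x) \<in> V0 \<Omega> p" "k \<in> sobolev \<Omega> p" "u \<in> sobolev \<Omega> p"
      "(\<lambda>j. rho1 \<Omega> p (\<lambda>x. f j x - u x)) \<longlonglongrightarrow> 0" for k f u
  proof (rule V0_limit[where v = "\<lambda>j x. k x + f j x"])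
    show "(\<lambda>x. k x + u x) \<in> sobolev \<Omega> p" using that by (intro sobolev_add)
    show "(\<lambda>j. rho1 \<Omega> p (\<lambda>x. k x + f j x - (k x + u x))) \<longlonglongrightarrow> 0" using that(4) by simp
  qed (rule that(1))
  have step: "(\<lambda>x. h x + w x) \<in> V0 \<Omega> p" if h: "h \<in> test_functions \<Omega>" and w: "w \<in> V0 \<Omega> p" for h w
    using w
  proof (induction rule: V0_induct)
    case (test k)
    then show ?case using test test_functions_subset_V0 test_functions_add[OF h] by blast
  next
    case (limit f u)
    then show ?case using lim[of h f u] h limit test_functions_subset_sobolev by auto
  qed
  show ?thesis using w
  proof (induction rule: V0_induct)
    case (test k)
    then show ?case using test step[of k v] v by (simp add: add.commute)
  next
    case (limit f u)
    then show ?case using lim[of v f u] limit V0_sobolev[OF v] by auto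
  qed
qed

lemma rho1_scale_le:
  assumes u: "u \<in> sobolev \<Omega> p" and c: "\<bar>c\<bar> \<le> 1"
  shows "rho1 \<Omega> p (\<lambda>x. c * u x) \<le> rho1 \<Omega> p u"
proof -
  have "modular (\<lambda>x. c *\<^sub>R f x) \<le> modular f" for f :: "'a \<Rightarrow> 'b::euclidean_space"
    using modular_scale_mono[of c 1 f] c by simp
  from add_mono[OF this[of u] this[of "wg u"]] show ?thesis
    using rho1_eq[OF sobolevD(1)[OF u]] rho1_eq[OF has_weak_gradient_scale[OF sobolevD(1)[OF u], of c]]
    by simp
qed

text \<open>
  Only contractions preserve modular convergence. Larger factors are reached by adding elements of
  \<open>V0\<close>.
\<close>

lemma V0_scale_le_1:
  assumes v: "v \<in> V0 \<Omega> p" and c: "\<bar>c\<bar> \<le> 1"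
  shows "(\<lambda>x. c * v x) \<in> V0 \<Omega> p"
  using v
proof (induction rule: V0_induct)
  case (test h)
  then show ?case using test test_functions_scale test_functions_subset_V0 by blast
next
  case (limit f u)
  show ?case
  proof (rule V0_limit[where v = "\<lambda>j x. c * f j x"])
    show "(\<lambda>x. c * u x) \<in> sobolev \<Omega> p" using limit by (intro sobolev_scale)
    have "rho1 \<Omega> p (\<lambda>x. c * f j x - c * u x) \<le> rho1 \<Omega> p (\<lambda>x. f j x - u x)" for j
      using rho1_scale_le[OF sobolev_diff[OF limit(1) limit(2)] c, of j] by (simp add: right_diff_distrib)
    then show "(\<lambda>j. rho1 \<Omega> p (\<lambda>x. c * f j x - c * u x)) \<longlonglongrightarrow> 0"
      by (intro tendsto_sandwich[OF _ _ tendsto_const limit(3)]) auto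
  qed (rule limit)
qed

lemma V0_diff:
  assumes v: "v \<in> V0 \<Omega> p" and w: "w \<in> V0 \<Omega> p"
  shows "(\<lambda>x. v x - w x) \<in> V0 \<Omega> p"
  using V0_add[OF v V0_scale_le_1[OF w, of "-1"]] by simp

text \<open>The \<open>q\<close>-th power of the \<open>L\<^sup>q\<close> norm; with constant exponent, convergence is invariant under scaling.\<close>

definition Lq :: "('a \<Rightarrow> 'b::euclidean_space) \<Rightarrow> ennreal" where
  "Lq f = (\<integral>\<^sup>+x. ennreal (norm (f x) powr q) \<partial>M)"

lemma Lq_cong_AE: "AE x in M. f x = g x \<Longrightarrow> Lq f = Lq g"
  unfolding Lq_def by (intro nn_integral_cong_AE) auto

lemma Lq_minus_commute: "Lq (\<lambda>x. f x - g x) = Lq (\<lambda>x. g x - f x)"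
  unfolding Lq_def by (simp add: norm_minus_commute)

lemma Lq_add_le:
  fixes f g :: "'a \<Rightarrow> 'b::euclidean_space"
  assumes [measurable]: "f \<in> borel_measurable M" "g \<in> borel_measurable M"
  shows "Lq (\<lambda>x. f x + g x) \<le> ennreal (2 powr q) * (Lq f + Lq g)"
proof -
  have "Lq (\<lambda>x. f x + g x) \<le> (\<integral>\<^sup>+x. ennreal (2 powr q) * (ennreal (norm (f x) powr q) + ennreal (norm (g x) powr q)) \<partial>M)"
    unfolding Lq_def
    by (intro nn_integral_mono) (simp add: ennreal_plus[symmetric] ennreal_mult[symmetric] ennreal_leI norm_add_powr_le q_gt_1 del: ennreal_plus)
  also have "\<dots> = ennreal (2 powr q) * (Lq f + Lq g)"
    unfolding Lq_def by (subst nn_integral_cmult) (auto simp: nn_integral_add)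
  finally show ?thesis .
qed

text \<open>
  Modular convergence implies convergence in \<open>W\<^sup>1\<^sup>,\<^sup>q\<close>, so membership in the \<open>W\<^sup>1\<^sup>,\<^sup>q\<close> closure of the
  test functions survives modular limits.
\<close>

lemma V0_approximation:
  assumes "v \<in> V0 \<Omega> p" and "0 < (e::real)"
  obtains h where "h \<in> test_functions \<Omega>" "Lq (\<lambda>x. v x - h x) \<le> ennreal e"
    "Lq (\<lambda>x. wg v x - gradient h x) \<le> ennreal e"
proof -
  have "\<forall>e>0. \<exists>h\<in>test_functions \<Omega>. Lq (\<lambda>x. v x - h x) \<le> ennreal e \<and> Lq (\<lambda>x. wg v x - gradient h x) \<le> ennreal e"
    using assms(1)
  proof (induction rule: V0_induct)
    case (test h)
    have "Lq (\<lambda>x. wg h x - gradient h x) = Lq (\<lambda>x. 0 :: 'a)"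
      by (rule Lq_cong_AE) (use wg_AE_eq[OF has_weak_gradient_test_function[OF test(1)]] in auto)
    then show ?case using test by (auto simp: Lq_def intro!: bexI[of _ h])
  next
    case (limit f u)
    show ?case
    proof (intro allI impI)
      fix e :: real assume e: "e > 0"
      define r where "r = e / (2 * 2 powr q)"
      have r: "r > 0" using e by (simp add: r_def)
      obtain d1 where d1: "d1 > 0" "\<And>f :: 'a \<Rightarrow> real. f \<in> borel_measurable M \<Longrightarrow> modular f \<le> ennreal d1 \<Longrightarrow> Lq f \<le> ennreal r"
        using modular_small_imp_Lq_small[OF r] unfolding Lq_def by blast
      obtain d2 where d2: "d2 > 0" "\<And>f :: 'a \<Rightarrow> 'a. f \<in> borel_measurable M \<Longrightarrow> modular f \<le> ennreal d2 \<Longrightarrow> Lq f \<le> ennreal r"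
        using modular_small_imp_Lq_small[OF r] unfolding Lq_def by blast
      have "\<forall>\<^sub>F j in sequentially. rho1 \<Omega> p (\<lambda>x. f j x - u x) < ennreal (min d1 d2)"
        using limit(3) d1 d2 by (intro order_tendstoD(2)) auto
      then obtain j where j: "rho1 \<Omega> p (\<lambda>x. f j x - u x) < ennreal (min d1 d2)"
        using eventually_happens'[OF sequentially_bot] by blast
      note fj = sobolevD[OF limit(1)[of j]] and u = sobolevD[OF limit(2)]
      have "modular (\<lambda>x. f j x - u x) + modular (\<lambda>x. wg (f j) x - wg u x) \<le> ennreal (min d1 d2)"
        using j rho1_eq[OF has_weak_gradient_diff[OF fj(1) u(1)]] by simp
      then have le: "A \<le> ennreal (min d1 d2)" 
        if "A \<in> {modular (\<lambda>x. f j x - u x), modular (\<lambda>x. wg (f j) x - wg u x)}" for A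
        using that by (elim order_trans[rotated]) (auto simp: add_increasing add_increasing2)
      have "modular (\<lambda>x. f j x - u x) \<le> ennreal d1" "modular (\<lambda>x. wg (f j) x - wg u x) \<le> ennreal d2"
        by (rule order_trans[OF le ennreal_leI], simp, simp)+
      then have Lr: "Lq (\<lambda>x. u x - f j x) \<le> ennreal r" "Lq (\<lambda>x. wg u x - wg (f j) x) \<le> ennreal r"
        using fj u by (auto intro!: d1 d2 simp: Lq_minus_commute[of u] Lq_minus_commute[of "wg u"])
      obtain h where h: "h \<in> test_functions \<Omega>" "Lq (\<lambda>x. f j x - h x) \<le> ennreal r"
        "Lq (\<lambda>x. wg (f j) x - gradient h x) \<le> ennreal r"
        using limit(4)[of j] r by blast
      note hm = has_weak_gradient_measurable[OF has_weak_gradient_test_function[OF h(1)]]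
      have fin: "ennreal (2 powr q) * (A + B) \<le> ennreal e" if "A \<le> ennreal r" "B \<le> ennreal r" for A B
      proof -
        have "ennreal (2 powr q) * (A + B) \<le> ennreal (2 powr q) * (ennreal r + ennreal r)"
          using that by (intro mult_left_mono add_mono) auto
        also have "\<dots> = ennreal e"
          using r by (simp add: ennreal_mult[symmetric] ennreal_plus[symmetric] r_def del: ennreal_plus)
        finally show ?thesis .
      qed
      have "Lq (\<lambda>x. (u x - f j x) + (f j x - h x)) \<le> ennreal e"
        using fj u hm by (intro order_trans[OF Lq_add_le fin] Lr h) auto
      moreover have "Lq (\<lambda>x. (wg u x - wg (f j) x) + (wg (f j) x - gradient h x)) \<le> ennreal e"
        using fj u hm by (intro order_trans[OF Lq_add_le fin] Lr h) auto
      ultimately show "\<exists>h\<in>test_functions \<Omega>. Lq (\<lambda>x. u x - h x) \<le> ennreal e \<and> Lq (\<lambda>x. wg u x - gradient h x) \<le> ennreal e"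
        using h(1) by auto
    qed
  qed
  then show ?thesis using assms(2) that by blast
qed


subsection \<open>Uniform and integral bounds\<close>

lemma nn_integral_norm_le_Lq:
  fixes f :: "'a \<Rightarrow> 'b::euclidean_space"
  assumes [measurable]: "f \<in> borel_measurable M" and r: "r > 0"
  shows "(\<integral>\<^sup>+x. ennreal (norm (f x)) \<partial>M) \<le> ennreal (r * measure M \<Omega>) + ennreal (r powr (1 - q)) * Lq f"
proof -
  have "(\<integral>\<^sup>+x. ennreal (norm (f x)) \<partial>M) \<le> (\<integral>\<^sup>+x. ennreal r + ennreal (r powr (1 - q)) * ennreal (norm (f x) powr q) \<partial>M)"
    using r q_gt_1
    by (intro nn_integral_mono)
      (simp add: ennreal_plus[symmetric] ennreal_mult[symmetric] ennreal_leI Young_weight del: ennreal_plus)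
  also have "\<dots> = ennreal (r * measure M \<Omega>) + ennreal (r powr (1 - q)) * Lq f"
    unfolding Lq_def using r by (simp add: nn_integral_add nn_integral_cmult emeasure_eq_measure ennreal_mult)
  finally show ?thesis .
qed

lemma modular_small_imp_L1_small:
  assumes e: "e > 0"
  obtains d :: real where "d > 0" 
    "\<And>f :: 'a \<Rightarrow> 'b::euclidean_space. f \<in> borel_measurable M \<Longrightarrow> modular f \<le> ennreal d \<Longrightarrow> 
       (\<integral>\<^sup>+x. ennreal (norm (f x)) \<partial>M) \<le> ennreal e"
proof -
  define m where "m = measure M \<Omega>"
  have m: "m \<ge> 0" by (simp add: m_def)
  define r where "r = e / (2 * (m + 1))"
  have r: "r > 0" using e m by (simp add: r_def)
  have rm: "r * m \<le> e / 2"
  proof -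
    have "r * m \<le> r * (m + 1)" using r by (intro mult_left_mono) auto
    also have "\<dots> = e / 2" using m by (simp add: r_def field_simps)
    finally show ?thesis .
  qed
  define s where "s = e / (2 * r powr (1 - q))"
  have s: "s > 0" "r powr (1 - q) * s = e / 2" using e r by (auto simp: s_def)
  obtain d where d: "d > 0" "\<And>f :: 'a \<Rightarrow> 'b. f \<in> borel_measurable M \<Longrightarrow> modular f \<le> ennreal d \<Longrightarrow> Lq f \<le> ennreal s"
    using modular_small_imp_Lq_small[OF s(1)] unfolding Lq_def by blast
  show ?thesis
  proof (rule that[OF d(1)])
    fix f :: "'a \<Rightarrow> 'b" assume f: "f \<in> borel_measurable M" "modular f \<le> ennreal d"
    have "(\<integral>\<^sup>+x. ennreal (norm (f x)) \<partial>M) \<le> ennreal (r * m) + ennreal (r powr (1 - q)) * Lq f"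
      unfolding m_def by (rule nn_integral_norm_le_Lq[OF f(1) r])
    also have "\<dots> \<le> ennreal (e / 2) + ennreal (r powr (1 - q)) * ennreal s"
      using rm d(2)[OF f] by (intro add_mono mult_left_mono ennreal_leI) auto
    also have "\<dots> = ennreal (e / 2) + ennreal (e / 2)"
      unfolding s(2)[symmetric] using s(1) by (simp add: ennreal_mult)
    also have "\<dots> = ennreal e" using e by (simp add: ennreal_plus[symmetric] del: ennreal_plus)
    finally show "(\<integral>\<^sup>+x. ennreal (norm (f x)) \<partial>M) \<le> ennreal e" .
  qed
qed

lemma modular_finite_imp_integrable:
  fixes f :: "'a \<Rightarrow> 'b::euclidean_space"
  assumes [measurable]: "f \<in> borel_measurable M" and f: "modular f < \<infinity>"
  shows "integrable M f"
proof (rule integrableI_bounded)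
  have "(\<integral>\<^sup>+x. ennreal (norm (f x)) \<partial>M) \<le> (\<integral>\<^sup>+x. 2 + ennreal q * ennreal (norm (f x) powr p x / p x) \<partial>M)"
  proof (rule nn_integral_mono)
    fix x assume "x \<in> space M"
    then have x: "x \<in> \<Omega>" by simp
    define z where "z = norm (f x) powr p x / p x"
    have z: "0 \<le> z" using p_pos[OF x] by (simp add: z_def)
    have "norm (f x) \<le> 1 + norm (f x) powr q"
      using Young_weight[of "norm (f x)" 1 q] q_gt_1 by simp
    also have "\<dots> \<le> 1 + (q * z + 1)"
      using q_gt_1 p_ge[OF x] unfolding z_def by (intro add_left_mono powr_le_smaller_exponent) auto
    finally have "norm (f x) \<le> 2 + q * z" by simp
    then have "ennreal (norm (f x)) \<le> ennreal (2 + q * z)" by (rule ennreal_leI)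
    also have "\<dots> = 2 + ennreal q * ennreal z"
      using z q_gt_1 by (simp add: ennreal_mult)
    finally show "ennreal (norm (f x)) \<le> 2 + ennreal q * ennreal (norm (f x) powr p x / p x)"
      by (simp add: z_def)
  qed
  also have "\<dots> = 2 * emeasure M \<Omega> + ennreal q * modular f"
    unfolding modular_def by (simp add: nn_integral_add nn_integral_cmult)
  also have "\<dots> < \<infinity>"
    using f by (simp add: emeasure_eq_measure ennreal_mult_less_top)
  finally show "(\<integral>\<^sup>+x. ennreal (norm (f x)) \<partial>M) < \<infinity>" .
qed measurable

lemma sobolev_wg_integrable:
  assumes u: "u \<in> sobolev \<Omega> p"
  shows "integrable M (wg u)"
proof -
  obtain c where c: "c > 0" "modular (\<lambda>x. c *\<^sub>R wg u x) < \<infinity>" using sobolevD(4)[OF u] by blast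
  have "integrable M (\<lambda>x. c *\<^sub>R wg u x)"
    by (intro modular_finite_imp_integrable c borel_measurable_scaleR borel_measurable_const sobolevD(3)[OF u])
  then have "integrable M (\<lambda>x. (1 / c) *\<^sub>R (c *\<^sub>R wg u x))" by (rule integrable_scaleR_right)
  then show ?thesis using c by simp
qed

text \<open>
  Test functions approximating \<open>v\<close> have \<open>L\<^sup>q\<close> norms of the gradient bounded by a multiple of that of
  \<open>v\<close>, and hence a common supremum bound \<open>e\<close>. The excess of \<open>|v|\<close> over \<open>e\<close> is at most the
  distance from \<open>v\<close> to the test function, so its integral vanishes.
\<close>

lemma V0_sup_bound_Lq:
  assumes e: "e > 0"
  obtains d :: real where "d > 0" 
    "\<And>v. v \<in> V0 \<Omega> p \<Longrightarrow> Lq (wg v) \<le> ennreal d \<Longrightarrow> AE x in M. \<bar>v x\<bar> \<le> e"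
proof -
  obtain C where C: "C > 0" 
    "\<And>h x e I. h \<in> test_functions \<Omega> \<Longrightarrow> e > 0 \<Longrightarrow> I \<ge> 0 \<Longrightarrow> 
       (\<integral>\<^sup>+y. ennreal (norm (gradient h y) powr q) \<partial>lborel) \<le> ennreal I \<Longrightarrow>
       \<bar>h x\<bar> \<le> C * (e + e powr (1 - q) * I)"
    using test_function_sup_bound[OF bounded_dom q_gt] by metis
  define r where "r = e / (2 * C)"
  have r: "r > 0" using e C by (simp add: r_def)
  \<comment> \<open>Chosen so that both terms of the supremum bound are equal to \<open>r = e / (2 C)\<close>.\<close>
  define d where "d = r / (r powr (1 - q) * (2 powr q * 2))"
  have d: "d > 0" using r by (simp add: d_def)
  define I where "I = 2 powr q * (2 * d)"
  have I: "I \<ge> 0" "r powr (1 - q) * I = r" using d r by (auto simp: I_def d_def)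
  show ?thesis
  proof (rule that[OF d])
    fix v assume v: "v \<in> V0 \<Omega> p" and Lv: "Lq (wg v) \<le> ennreal d"
    note vm [measurable] = sobolevD(2,3)[OF V0_sobolev[OF v]]
    have "(\<integral>\<^sup>+x. ennreal (max 0 (\<bar>v x\<bar> - e) powr q) \<partial>M) \<le> 0"
    proof (rule ennreal_le_epsilon)
      fix s :: real assume "s > 0"
      \<comment> \<open>Approximation to within \<open>d\<close> keeps the supremum bound fixed while \<open>s\<close> tends to 0.\<close>
      define t where "t = min s d"
      have t: "t > 0" "t \<le> s" "t \<le> d" using \<open>s > 0\<close> d by (auto simp: t_def)
      obtain h where h: "h \<in> test_functions \<Omega>" "Lq (\<lambda>x. v x - h x) \<le> ennreal t"
        "Lq (\<lambda>x. wg v x - gradient h x) \<le> ennreal t"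
        using V0_approximation[OF v t(1)] by blast
      note hm [measurable] = has_weak_gradient_measurable[OF has_weak_gradient_test_function[OF h(1)]]
      have "Lq (\<lambda>x. (gradient h x - wg v x) + wg v x) \<le> ennreal (2 powr q) * (Lq (\<lambda>x. gradient h x - wg v x) + Lq (wg v))"
        by (rule Lq_add_le) measurable
      also have "\<dots> \<le> ennreal (2 powr q) * (ennreal d + ennreal d)"
        using h(3) Lv t unfolding Lq_minus_commute[of "gradient h"]
        by (intro mult_left_mono add_mono) (auto elim!: order_trans intro: ennreal_leI)
      also have "\<dots> = ennreal I"
        using d by (simp add: I_def ennreal_mult[symmetric] ennreal_plus[symmetric] del: ennreal_plus)
      finally have LI: "Lq (gradient h) \<le> ennreal I" by simp
      have "(\<integral>\<^sup>+y. ennreal (norm (gradient h y) powr q) \<partial>lborel) = Lq (gradient h)"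
      proof -
        have "gradient h y = 0" if "y \<notin> \<Omega>" for y
          using that test_functions_support(2)[OF h(1)] by (intro gradient_0_outside_support) blast
        then have "ennreal (norm (gradient h y) powr q) = ennreal (norm (gradient h y) powr q) * indicator \<Omega> y" for y
          by (cases "y \<in> \<Omega>") auto
        then show ?thesis
          unfolding Lq_def by (subst nn_integral_restrict_space) (auto intro: nn_integral_cong)
      qed
      with LI have "\<bar>h x\<bar> \<le> C * (r + r powr (1 - q) * I)" for x
        by (intro C(2)[OF h(1) r I(1)]) simp
      then have hb: "\<bar>h x\<bar> \<le> e" for x using I C by (simp add: r_def)
      have "(\<integral>\<^sup>+x. ennreal (max 0 (\<bar>v x\<bar> - e) powr q) \<partial>M) \<le> Lq (\<lambda>x. v x - h x)"
        unfolding Lq_def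
      proof (rule nn_integral_mono, rule ennreal_leI, rule powr_mono2)
        fix x show "max 0 (\<bar>v x\<bar> - e) \<le> norm (v x - h x)"
          using hb[of x] by (simp add: real_norm_def)
      qed (use q_gt_1 in auto)
      also have "\<dots> \<le> 0 + ennreal s" using h(2) t ennreal_leI[of t s] by (simp add: order_trans)
      finally show "(\<integral>\<^sup>+x. ennreal (max 0 (\<bar>v x\<bar> - e) powr q) \<partial>M) \<le> 0 + ennreal s" .
    qed
    then have "(\<integral>\<^sup>+x. ennreal (max 0 (\<bar>v x\<bar> - e) powr q) \<partial>M) = 0" by simp
    then have "AE x in M. ennreal (max 0 (\<bar>v x\<bar> - e) powr q) = 0"
      by (subst (asm) nn_integral_0_iff_AE) measurable
    then show "AE x in M. \<bar>v x\<bar> \<le> e"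
      by (auto elim!: eventually_mono simp: ennreal_eq_0_iff max_def split: if_splits)
  qed
qed

text \<open>The factor 1/2 matches the form in which uniform convexity delivers the Cauchy property.\<close>

lemma V0_sup_bound:
  assumes e: "e > 0"
  obtains d :: real where "d > 0" 
    "\<And>v. v \<in> V0 \<Omega> p \<Longrightarrow> modular (\<lambda>x. (1/2) *\<^sub>R wg v x) \<le> ennreal d \<Longrightarrow> AE x in M. \<bar>v x\<bar> \<le> e"
proof -
  obtain s where s: "s > 0" "\<And>v. v \<in> V0 \<Omega> p \<Longrightarrow> Lq (wg v) \<le> ennreal s \<Longrightarrow> AE x in M. \<bar>v x\<bar> \<le> e / 2"
    using V0_sup_bound_Lq[of "e / 2"] e by auto
  obtain d where d: "d > 0" "\<And>f :: 'a \<Rightarrow> 'a. f \<in> borel_measurable M \<Longrightarrow> modular f \<le> ennreal d \<Longrightarrow> Lq f \<le> ennreal s"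
    using modular_small_imp_Lq_small[OF s(1)] unfolding Lq_def by blast
  show ?thesis
  proof (rule that[OF d(1)])
    fix v assume v: "v \<in> V0 \<Omega> p" and mv: "modular (\<lambda>x. (1/2) *\<^sub>R wg v x) \<le> ennreal d"
    note vm [measurable] = sobolevD(2,3)[OF V0_sobolev[OF v]]
    have "Lq (wg (\<lambda>x. (1/2) * v x)) = Lq (\<lambda>x. (1/2) *\<^sub>R wg v x)"
      by (rule Lq_cong_AE[OF wg_AE_eq[OF has_weak_gradient_scale[OF sobolevD(1)[OF V0_sobolev[OF v]]]]])
    also have "\<dots> \<le> ennreal s" using mv by (intro d(2)) measurable
    finally have "AE x in M. \<bar>(1/2) * v x\<bar> \<le> e / 2"
      using V0_scale_le_1[OF v, of "1/2"] by (intro s(2)) auto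
    then show "AE x in M. \<bar>v x\<bar> \<le> e"
      by (auto elim!: eventually_mono simp: abs_mult)
  qed
qed

lemma abs_integral_mult_le:
  fixes f k :: "'a \<Rightarrow> real"
  assumes f: "(\<integral>\<^sup>+x. ennreal \<bar>f x\<bar> \<partial>M) \<le> ennreal e" and k: "\<And>x. \<bar>k x\<bar> \<le> B" and e: "e \<ge> 0" "B \<ge> 0"
    and [measurable]: "f \<in> borel_measurable M" "k \<in> borel_measurable M"
  shows "\<bar>LINT x|M. f x * k x\<bar> \<le> B * e"
proof (cases "integrable M (\<lambda>x. f x * k x)")
  case True
  have "ennreal (norm (LINT x|M. f x * k x)) \<le> (\<integral>\<^sup>+x. ennreal (norm (f x * k x)) \<partial>M)"
    by (rule integral_norm_bound_ennreal[OF True])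
  also have "\<dots> \<le> (\<integral>\<^sup>+x. ennreal B * ennreal \<bar>f x\<bar> \<partial>M)"
    using k e by (intro nn_integral_mono)
      (auto simp: ennreal_mult[symmetric] abs_mult mult.commute[of B] intro!: ennreal_leI mult_left_mono)
  also have "\<dots> = ennreal B * (\<integral>\<^sup>+x. ennreal \<bar>f x\<bar> \<partial>M)" by (rule nn_integral_cmult) measurable
  also have "\<dots> \<le> ennreal B * ennreal e" using f by (rule mult_left_mono) simp
  also have "\<dots> = ennreal (B * e)" using e by (simp add: ennreal_mult)
  finally show ?thesis using e by (simp add: ennreal_le_iff)
qed (use e in \<open>simp add: not_integrable_integral_eq\<close>)

lemma has_weak_gradient_L1_limit:
  fixes w :: "nat \<Rightarrow> 'a \<Rightarrow> real"
  assumes w: "\<And>j. has_weak_gradient \<Omega> (w j) (G j)"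
    and [measurable]: "v \<in> borel_measurable M" "g \<in> borel_measurable M"
    and L1: "\<And>e. e > 0 \<Longrightarrow> \<exists>j. (\<integral>\<^sup>+x. ennreal \<bar>w j x - v x\<bar> \<partial>M) \<le> ennreal e \<and> (\<integral>\<^sup>+x. ennreal (norm (G j x - g x)) \<partial>M) \<le> ennreal e"
  shows "has_weak_gradient \<Omega> v g"
  unfolding has_weak_gradient_alt
proof (intro conjI ballI)
  note [measurable] = has_weak_gradient_measurable[OF w]
  obtain j where j: "(\<integral>\<^sup>+x. ennreal \<bar>w j x - v x\<bar> \<partial>M) \<le> ennreal 1" "(\<integral>\<^sup>+x. ennreal (norm (G j x - g x)) \<partial>M) \<le> ennreal 1"
    using L1[of 1] by auto
  have i1: "integrable M (\<lambda>x. w j x - v x)" 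
  proof (rule integrableI_bounded)
    show "(\<integral>\<^sup>+x. ennreal (norm (w j x - v x)) \<partial>M) < \<infinity>"
      using j(1) by (auto intro: le_less_trans)
  qed measurable
  have i2: "integrable M (\<lambda>x. G j x - g x)"
  proof (rule integrableI_bounded)
    show "(\<integral>\<^sup>+x. ennreal (norm (G j x - g x)) \<partial>M) < \<infinity>"
      using j(2) by (auto intro: le_less_trans)
  qed measurable
  have "locally_integrable_on \<Omega> (\<lambda>x. w j x + (-1) *\<^sub>R (w j x - v x))"
    using w[of j] by (intro locally_integrable_on_add locally_integrable_on_scale integrable_imp_locally_integrable[OF i1])
      (simp add: has_weak_gradient_def)
  then show lv: "locally_integrable_on \<Omega> v" by simp
  have "locally_integrable_on \<Omega> (\<lambda>x. G j x + (-1) *\<^sub>R (G j x - g x))"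
    using w[of j] by (intro locally_integrable_on_add locally_integrable_on_scale integrable_imp_locally_integrable[OF i2])
      (simp add: has_weak_gradient_def)
  then show lg: "locally_integrable_on \<Omega> g" by simp
  fix h :: "'a \<Rightarrow> real" and b :: 'a assume h: "h \<in> test_functions \<Omega>" and b: "b \<in> Basis"
  obtain B where B: "B > 0" "\<And>x. norm (gradient h x) \<le> B" "\<And>x. \<bar>h x\<bar> \<le> B"
    using bounded_gradient[OF h] by blast
  have Bb: "\<bar>gradient h x \<bullet> b\<bar> \<le> B" for x
    using B(2)[of x] Basis_le_norm[OF b, of "gradient h x"] by simp
  note [measurable] = has_weak_gradient_measurable[OF has_weak_gradient_test_function[OF h]]
  define A where "A = (LINT x|M. v x * (gradient h x \<bullet> b)) + (LINT x|M. (g x \<bullet> b) * h x)"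
  have "\<bar>A\<bar> \<le> 0 + e" if "e > 0" for e
  proof -
    define s where "s = e / (2 * B)"
    have s: "s > 0" using that B by (simp add: s_def)
    obtain i where i: "(\<integral>\<^sup>+x. ennreal \<bar>w i x - v x\<bar> \<partial>M) \<le> ennreal s" "(\<integral>\<^sup>+x. ennreal (norm (G i x - g x)) \<partial>M) \<le> ennreal s"
      using L1[OF s] by auto
    have li: "locally_integrable_on \<Omega> (w i)" "locally_integrable_on \<Omega> (G i)"
      using w[of i] by (simp_all add: has_weak_gradient_def)
    have w0: "(LINT x|M. w i x * (gradient h x \<bullet> b)) = - (LINT x|M. (G i x \<bullet> b) * h x)"
      using w[of i] h b unfolding has_weak_gradient_alt integral_M by blast
    have "(LINT x|M. (w i x - v x) * (gradient h x \<bullet> b)) 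
       = (LINT x|M. w i x * (gradient h x \<bullet> b)) - (LINT x|M. v x * (gradient h x \<bullet> b))"
      unfolding left_diff_distrib
      by (intro Bochner_Integration.integral_diff set_integrable_mult_gradient[OF _ h, unfolded integrable_M] li lv)
    moreover have "(LINT x|M. ((G i x - g x) \<bullet> b) * h x) 
       = (LINT x|M. (G i x \<bullet> b) * h x) - (LINT x|M. (g x \<bullet> b) * h x)"
      unfolding left_diff_distrib inner_diff_left
      by (intro Bochner_Integration.integral_diff set_integrable_inner_mult_test_function[OF _ h, unfolded integrable_M] li lg)
    ultimately have A: "A = - (LINT x|M. (w i x - v x) * (gradient h x \<bullet> b)) - (LINT x|M. ((G i x - g x) \<bullet> b) * h x)"
      using w0 by (simp add: A_def)
    have 1: "\<bar>LINT x|M. (w i x - v x) * (gradient h x \<bullet> b)\<bar> \<le> B * s"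
      using i(1) Bb s B by (intro abs_integral_mult_le) auto
    have "(\<integral>\<^sup>+x. ennreal \<bar>(G i x - g x) \<bullet> b\<bar> \<partial>M) \<le> (\<integral>\<^sup>+x. ennreal (norm (G i x - g x)) \<partial>M)"
      by (intro nn_integral_mono ennreal_leI Basis_le_norm b)
    then have 2: "\<bar>LINT x|M. ((G i x - g x) \<bullet> b) * h x\<bar> \<le> B * s"
      using i(2) B s by (intro abs_integral_mult_le) auto
    have "\<bar>A\<bar> \<le> B * s + B * s" using A 1 2 by linarith
    also have "\<dots> = e" using B by (simp add: s_def)
    finally show ?thesis by simp
  qed
  then have "\<bar>A\<bar> \<le> 0" by (rule field_le_epsilon)
  then show "(LINT x:\<Omega>|lborel. v x * (gradient h x \<bullet> b)) = - (LINT x:\<Omega>|lborel. (g x \<bullet> b) * h x)"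
    unfolding integral_M by (simp add: A_def)
qed


subsection \<open>Completeness of the space of zero boundary values\<close>

lemma modular_le_of_AE_bound:
  fixes f :: "'a \<Rightarrow> 'b::euclidean_space"
  assumes f: "AE x in M. norm (f x) \<le> e" and e: "0 \<le> e" "e \<le> 1"
  shows "modular f \<le> ennreal (e * measure M \<Omega>)"
proof -
  have "modular f \<le> (\<integral>\<^sup>+x. ennreal e \<partial>M)"
    unfolding modular_def
  proof (rule nn_integral_mono_AE)
    have "AE x in M. x \<in> \<Omega>" by (simp add: AE_M_iff)
    with f show "AE x in M. ennreal (norm (f x) powr p x / p x) \<le> ennreal e"
    proof eventually_elim
      case (elim x)
      note px = p_gt_1[OF elim(2)]
      have "norm (f x) powr p x / p x \<le> norm (f x) powr p x / 1"
        using px by (intro divide_left_mono) auto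
      also have "\<dots> \<le> e powr p x" using elim px by (simp add: powr_mono2)
      also have "\<dots> \<le> e powr 1" using px e by (intro powr_mono') auto
      also have "\<dots> = e" using e by simp
      finally show ?case by (rule ennreal_leI)
    qed
  qed
  also have "\<dots> = ennreal (e * measure M \<Omega>)"
    using e by (simp add: emeasure_eq_measure ennreal_mult)
  finally show ?thesis .
qed

lemma AE_Cauchy_uniform_limit:
  fixes w :: "nat \<Rightarrow> 'a \<Rightarrow> real"
  assumes [measurable]: "\<And>j. w j \<in> borel_measurable M"
    and Cau: "\<And>e. e > 0 \<Longrightarrow> \<exists>N. \<forall>j\<ge>N. \<forall>k\<ge>N. AE x in M. \<bar>w j x - w k x\<bar> \<le> e"
  obtains v where "v \<in> borel_measurable M" 
    "\<And>e. e > 0 \<Longrightarrow> \<exists>N. \<forall>j\<ge>N. AE x in M. \<bar>w j x - v x\<bar> \<le> e"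
proof -
  have "\<exists>N. \<forall>n. \<forall>j\<ge>N n. \<forall>k\<ge>N n. AE x in M. \<bar>w j x - w k x\<bar> \<le> 1 / real (Suc n)"
    by (intro choice allI Cau) simp
  then obtain N where N: "\<And>n j k. j \<ge> N n \<Longrightarrow> k \<ge> N n \<Longrightarrow> AE x in M. \<bar>w j x - w k x\<bar> \<le> 1 / real (Suc n)"
    by blast
  have "AE x in M. \<bar>w (N n + j) x - w (N n + k) x\<bar> \<le> 1 / real (Suc n)" for n j k
    by (rule N) auto
  then have all: "AE x in M. \<forall>n j k. \<bar>w (N n + j) x - w (N n + k) x\<bar> \<le> 1 / real (Suc n)"
    by (simp only: AE_all_countable) blast
  define v where "v x = lim (\<lambda>j. w j x)" for x
  have vm: "v \<in> borel_measurable M" unfolding v_def by measurable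
  have bnd: "AE x in M. \<forall>n j. \<bar>w (N n + j) x - v x\<bar> \<le> 1 / real (Suc n)"
    using all
  proof (rule eventually_mono)
    fix x assume x: "\<forall>n j k. \<bar>w (N n + j) x - w (N n + k) x\<bar> \<le> 1 / real (Suc n)"
    have le: "\<bar>w j x - w k x\<bar> \<le> 1 / real (Suc n)" if "j \<ge> N n" "k \<ge> N n" for n j k
      using x[rule_format, of n "j - N n" "k - N n"] that by simp
    have "Cauchy (\<lambda>j. w j x)"
    proof (rule CauchyI)
      fix e :: real assume "e > 0"
      then obtain n where n: "1 / real (Suc n) < e" using nat_approx_posE by metis
      show "\<exists>M. \<forall>m\<ge>M. \<forall>n\<ge>M. norm (w m x - w n x) < e"
        using le[of n] n by (intro exI[of _ "N n"]) (auto intro: le_less_trans)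
    qed
    then have lim: "(\<lambda>j. w j x) \<longlonglongrightarrow> v x"
      unfolding v_def by (simp add: Cauchy_convergent_iff convergent_LIMSEQ_iff)
    show "\<forall>n j. \<bar>w (N n + j) x - v x\<bar> \<le> 1 / real (Suc n)"
    proof (intro allI)
      fix n j
      have "(\<lambda>k. \<bar>w (N n + j) x - w k x\<bar>) \<longlonglongrightarrow> \<bar>w (N n + j) x - v x\<bar>"
        by (intro tendsto_intros lim)
      then show "\<bar>w (N n + j) x - v x\<bar> \<le> 1 / real (Suc n)"
        by (rule LIMSEQ_le_const2) (intro exI[of _ "N n"] allI impI le, auto)
    qed
  qed
  show ?thesis
  proof (rule that[OF vm])
    fix e :: real assume "e > 0"
    then obtain n where n: "1 / real (Suc n) < e" using nat_approx_posE by metis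
    have "AE x in M. \<bar>w j x - v x\<bar> \<le> e" if "j \<ge> N n" for j
      using bnd
    proof (rule eventually_mono)
      fix x assume "\<forall>n j. \<bar>w (N n + j) x - v x\<bar> \<le> 1 / real (Suc n)"
      from this[rule_format, of n "j - N n"] that n show "\<bar>w j x - v x\<bar> \<le> e" by simp
    qed
    then show "\<exists>N. \<forall>j\<ge>N. AE x in M. \<bar>w j x - v x\<bar> \<le> e" by blast
  qed
qed

text \<open>
  Modular smallness of the halved differences makes the sequence Cauchy in \<open>L\<^sup>1\<close>, and such sequences
  have subsequences that converge almost everywhere.
\<close>

lemma modular_Cauchy_imp_AE_subseq:
  fixes G :: "nat \<Rightarrow> 'a \<Rightarrow> 'b::euclidean_space"
  assumes G: "\<And>j. integrable M (G j)"
    and Cau: "\<And>d. d > 0 \<Longrightarrow> \<exists>N. \<forall>j\<ge>N. \<forall>k\<ge>N. modular (\<lambda>x. (1/2) *\<^sub>R (G j x - G k x)) \<le> ennreal d"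
  obtains r g where "strict_mono r" "g \<in> borel_measurable M" "AE x in M. (\<lambda>i. G (r i) x) \<longlonglongrightarrow> g x"
proof -
  note [measurable] = borel_measurable_integrable[OF G]
  have "\<exists>N. \<forall>i\<ge>N. \<forall>j\<ge>N. (LINT x|M. norm (G i x - G j x)) < e" if e: "e > 0" for e
  proof -
    have "e / 4 > 0" using e by simp
    then obtain d where d: "d > 0" "\<And>f :: 'a \<Rightarrow> 'b. f \<in> borel_measurable M \<Longrightarrow> modular f \<le> ennreal d \<Longrightarrow> 
       (\<integral>\<^sup>+x. ennreal (norm (f x)) \<partial>M) \<le> ennreal (e / 4)"
      using modular_small_imp_L1_small by blast
    obtain N where N: "\<forall>j\<ge>N. \<forall>k\<ge>N. modular (\<lambda>x. (1/2) *\<^sub>R (G j x - G k x)) \<le> ennreal d"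
      using Cau[OF d(1)] by blast
    have "(LINT x|M. norm (G i x - G j x)) < e" if "i \<ge> N" "j \<ge> N" for i j
    proof -
      have int: "integrable M (\<lambda>x. norm ((1/2) *\<^sub>R (G i x - G j x)))" using G by (intro integrable_norm) auto
      have "ennreal (LINT x|M. norm ((1/2) *\<^sub>R (G i x - G j x))) = (\<integral>\<^sup>+x. ennreal (norm ((1/2) *\<^sub>R (G i x - G j x))) \<partial>M)"
        using int by (intro nn_integral_eq_integral[symmetric]) auto
      also have "\<dots> \<le> ennreal (e / 4)" using N that by (intro d(2)) auto
      finally have "(LINT x|M. norm ((1/2) *\<^sub>R (G i x - G j x))) \<le> e / 4"
        using e by (simp add: ennreal_le_iff)
      then show ?thesis using e by simp
    qed
    then show ?thesis by blast
  qed
  from cauchy_L1_AE_cauchy_subseq[OF G this] obtain r where r: "strict_mono r" "AE x in M. Cauchy (\<lambda>i. G (r i) x)"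
    by blast
  show ?thesis
  proof (rule that[OF r(1)])
    show "(\<lambda>x. lim (\<lambda>i. G (r i) x)) \<in> borel_measurable M" by measurable
    show "AE x in M. (\<lambda>i. G (r i) x) \<longlonglongrightarrow> lim (\<lambda>i. G (r i) x)"
      using r(2) by (auto elim!: eventually_mono simp: Cauchy_convergent_iff convergent_LIMSEQ_iff)
  qed
qed

text \<open>
  The supremum bound makes \<open>v\<close> uniformly convergent to some \<open>u\<close>, the modular makes the gradients
  converge to some \<open>g\<close> along a subsequence, and \<open>L\<^sup>1\<close> convergence of both identifies \<open>g\<close> as the weak
  gradient of \<open>u\<close>. Only \<open>(v j - u) / 2\<close> tends to 0 in \<open>rho1\<close>, so the closedness of \<open>V0\<close>
  yields \<open>u / 2\<close>, and \<open>u\<close> is the sum of two such functions.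
\<close>

lemma V0_complete:
  assumes v: "\<And>j::nat. v j \<in> V0 \<Omega> p"
    and Cau: "\<And>d. d > 0 \<Longrightarrow> \<exists>N. \<forall>j\<ge>N. \<forall>k\<ge>N. modular (\<lambda>x. (1/2) *\<^sub>R (wg (v j) x - wg (v k) x)) \<le> ennreal d"
  obtains u r where "u \<in> V0 \<Omega> p" "strict_mono r" "AE x in M. (\<lambda>i. wg (v (r i)) x) \<longlonglongrightarrow> wg u x"
proof -
  note vS = V0_sobolev[OF v]
  note [measurable] = sobolevD(2,3)[OF vS]
  obtain r g where r: "strict_mono r" and [measurable]: "g \<in> borel_measurable M" 
    and lim: "AE x in M. (\<lambda>i. wg (v (r i)) x) \<longlonglongrightarrow> g x"
    using modular_Cauchy_imp_AE_subseq[of "\<lambda>j. wg (v j)", OF sobolev_wg_integrable[OF vS] Cau] by blast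
  have rge: "r i \<ge> i" for i using r by (rule seq_suble)
  have Gg: "\<exists>N. \<forall>j\<ge>N. modular (\<lambda>x. (1/2) *\<^sub>R (wg (v j) x - g x)) \<le> ennreal d" if "d > 0" for d
  proof -
    obtain N where N: "\<forall>j\<ge>N. \<forall>k\<ge>N. modular (\<lambda>x. (1/2) *\<^sub>R (wg (v j) x - wg (v k) x)) \<le> ennreal d"
      using Cau[OF \<open>d > 0\<close>] by blast
    have "modular (\<lambda>x. (1/2) *\<^sub>R (wg (v j) x - g x)) \<le> ennreal d" if "j \<ge> N" for j
    proof (rule modular_Fatou[where f = "\<lambda>k x. (1/2) *\<^sub>R (wg (v j) x - wg (v (r k)) x)"])
      show "AE x in M. (\<lambda>k. (1/2) *\<^sub>R (wg (v j) x - wg (v (r k)) x)) \<longlonglongrightarrow> (1/2) *\<^sub>R (wg (v j) x - g x)"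
        using lim by eventually_elim (intro tendsto_intros)
      show "\<forall>\<^sub>F k in sequentially. modular (\<lambda>x. (1/2) *\<^sub>R (wg (v j) x - wg (v (r k)) x)) \<le> ennreal d"
        using eventually_ge_at_top[of N]
      proof eventually_elim
        case (elim k)
        then show ?case using N that rge[of k] by simp
      qed
    qed measurable
    then show ?thesis by blast
  qed
  have "\<exists>N. \<forall>j\<ge>N. \<forall>k\<ge>N. AE x in M. \<bar>v j x - v k x\<bar> \<le> e" if "e > 0" for e
  proof -
    obtain d where d: "d > 0" 
      "\<And>v. v \<in> V0 \<Omega> p \<Longrightarrow> modular (\<lambda>x. (1/2) *\<^sub>R wg v x) \<le> ennreal d \<Longrightarrow> AE x in M. \<bar>v x\<bar> \<le> e"
      using V0_sup_bound[OF \<open>e > 0\<close>] by blast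
    obtain N where N: "\<forall>j\<ge>N. \<forall>k\<ge>N. modular (\<lambda>x. (1/2) *\<^sub>R (wg (v j) x - wg (v k) x)) \<le> ennreal d"
      using Cau[OF d(1)] by blast
    have "AE x in M. \<bar>v j x - v k x\<bar> \<le> e" if "j \<ge> N" "k \<ge> N" for j k
    proof (rule d(2)[OF V0_diff[OF v v]])
      have "modular (\<lambda>x. (1/2) *\<^sub>R wg (\<lambda>x. v j x - v k x) x) = modular (\<lambda>x. (1/2) *\<^sub>R (wg (v j) x - wg (v k) x))"
        using wg_AE_eq[OF has_weak_gradient_diff[OF sobolevD(1)[OF vS] sobolevD(1)[OF vS]], of j k]
        by (intro modular_cong_AE) (auto elim!: eventually_mono)
      then show "modular (\<lambda>x. (1/2) *\<^sub>R wg (\<lambda>x. v j x - v k x) x) \<le> ennreal d" using N that by simp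
    qed
    then show ?thesis by blast
  qed
  then obtain u where [measurable]: "u \<in> borel_measurable M" 
    and vu: "\<And>e. e > 0 \<Longrightarrow> \<exists>N. \<forall>j\<ge>N. AE x in M. \<bar>v j x - u x\<bar> \<le> e"
    using AE_Cauchy_uniform_limit[of v, OF sobolevD(2)[OF vS]] by blast
  define m where "m = measure M \<Omega>"
  have m: "m \<ge> 0" by (simp add: m_def)
  have wu: "has_weak_gradient \<Omega> u g"
  proof (rule has_weak_gradient_L1_limit[of v "\<lambda>j. wg (v j)"])
    fix e :: real assume e: "e > 0"
    have "e / (m + 1) > 0" using e m by simp
    then obtain N1 where N1: "\<forall>j\<ge>N1. AE x in M. \<bar>v j x - u x\<bar> \<le> e / (m + 1)"
      using vu by blast
    have "e / 2 > 0" using e by simp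
    then obtain d where d: "d > 0" "\<And>f :: 'a \<Rightarrow> 'a. f \<in> borel_measurable M \<Longrightarrow> modular f \<le> ennreal d \<Longrightarrow> 
       (\<integral>\<^sup>+x. ennreal (norm (f x)) \<partial>M) \<le> ennreal (e / 2)"
      using modular_small_imp_L1_small by blast
    obtain N2 where N2: "\<forall>j\<ge>N2. modular (\<lambda>x. (1/2) *\<^sub>R (wg (v j) x - g x)) \<le> ennreal d"
      using Gg[OF d(1)] by blast
    define j where "j = max N1 N2"
    have "AE x in M. \<bar>v j x - u x\<bar> \<le> e / (m + 1)" using N1 by (simp add: j_def)
    then have "(\<integral>\<^sup>+x. ennreal \<bar>v j x - u x\<bar> \<partial>M) \<le> (\<integral>\<^sup>+x. ennreal (e / (m + 1)) \<partial>M)"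
      by (intro nn_integral_mono_AE) (auto elim!: eventually_mono intro: ennreal_leI)
    also have "\<dots> = ennreal (e / (m + 1) * m)"
      using e m by (subst ennreal_mult) (auto simp: emeasure_eq_measure m_def)
    also have "\<dots> \<le> ennreal e"
      using e m by (intro ennreal_leI) (simp add: field_simps)
    finally have 1: "(\<integral>\<^sup>+x. ennreal \<bar>v j x - u x\<bar> \<partial>M) \<le> ennreal e" .
    have "(\<integral>\<^sup>+x. ennreal (norm (wg (v j) x - g x)) \<partial>M) = (\<integral>\<^sup>+x. 2 * ennreal (norm ((1/2) *\<^sub>R (wg (v j) x - g x))) \<partial>M)"
      by (intro nn_integral_cong) (simp add: ennreal_mult'[symmetric] flip: ennreal_numeral)
    also have "\<dots> = 2 * (\<integral>\<^sup>+x. ennreal (norm ((1/2) *\<^sub>R (wg (v j) x - g x))) \<partial>M)"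
      by (rule nn_integral_cmult) measurable
    also have "\<dots> \<le> 2 * ennreal (e / 2)"
    proof (intro mult_left_mono d(2))
      show "modular (\<lambda>x. (1/2) *\<^sub>R (wg (v j) x - g x)) \<le> ennreal d" using N2 by (simp add: j_def)
      show "(\<lambda>x. (1/2) *\<^sub>R (wg (v j) x - g x)) \<in> borel_measurable M" by measurable
    qed simp
    also have "\<dots> = ennreal e" using e by (simp add: ennreal_mult'[symmetric] flip: ennreal_numeral)
    finally show "\<exists>j. (\<integral>\<^sup>+x. ennreal \<bar>v j x - u x\<bar> \<partial>M) \<le> ennreal e \<and> (\<integral>\<^sup>+x. ennreal (norm (wg (v j) x - g x)) \<partial>M) \<le> ennreal e"
      using 1 by blast
  qed (use sobolevD(1)[OF vS] in \<open>auto\<close>)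
  have wdiff: "has_weak_gradient \<Omega> (\<lambda>x. (1/2) * (v j x - u x)) (\<lambda>x. (1/2) *\<^sub>R (wg (v j) x - g x))" for j
    by (rule has_weak_gradient_scale[OF has_weak_gradient_diff[OF sobolevD(1)[OF vS] wu]])
  \<comment> \<open>Uniform smallness below 1 gives modular smallness for all exponents at once.\<close>
  have conv: "\<exists>N. \<forall>j\<ge>N. rho1 \<Omega> p (\<lambda>x. (1/2) * (v j x - u x)) \<le> ennreal e" if e: "e > 0" for e
  proof -
    define s where "s = min 1 (e / (2 * (m + 1)))"
    have s: "0 < s" "s \<le> 1" using e m by (auto simp: s_def)
    have sm: "s * m \<le> e / 2"
    proof -
      have "s * m \<le> e / (2 * (m + 1)) * (m + 1)" using e m by (intro mult_mono) (auto simp: s_def)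
      also have "\<dots> = e / 2" using m by (simp add: field_simps)
      finally show ?thesis .
    qed
    obtain N1 where N1: "\<forall>j\<ge>N1. AE x in M. \<bar>v j x - u x\<bar> \<le> s" using vu[OF s(1)] by blast
    have "e / 2 > 0" using e by simp
    then obtain N2 where N2: "\<forall>j\<ge>N2. modular (\<lambda>x. (1/2) *\<^sub>R (wg (v j) x - g x)) \<le> ennreal (e / 2)"
      using Gg by blast
    have "rho1 \<Omega> p (\<lambda>x. (1/2) * (v j x - u x)) \<le> ennreal e" if "j \<ge> max N1 N2" for j
    proof -
      have "AE x in M. norm ((1/2) * (v j x - u x)) \<le> s"
        using N1[rule_format, of j] that s by (auto elim!: eventually_mono simp: abs_mult)
      then have "modular (\<lambda>x. (1/2) * (v j x - u x)) \<le> ennreal (s * m)"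
        unfolding m_def using s by (intro modular_le_of_AE_bound) auto
      also have "\<dots> \<le> ennreal (e / 2)" using sm by (rule ennreal_leI)
      finally have "rho1 \<Omega> p (\<lambda>x. (1/2) * (v j x - u x)) \<le> ennreal (e / 2) + ennreal (e / 2)"
        unfolding rho1_eq[OF wdiff] using N2 that by (intro add_mono) auto
      then show ?thesis using e by (simp add: ennreal_plus[symmetric] del: ennreal_plus)
    qed
    then show ?thesis by blast
  qed
  \<comment> \<open>One halved difference of finite modular suffices, as \<open>u = v N - 2 ((v N - u) / 2)\<close>.\<close>
  have uS: "u \<in> sobolev \<Omega> p"
  proof -
    obtain N where N: "\<forall>j\<ge>N. rho1 \<Omega> p (\<lambda>x. (1/2) * (v j x - u x)) \<le> ennreal 1" using conv[of 1] by auto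
    then have "rho1 \<Omega> p (\<lambda>x. (1/2) * (v N x - u x)) < \<infinity>" by (auto intro: le_less_trans)
    then have fin: "modular (\<lambda>x. (1/2) * (v N x - u x)) < \<infinity>" "modular (\<lambda>x. (1/2) *\<^sub>R (wg (v N) x - g x)) < \<infinity>"
      unfolding rho1_eq[OF wdiff] by auto
    have "(\<lambda>x. (1/2) * (v N x - u x)) \<in> sobolev \<Omega> p"
      by (rule sobolevI[OF wdiff, of 1]) (use fin in simp_all)
    then have "(\<lambda>x. v N x - 2 * ((1/2) * (v N x - u x))) \<in> sobolev \<Omega> p"
      by (rule sobolev_diff[OF vS sobolev_scale])
    moreover have "(\<lambda>x. v N x - 2 * ((1/2) * (v N x - u x))) = u" by (auto simp: fun_eq_iff field_simps)
    ultimately show ?thesis by simp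
  qed
  have "(\<lambda>x. (1/2) * u x) \<in> V0 \<Omega> p"
  proof (rule V0_limit[where v = "\<lambda>j x. (1/2) * v j x"])
    show "(\<lambda>x. (1/2) * v j x) \<in> V0 \<Omega> p" for j by (intro V0_scale_le_1 v) simp
    show "(\<lambda>x. (1/2) * u x) \<in> sobolev \<Omega> p" by (intro sobolev_scale uS)
    have "(\<lambda>j. rho1 \<Omega> p (\<lambda>x. (1/2) * (v j x - u x))) \<longlonglongrightarrow> 0"
    proof (rule order_tendstoI)
      fix a :: ennreal assume "0 < a"
      obtain e where e: "e > 0" "ennreal e < a"
      proof (cases a)
        case (real b)
        with \<open>0 < a\<close> show ?thesis by (intro that[of "b / 2"]) (auto simp: ennreal_less_iff)
      next
        case top
        then show ?thesis by (intro that[of 1]) auto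
      qed
      show "\<forall>\<^sub>F j in sequentially. rho1 \<Omega> p (\<lambda>x. (1/2) * (v j x - u x)) < a"
        using conv[OF e(1)] e(2) by (auto simp: eventually_sequentially intro: le_less_trans)
    qed simp
    then show "(\<lambda>j. rho1 \<Omega> p (\<lambda>x. (1/2) * v j x - (1/2) * u x)) \<longlonglongrightarrow> 0"
      by (simp add: right_diff_distrib)
  qed
  \<comment> \<open>The sum of the half with itself recovers \<open>u\<close>.\<close>
  from V0_add[OF this this] have uV: "u \<in> V0 \<Omega> p" by simp
  have "AE x in M. (\<lambda>i. wg (v (r i)) x) \<longlonglongrightarrow> wg u x"
    using lim wg_AE_eq[OF wu] by eventually_elim simp
  with uV r show ?thesis by (rule that)
qed

section \<open>Existence of a minimiser\<close>

text \<open>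
  The negative term of the pointwise inequality is moved to the left, because subtraction of extended
  nonnegative reals is truncated.
\<close>

lemma modular_uniform_convexity:
  assumes e: "0 < e" "e < 1"
  obtains C where "C > 0" 
    "\<And>f g :: 'a \<Rightarrow> 'b::euclidean_space. f \<in> borel_measurable M \<Longrightarrow> g \<in> borel_measurable M \<Longrightarrow>
       modular (\<lambda>x. (1/2) *\<^sub>R (f x - g x)) + ennreal C * modular (\<lambda>x. (1/2) *\<^sub>R (f x + g x))
        \<le> ennreal (e + C / 2) * (modular f + modular g)"
proof -
  obtain C where C: "C > 0" "\<And>p a (b::'b). q \<le> p \<Longrightarrow> 
    norm ((1/2) *\<^sub>R (a - b)) powr p \<le> e * (norm a powr p + norm b powr p)
       + C * ((norm a powr p + norm b powr p) / 2 - norm ((1/2) *\<^sub>R (a + b)) powr p)"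
    using norm_powr_uniform_convexity[OF q_gt_1 e] by metis
  show ?thesis
  proof (rule that[OF C(1)])
    fix f g :: "'a \<Rightarrow> 'b" assume [measurable]: "f \<in> borel_measurable M" "g \<in> borel_measurable M"
    have "modular (\<lambda>x. (1/2) *\<^sub>R (f x - g x)) + ennreal C * modular (\<lambda>x. (1/2) *\<^sub>R (f x + g x)) =
      (\<integral>\<^sup>+x. ennreal (norm ((1/2) *\<^sub>R (f x - g x)) powr p x / p x) 
          + ennreal C * ennreal (norm ((1/2) *\<^sub>R (f x + g x)) powr p x / p x) \<partial>M)"
      unfolding modular_def by (subst nn_integral_add) (measurable, simp add: nn_integral_cmult)
    also have "\<dots> \<le> (\<integral>\<^sup>+x. ennreal (e + C / 2) * (ennreal (norm (f x) powr p x / p x) + ennreal (norm (g x) powr p x / p x)) \<partial>M)"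
    proof (rule nn_integral_mono)
      fix x assume "x \<in> space M"
      then have x: "q \<le> p x" "p x > 0" using p_ge p_pos by auto
      define d n A B where "d = norm ((1/2) *\<^sub>R (f x - g x)) powr p x" and "n = norm ((1/2) *\<^sub>R (f x + g x)) powr p x"
        and "A = norm (f x) powr p x" and "B = norm (g x) powr p x"
      have nn: "0 \<le> d" "0 \<le> n" "0 \<le> A" "0 \<le> B" by (auto simp: d_def n_def A_def B_def)
      have "d \<le> e * (A + B) + C * ((A + B) / 2 - n)"
        unfolding d_def n_def A_def B_def by (rule C(2)[OF x(1)])
      then have "d + C * n \<le> (e + C / 2) * (A + B)" by (simp add: algebra_simps)
      then have "(d + C * n) / p x \<le> (e + C / 2) * (A + B) / p x"
        using x by (intro divide_right_mono) auto
      then have "d / p x + C * (n / p x) \<le> (e + C / 2) * (A / p x + B / p x)"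
        by (simp add: add_divide_distrib distrib_left)
      then have "ennreal (d / p x + C * (n / p x)) \<le> ennreal ((e + C / 2) * (A / p x + B / p x))"
        by (rule ennreal_leI)
      moreover have "ennreal (d / p x + C * (n / p x)) = ennreal (d / p x) + ennreal C * ennreal (n / p x)"
        using nn x C by (subst ennreal_plus) (auto simp: ennreal_mult simp del: times_divide_eq_right)
      moreover have "ennreal ((e + C / 2) * (A / p x + B / p x)) = ennreal (e + C / 2) * (ennreal (A / p x) + ennreal (B / p x))"
        using nn x C e by (subst ennreal_mult) auto
      ultimately show "ennreal (norm ((1/2) *\<^sub>R (f x - g x)) powr p x / p x) 
          + ennreal C * ennreal (norm ((1/2) *\<^sub>R (f x + g x)) powr p x / p x)
          \<le> ennreal (e + C / 2) * (ennreal (norm (f x) powr p x / p x) + ennreal (norm (g x) powr p x / p x))"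
        by (simp only: d_def n_def A_def B_def)
    qed
    also have "\<dots> = ennreal (e + C / 2) * (modular f + modular g)"
      unfolding modular_def by (subst nn_integral_cmult) (measurable, simp add: nn_integral_add)
    finally show "modular (\<lambda>x. (1/2) *\<^sub>R (f x - g x)) + ennreal C * modular (\<lambda>x. (1/2) *\<^sub>R (f x + g x))
        \<le> ennreal (e + C / 2) * (modular f + modular g)" .
  qed
qed

text \<open>
  Midpoints have modular at least \<open>m\<close>, so the gain in uniform convexity is at most of the order of the
  excess \<open>t\<close> over \<open>m\<close>. The remaining term \<open>e * (2 * (m + t))\<close> is made small by the choice of \<open>e\<close>,
  before \<open>C\<close>, which depends on \<open>e\<close>, determines \<open>t\<close>.
\<close>

lemma minimising_sequence_Cauchy:
  fixes f :: "nat \<Rightarrow> 'a \<Rightarrow> 'b::euclidean_space"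
  assumes f [measurable]: "\<And>j. f j \<in> borel_measurable M" and m: "m \<ge> 0"
    and le: "\<And>t. t > 0 \<Longrightarrow> \<exists>N. \<forall>j\<ge>N. modular (f j) \<le> ennreal (m + t)"
    and mid: "\<And>j k. ennreal m \<le> modular (\<lambda>x. (1/2) *\<^sub>R (f j x + f k x))"
    and d: "d > 0"
  shows "\<exists>N. \<forall>j\<ge>N. \<forall>k\<ge>N. modular (\<lambda>x. (1/2) *\<^sub>R (f j x - f k x)) \<le> ennreal d"
proof -
  define e where "e = min (1/2) (d / (4 * (m + 1)))"
  have e: "0 < e" "e < 1" "e * (2 * (m + 1)) \<le> d / 2"
  proof -
    show "0 < e" "e < 1" using d m by (auto simp: e_def)
    have "e * (2 * (m + 1)) \<le> d / (4 * (m + 1)) * (2 * (m + 1))"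
      using m by (intro mult_right_mono) (auto simp: e_def)
    also have "\<dots> = d / 2" using m by (simp add: field_simps)
    finally show "e * (2 * (m + 1)) \<le> d / 2" .
  qed
  obtain C where C: "C > 0" 
    "\<And>f g :: 'a \<Rightarrow> 'b. f \<in> borel_measurable M \<Longrightarrow> g \<in> borel_measurable M \<Longrightarrow>
       modular (\<lambda>x. (1/2) *\<^sub>R (f x - g x)) + ennreal C * modular (\<lambda>x. (1/2) *\<^sub>R (f x + g x))
        \<le> ennreal (e + C / 2) * (modular f + modular g)"
    using modular_uniform_convexity[OF e(1,2)] by blast
  define t where "t = min 1 (d / (2 * C))"
  have t: "0 < t" "t \<le> 1" "C * t \<le> d / 2"
  proof -
    show "0 < t" "t \<le> 1" using d C by (auto simp: t_def)
    have "C * t \<le> C * (d / (2 * C))" using C by (intro mult_left_mono) (auto simp: t_def)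
    then show "C * t \<le> d / 2" using C by simp
  qed
  obtain N where N: "\<forall>j\<ge>N. modular (f j) \<le> ennreal (m + t)" using le[OF t(1)] by blast
  have "modular (\<lambda>x. (1/2) *\<^sub>R (f j x - f k x)) \<le> ennreal d" if jk: "j \<ge> N" "k \<ge> N" for j k
  proof -
    define X where "X = modular (\<lambda>x. (1/2) *\<^sub>R (f j x - f k x))"
    have "X + ennreal (C * m) \<le> X + ennreal C * modular (\<lambda>x. (1/2) *\<^sub>R (f j x + f k x))"
      using C m mid by (intro add_left_mono) (simp add: ennreal_mult mult_left_mono)
    also have "\<dots> \<le> ennreal (e + C / 2) * (modular (f j) + modular (f k))"
      unfolding X_def by (intro C(2)) measurable
    also have "\<dots> \<le> ennreal (e + C / 2) * (ennreal (m + t) + ennreal (m + t))"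
      using N jk by (intro mult_left_mono add_mono) auto
    also have "\<dots> = ennreal ((e + C / 2) * (2 * (m + t)))"
      using e C m t by (simp add: ennreal_mult[symmetric] ennreal_plus[symmetric] del: ennreal_plus)
    finally have X: "X + ennreal (C * m) \<le> ennreal ((e + C / 2) * (2 * (m + t)))" .
    then have "X < top" by (auto simp: less_top[symmetric] top_unique)
    then obtain x where x: "X = ennreal x" "x \<ge> 0" by (cases X) auto
    have "x + C * m \<le> (e + C / 2) * (2 * (m + t))"
      using X x C m e t by (simp add: ennreal_plus[symmetric] ennreal_le_iff del: ennreal_plus)
    also have "\<dots> = e * (2 * (m + t)) + C * m + C * t" by (simp add: algebra_simps)
    also have "e * (2 * (m + t)) \<le> e * (2 * (m + 1))" using e t by (intro mult_left_mono) auto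
    finally have "x \<le> d" using e t by linarith
    then show ?thesis using x by (simp add: X_def ennreal_leI)
  qed
  then show ?thesis by blast
qed

lemma zero_V0: "(\<lambda>x. 0) \<in> V0 \<Omega> p"
  using test_functions_subset_V0 by (auto simp: test_functions_def C_k_on_const)

text \<open>
  The midpoint of two admissible gradients is the gradient of \<open>\<phi>\<close> plus the midpoint in \<open>V0\<close>, so a
  minimising sequence satisfies the hypotheses of \<open>minimising_sequence_Cauchy\<close>.
\<close>

lemma minimiser_exists:
  assumes \<phi>: "\<phi> \<in> sobolev \<Omega> p" and fin: "modular (wg \<phi>) < \<infinity>"
  obtains v where "v \<in> V0 \<Omega> p" "modular (\<lambda>x. wg \<phi> x + wg v x) < \<infinity>"
    "\<And>w. w \<in> V0 \<Omega> p \<Longrightarrow> modular (\<lambda>x. wg \<phi> x + wg v x) \<le> modular (\<lambda>x. wg \<phi> x + wg w x)"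
proof -
  define F where "F w = modular (\<lambda>x. wg \<phi> x + wg w x)" for w
  define I where "I = (INF w\<in>V0 \<Omega> p. F w)"
  have IF: "I \<le> F w" if "w \<in> V0 \<Omega> p" for w unfolding I_def using that by (rule INF_lower)
  note [measurable] = sobolevD(3)[OF \<phi>]
  have "F (\<lambda>x. 0) = modular (wg \<phi>)"
  proof -
    have "has_weak_gradient \<Omega> (\<lambda>x. 0 * \<phi> x) (\<lambda>x. 0 *\<^sub>R wg \<phi> x)"
      by (rule has_weak_gradient_scale[OF sobolevD(1)[OF \<phi>]])
    from wg_AE_eq[OF this] show ?thesis unfolding F_def
      by (intro modular_cong_AE) (auto elim!: eventually_mono)
  qed
  with IF[OF zero_V0] fin have "I < \<infinity>" by (simp add: le_less_trans)
  then obtain m where m: "I = ennreal m" "m \<ge> 0" by (cases I) auto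
  have "\<exists>v. v \<in> V0 \<Omega> p \<and> F v < ennreal (m + 1 / real (Suc j))" for j
  proof -
    have "I < ennreal (m + 1 / real (Suc j))" using m by (simp add: ennreal_less_iff)
    then show ?thesis unfolding I_def by (simp add: INF_less_iff Bex_def)
  qed
  then have "\<exists>v. \<forall>j. v j \<in> V0 \<Omega> p \<and> F (v j) < ennreal (m + 1 / real (Suc j))"
    by (intro choice allI)
  then obtain v where v: "\<And>j. v j \<in> V0 \<Omega> p" "\<And>j. F (v j) < ennreal (m + 1 / real (Suc j))" by blast
  note vS = V0_sobolev[OF v(1)]
  note [measurable] = sobolevD(3)[OF vS]
  have le: "\<exists>N. \<forall>j\<ge>N. F (v j) \<le> ennreal (m + t)" if "t > 0" for t :: real
  proof -
    obtain N where N: "1 / real (Suc N) < t" using nat_approx_posE[OF \<open>t > 0\<close>] by metis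
    have "F (v j) \<le> ennreal (m + t)" if "j \<ge> N" for j
    proof -
      have "1 / real (Suc j) \<le> 1 / real (Suc N)" using that by (intro divide_left_mono) auto
      then have "m + 1 / real (Suc j) \<le> m + t" using N by linarith
      then show ?thesis by (rule order_trans[OF less_imp_le[OF v(2)] ennreal_leI])
    qed
    then show ?thesis by blast
  qed
  have "\<exists>N. \<forall>j\<ge>N. \<forall>k\<ge>N. modular (\<lambda>x. (1/2) *\<^sub>R ((wg \<phi> x + wg (v j) x) - (wg \<phi> x + wg (v k) x))) \<le> ennreal d" 
    if "d > 0" for d
  proof (rule minimising_sequence_Cauchy[OF _ m(2) _ _ that])
    show "(\<lambda>x. wg \<phi> x + wg (v j) x) \<in> borel_measurable M" for j by measurable
    show "\<exists>N. \<forall>j\<ge>N. modular (\<lambda>x. wg \<phi> x + wg (v j) x) \<le> ennreal (m + t)" if "t > 0" for t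
      using le[OF that] unfolding F_def .
    fix j k
    define w where "w x = (1/2) * (v j x + v k x)" for x
    have w: "w \<in> V0 \<Omega> p" unfolding w_def by (rule V0_scale_le_1[OF V0_add[OF v(1) v(1)]]) simp
    have wg: "has_weak_gradient \<Omega> w (\<lambda>x. (1/2) *\<^sub>R (wg (v j) x + wg (v k) x))"
      unfolding w_def by (rule has_weak_gradient_scale[OF has_weak_gradient_add[OF sobolevD(1)[OF vS] sobolevD(1)[OF vS]]])
    have "modular (\<lambda>x. (1/2) *\<^sub>R (wg \<phi> x + wg (v j) x + (wg \<phi> x + wg (v k) x))) = F w"
      unfolding F_def
    proof (rule modular_cong_AE)
      show "AE x in M. (1/2) *\<^sub>R (wg \<phi> x + wg (v j) x + (wg \<phi> x + wg (v k) x)) = wg \<phi> x + wg w x"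
        using wg_AE_eq[OF wg]
      proof eventually_elim
        case (elim x)
        have "(1/2) *\<^sub>R (wg \<phi> x + wg \<phi> x) = wg \<phi> x" by (simp flip: scaleR_2)
        then show ?case unfolding elim by (simp add: algebra_simps)
      qed
    qed
    with IF[OF w] m show "ennreal m \<le> modular (\<lambda>x. (1/2) *\<^sub>R (wg \<phi> x + wg (v j) x + (wg \<phi> x + wg (v k) x)))"
      by simp
  qed
  then have Cau: "\<exists>N. \<forall>j\<ge>N. \<forall>k\<ge>N. modular (\<lambda>x. (1/2) *\<^sub>R (wg (v j) x - wg (v k) x)) \<le> ennreal d" if "d > 0" for d
    using that by simp
  obtain u r where u: "u \<in> V0 \<Omega> p" "strict_mono r" "AE x in M. (\<lambda>i. wg (v (r i)) x) \<longlonglongrightarrow> wg u x"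
    using V0_complete[OF v(1) Cau] by blast
  note [measurable] = sobolevD(3)[OF V0_sobolev[OF u(1)]]
  have "F u \<le> I + ennreal t" if "t > 0" for t
    unfolding F_def
  proof (rule modular_Fatou[where f = "\<lambda>k x. wg \<phi> x + wg (v (r k)) x"])
    show "AE x in M. (\<lambda>k. wg \<phi> x + wg (v (r k)) x) \<longlonglongrightarrow> wg \<phi> x + wg u x"
      using u(3) by eventually_elim (intro tendsto_intros)
    obtain N where N: "\<forall>j\<ge>N. F (v j) \<le> ennreal (m + t)" using le[OF \<open>t > 0\<close>] by blast
    show "\<forall>\<^sub>F k in sequentially. modular (\<lambda>x. wg \<phi> x + wg (v (r k)) x) \<le> I + ennreal t"
      using eventually_ge_at_top[of N]
    proof eventually_elim
      case (elim k)
      have "r k \<ge> N" using seq_suble[OF u(2), of k] elim by simp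
      then have "F (v (r k)) \<le> ennreal (m + t)" using N by blast
      then show ?case using m that by (simp add: F_def)
    qed
  qed measurable
  then have FI: "F u \<le> I" by (rule ennreal_le_epsilon)
  show ?thesis
  proof (rule that[OF u(1)])
    show "modular (\<lambda>x. wg \<phi> x + wg u x) < \<infinity>" using FI \<open>I < \<infinity>\<close> by (simp add: F_def)
    show "modular (\<lambda>x. wg \<phi> x + wg u x) \<le> modular (\<lambda>x. wg \<phi> x + wg w x)" if "w \<in> V0 \<Omega> p" for w
      using order_trans[OF FI IF[OF that]] by (simp add: F_def)
  qed
qed

section \<open>The Euler-Lagrange equation\<close>

text \<open>
  Dominates the integrands of the first variation, uniformly in \<open>t\<close>. The bound \<open>P\<close> on the exponent
  is restricted to the set where \<open>g\<close> is nonzero: for the gradient of a test function that set has compact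
  closure in the domain, while \<open>p\<close> may be unbounded elsewhere.
\<close>

lemma flux_bound:
  fixes a g :: "'a \<Rightarrow> 'b::euclidean_space"
  assumes x: "x \<in> \<Omega>" and B: "1 \<le> B" "norm (g x) \<le> B" and t: "0 \<le> t" "t \<le> 1"
    and P: "g x \<noteq> 0 \<Longrightarrow> p x \<le> P" "0 \<le> P"
  shows "\<bar>norm (a x + t *\<^sub>R g x) powr (p x - 2) * ((a x + t *\<^sub>R g x) \<bullet> g x)\<bar>
     \<le> B * (1 + 2 powr P * (P * (norm (a x) powr p x / p x) + B powr P))"
proof (cases "g x = 0")
  case True
  then show ?thesis using B P p_pos[OF x] by simp
next
  case False
  define s where "s = norm (a x + t *\<^sub>R g x)"
  define z where "z = norm (a x) powr p x / p x"
  have px: "p x > 1" "p x > 0" "p x \<le> P" using p_gt_1[OF x] P False by auto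
  have z: "z \<ge> 0" "norm (a x) powr p x = p x * z" using px by (auto simp: z_def)
  have s: "s \<ge> 0" by (simp add: s_def)
  have tg: "norm (t *\<^sub>R g x) powr p x \<le> B powr P"
  proof -
    have "norm (t *\<^sub>R g x) \<le> 1 * B" unfolding norm_scaleR using B t by (intro mult_mono) auto
    then have "norm (t *\<^sub>R g x) powr p x \<le> B powr p x" using px by (intro powr_mono2) auto
    also have "\<dots> \<le> B powr P" using px B by (intro powr_mono) auto
    finally show ?thesis .
  qed
  have "s powr (p x - 1) \<le> 1 + s powr p x"
  proof (cases "s \<le> 1")
    case True
    then have "s powr (p x - 1) \<le> 1" using s px by (intro powr_le1) auto
    then show ?thesis by (simp add: add_increasing2)
  next
    case False
    then have "s powr (p x - 1) \<le> s powr p x" by (intro powr_mono) auto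
    then show ?thesis by simp
  qed
  also have "s powr p x \<le> 2 powr p x * (norm (a x) powr p x + norm (t *\<^sub>R g x) powr p x)"
    unfolding s_def by (rule norm_add_powr_le[OF px(1)])
  also have "\<dots> \<le> 2 powr P * (P * z + B powr P)"
    using px z tg by (intro mult_mono add_mono powr_mono) (auto intro: mult_right_mono)
  finally have le: "s powr (p x - 1) \<le> 1 + 2 powr P * (P * z + B powr P)" by simp
  have "\<bar>s powr (p x - 2) * ((a x + t *\<^sub>R g x) \<bullet> g x)\<bar> \<le> s powr (p x - 2) * (s * B)"
    unfolding abs_mult using Cauchy_Schwarz_ineq2[of "a x + t *\<^sub>R g x" "g x"] B
    by (auto simp: s_def intro!: mult_left_mono elim!: order_trans)
  also have "\<dots> = B * s powr (p x - 1)"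
    using powr_two_scale(2)[OF s, of "p x"] by simp
  also have "\<dots> \<le> B * (1 + 2 powr P * (P * z + B powr P))"
    using le B by (intro mult_left_mono) auto
  finally show ?thesis by (simp add: s_def z_def)
qed

text \<open>
  By the tangent inequality at \<open>a + t \<nabla>h\<close>, the modular grows by at most \<open>t\<close> times the integral of
  \<open>\<psi> t\<close>. Minimality makes that integral nonnegative for \<open>t > 0\<close>, and dominated convergence carries
  this to \<open>t = 0\<close>. The modular itself never has to be differentiated.
\<close>

lemma first_variation:
  fixes a :: "'a \<Rightarrow> 'a"
  assumes a [measurable]: "a \<in> borel_measurable M" and fin: "modular a < \<infinity>" and h: "h \<in> test_functions \<Omega>"
    and min: "\<And>t. 0 < t \<Longrightarrow> t \<le> 1 \<Longrightarrow> modular a \<le> modular (\<lambda>x. a x + t *\<^sub>R gradient h x)"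
  shows "integrable M (\<lambda>x. norm (a x) powr (p x - 2) * (a x \<bullet> gradient h x))"
    and "0 \<le> (LINT x|M. norm (a x) powr (p x - 2) * (a x \<bullet> gradient h x))"
proof -
  note [measurable] = has_weak_gradient_measurable(2)[OF has_weak_gradient_test_function[OF h]]
  obtain B0 where B0: "B0 > 0" "\<And>x. norm (gradient h x) \<le> B0" "\<And>x. \<bar>h x\<bar> \<le> B0"
    using bounded_gradient[OF h] by blast
  define B where "B = max 1 B0"
  have B: "1 \<le> B" "\<And>x. norm (gradient h x) \<le> B" using B0(2) by (auto simp: B_def le_max_iff_disj)
  note K = test_functions_support[OF h]
  have "bounded (p ` closure {x. h x \<noteq> 0})"
    using compact_imp_bounded[OF compact_continuous_image[OF continuous_on_subset[OF continuous_p K(2)] K(1)]] .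
  then obtain P0 where P0: "\<forall>y\<in>p ` closure {x. h x \<noteq> 0}. norm y \<le> P0" unfolding bounded_iff by blast
  define P where "P = max 0 P0"
  have P: "p x \<le> P" if "gradient h x \<noteq> 0" for x
  proof -
    have "x \<in> closure {x. h x \<noteq> 0}" using that gradient_0_outside_support by blast
    then have "\<bar>p x\<bar> \<le> P0" using P0 by auto
    then show ?thesis by (simp add: P_def)
  qed
  define z where "z t x = norm (a x + t *\<^sub>R gradient h x) powr p x / p x" for t x
  define \<psi> where "\<psi> t x = norm (a x + t *\<^sub>R gradient h x) powr (p x - 2) * ((a x + t *\<^sub>R gradient h x) \<bullet> gradient h x)" for t x
  have [measurable]: "z t \<in> borel_measurable M" "\<psi> t \<in> borel_measurable M" for t
    unfolding z_def \<psi>_def by measurable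
  have modz: "modular (\<lambda>x. a x + t *\<^sub>R gradient h x) = (\<integral>\<^sup>+x. ennreal (z t x) \<partial>M)" for t
    by (simp add: modular_def z_def)
  have z0: "0 \<le> z t x" if "x \<in> \<Omega>" for t x using p_pos[OF that] by (simp add: z_def)
  have AE\<Omega>: "AE x in M. x \<in> \<Omega>" by (simp add: AE_M_iff)
  have iz0: "integrable M (z 0)"
  proof (rule integrableI_nonneg)
    show "(\<integral>\<^sup>+x. ennreal (z 0 x) \<partial>M) < \<infinity>" using fin modz[of 0] by simp
    show "AE x in M. 0 \<le> z 0 x" using AE\<Omega> by eventually_elim (rule z0)
  qed measurable
  define D where "D x = B * (1 + 2 powr P * (P * z 0 x + B powr P))" for x
  have iD: "integrable M D" unfolding D_def using iz0 by simp
  have \<psi>D: "AE x in M. norm (\<psi> t x) \<le> D x" if "0 \<le> t" "t \<le> 1" for t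
    using AE\<Omega>
  proof eventually_elim
    case (elim x)
    show ?case
      using flux_bound[where g = "gradient h" and a = a and P = P, OF elim B that P]
      by (simp add: \<psi>_def D_def z_def P_def)
  qed
  have i\<psi>: "integrable M (\<psi> t)" if "0 \<le> t" "t \<le> 1" for t
  proof (rule Bochner_Integration.integrable_bound[OF iD])
    show "AE x in M. norm (\<psi> t x) \<le> norm (D x)" using \<psi>D[OF that] by eventually_elim simp
  qed measurable
  have conv: "z t x \<le> z 0 x + t * \<psi> t x" if "x \<in> \<Omega>" for t x
    using norm_powr_tangent[OF p_gt_1[OF that], of "a x + t *\<^sub>R gradient h x" "a x"]
    by (simp add: z_def \<psi>_def mult_ac)
  have pos: "0 \<le> (LINT x|M. \<psi> t x)" if t: "0 < t" "t \<le> 1" for t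
  proof -
    have "AE x in M. ennreal (z t x) \<le> ennreal (z 0 x + t * \<psi> t x)"
      using AE\<Omega> by eventually_elim (intro ennreal_leI conv)
    then have "(\<integral>\<^sup>+x. ennreal (z t x) \<partial>M) \<le> (\<integral>\<^sup>+x. ennreal (z 0 x + t * \<psi> t x) \<partial>M)"
      by (rule nn_integral_mono_AE)
    also have "\<dots> = ennreal (LINT x|M. z 0 x + t * \<psi> t x)"
    proof (rule nn_integral_eq_integral)
      show "integrable M (\<lambda>x. z 0 x + t * \<psi> t x)" using iz0 i\<psi>[of t] t by simp
      show "AE x in M. 0 \<le> z 0 x + t * \<psi> t x"
        using AE\<Omega> by eventually_elim (rule order_trans[OF z0 conv])
    qed
    also have "(LINT x|M. z 0 x + t * \<psi> t x) = (LINT x|M. z 0 x) + t * (LINT x|M. \<psi> t x)"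
      using iz0 i\<psi>[of t] t by simp
    finally have "(\<integral>\<^sup>+x. ennreal (z t x) \<partial>M) \<le> ennreal ((LINT x|M. z 0 x) + t * (LINT x|M. \<psi> t x))" .
    moreover have "ennreal (LINT x|M. z 0 x) = (\<integral>\<^sup>+x. ennreal (z 0 x) \<partial>M)"
      using iz0 AE\<Omega> z0 by (intro nn_integral_eq_integral[symmetric]) (auto elim!: eventually_mono)
    moreover have "(\<integral>\<^sup>+x. ennreal (z 0 x) \<partial>M) \<le> (\<integral>\<^sup>+x. ennreal (z t x) \<partial>M)"
      using min[OF t] modz[of 0] modz[of t] by simp
    ultimately have le: "ennreal (LINT x|M. z 0 x) \<le> ennreal ((LINT x|M. z 0 x) + t * (LINT x|M. \<psi> t x))"
      by simp
    have "0 \<le> (LINT x|M. z 0 x + t * \<psi> t x)"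
    proof (rule integral_nonneg_AE)
      show "AE x in M. 0 \<le> z 0 x + t * \<psi> t x"
        using AE\<Omega> by eventually_elim (rule order_trans[OF z0 conv])
    qed
    then have "0 \<le> (LINT x|M. z 0 x) + t * (LINT x|M. \<psi> t x)"
      using iz0 i\<psi>[of t] t by simp
    with le have "0 \<le> t * (LINT x|M. \<psi> t x)" by (simp add: ennreal_le_iff)
    then show ?thesis using t by (simp add: zero_le_mult_iff)
  qed
  have "(\<lambda>n. LINT x|M. \<psi> (inverse (real (Suc n))) x) \<longlonglongrightarrow> (LINT x|M. \<psi> 0 x)"
  proof (rule integral_dominated_convergence[OF _ _ iD])
    show "AE x in M. (\<lambda>n. \<psi> (inverse (real (Suc n))) x) \<longlonglongrightarrow> \<psi> 0 x"
      using AE\<Omega>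
    proof eventually_elim
      case (elim x)
      have "filterlim (\<lambda>n. inverse (real (Suc n))) (at 0) sequentially"
        using LIMSEQ_inverse_real_of_nat by (auto simp: filterlim_at)
      from filterlim_compose[OF flux_continuous[OF p_gt_1[OF elim], of "a x" "gradient h x"] this]
      show ?case by (simp add: \<psi>_def del: of_nat_Suc)
    qed
    show "AE x in M. norm (\<psi> (inverse (real (Suc n))) x) \<le> D x" for n
      by (rule \<psi>D) (auto simp: field_simps)
  qed measurable
  moreover have "0 \<le> (LINT x|M. \<psi> (inverse (real (Suc n))) x)" for n
    by (rule pos) (auto simp: field_simps)
  ultimately have "0 \<le> (LINT x|M. \<psi> 0 x)" by (intro LIMSEQ_le_const[of _ _ 0]) auto
  then show "0 \<le> (LINT x|M. norm (a x) powr (p x - 2) * (a x \<bullet> gradient h x))" by (simp add: \<psi>_def)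
  show "integrable M (\<lambda>x. norm (a x) powr (p x - 2) * (a x \<bullet> gradient h x))"
    using i\<psi>[of 0] by (simp add: \<psi>_def[abs_def])
qed

text \<open>The first variation is nonnegative in the directions \<open>h\<close> and \<open>- h\<close>, hence zero.\<close>

lemma minimiser_weak_p_harmonic:
  assumes \<phi>: "\<phi> \<in> sobolev \<Omega> p" and v: "v \<in> V0 \<Omega> p" and fin: "modular (\<lambda>x. wg \<phi> x + wg v x) < \<infinity>"
    and min: "\<And>w. w \<in> V0 \<Omega> p \<Longrightarrow> modular (\<lambda>x. wg \<phi> x + wg v x) \<le> modular (\<lambda>x. wg \<phi> x + wg w x)"
  shows "weak_p_harmonic \<Omega> p (\<lambda>x. \<phi> x + v x)"
  unfolding weak_p_harmonic_def integral_M integrable_M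
proof (rule ballI)
  fix h assume h: "h \<in> test_functions \<Omega>"
  define a where "a x = wg \<phi> x + wg v x" for x
  note vS = V0_sobolev[OF v]
  note [measurable] = sobolevD(3)[OF \<phi>] sobolevD(3)[OF vS] sobolevD(3)[OF sobolev_add[OF \<phi> vS]]
    has_weak_gradient_measurable(2)[OF has_weak_gradient_test_function[OF h]]
  have am [measurable]: "a \<in> borel_measurable M" unfolding a_def by measurable
  have mod: "modular a \<le> modular (\<lambda>x. a x + t *\<^sub>R gradient k x)" if k: "k \<in> test_functions \<Omega>" for k t
  proof -
    define w where "w x = v x + t * k x" for x
    have w: "w \<in> V0 \<Omega> p"
      unfolding w_def using test_functions_scale[OF k] test_functions_subset_V0 by (intro V0_add v) auto
    have wg: "has_weak_gradient \<Omega> w (\<lambda>x. wg v x + t *\<^sub>R gradient k x)"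
      unfolding w_def
      by (rule has_weak_gradient_add[OF sobolevD(1)[OF vS] has_weak_gradient_scale[OF has_weak_gradient_test_function[OF k]]])
    have "modular (\<lambda>x. wg \<phi> x + wg w x) = modular (\<lambda>x. a x + t *\<^sub>R gradient k x)"
      using wg_AE_eq[OF wg] by (intro modular_cong_AE) (auto elim!: eventually_mono simp: a_def)
    then show ?thesis using min[OF w] unfolding a_def by simp
  qed
  have finA: "modular a < \<infinity>" using fin unfolding a_def .
  have neg: "(\<lambda>x. (-1) * h x) \<in> test_functions \<Omega>" by (rule test_functions_scale[OF h])
  have gneg: "gradient (\<lambda>x. (-1) * h x) x = - gradient h x" for x
    using gradient_scale[OF test_functions_differentiable[OF h], of "-1" x] by simp
  note fv = first_variation[OF am finA h mod[OF h]]
  have "0 \<le> (LINT x|M. norm (a x) powr (p x - 2) * (a x \<bullet> - gradient h x))"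
    using first_variation(2)[OF am finA neg mod[OF neg]] unfolding gneg .
  then have zero: "(LINT x|M. norm (a x) powr (p x - 2) * (a x \<bullet> gradient h x)) = 0"
    using fv(2) by (simp add: inner_minus_right)
  have AE: "AE x in M. norm (a x) powr (p x - 2) * (a x \<bullet> gradient h x) =
      norm (wg (\<lambda>x. \<phi> x + v x) x) powr (p x - 2) * (wg (\<lambda>x. \<phi> x + v x) x \<bullet> gradient h x)"
    using wg_AE_eq[OF has_weak_gradient_add[OF sobolevD(1)[OF \<phi>] sobolevD(1)[OF vS]]]
    by eventually_elim (simp add: a_def)
  show "integrable M (\<lambda>x. norm (wg (\<lambda>x. \<phi> x + v x) x) powr (p x - 2) * (wg (\<lambda>x. \<phi> x + v x) x \<bullet> gradient h x)) \<and>
     (LINT x|M. norm (wg (\<lambda>x. \<phi> x + v x) x) powr (p x - 2) * (wg (\<lambda>x. \<phi> x + v x) x \<bullet> gradient h x)) = 0"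
  proof
    show "integrable M (\<lambda>x. norm (wg (\<lambda>x. \<phi> x + v x) x) powr (p x - 2) * (wg (\<lambda>x. \<phi> x + v x) x \<bullet> gradient h x))"
      by (rule integrable_cong_AE_imp[OF fv(1)]) (measurable, use AE in \<open>auto elim!: eventually_mono\<close>)
    have "(LINT x|M. norm (wg (\<lambda>x. \<phi> x + v x) x) powr (p x - 2) * (wg (\<lambda>x. \<phi> x + v x) x \<bullet> gradient h x))
       = (LINT x|M. norm (a x) powr (p x - 2) * (a x \<bullet> gradient h x))"
      by (rule integral_cong_AE) (measurable, use AE in \<open>auto elim!: eventually_mono\<close>)
    then show "(LINT x|M. norm (wg (\<lambda>x. \<phi> x + v x) x) powr (p x - 2) * (wg (\<lambda>x. \<phi> x + v x) x \<bullet> gradient h x)) = 0"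
      using zero by simp
  qed
qed

end

theorem theorem7p2:
  fixes \<Omega> :: "'a::euclidean_space set" and p \<phi> :: "'a \<Rightarrow> real"
  assumes "open \<Omega>" and "connected \<Omega>" and "\<Omega> \<noteq> {}" and "bounded \<Omega>"
    and "C2_boundary \<Omega>"
    and "continuous_on \<Omega> p" and "\<forall>x\<in>\<Omega>. 1 < p x"
    and "(INF x\<in>\<Omega>. p x) > real DIM('a)"
    and "\<phi> \<in> sobolev \<Omega> p"
    and "rho \<Omega> p (\<lambda>x. norm (weak_gradient \<Omega> \<phi> x)) < \<infinity>"
  shows "\<exists>u\<in>sobolev \<Omega> p. weak_p_harmonic \<Omega> p u \<and> (\<lambda>x. u x - \<phi> x) \<in> V0 \<Omega> p"
proof -
  have "bdd_below (p ` \<Omega>)" using assms(7) by (intro bdd_belowI[of _ 1]) auto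
  then have "(INF x\<in>\<Omega>. p x) \<le> p x" if "x \<in> \<Omega>" for x using that by (rule cINF_lower)
  then interpret variable_exponent \<Omega> p "INF x\<in>\<Omega>. p x"
    using assms by unfold_locales auto
  have "modular (wg \<phi>) < \<infinity>" using assms(10) by (simp only: rho_norm_eq_modular)
  then obtain v where v: "v \<in> V0 \<Omega> p" "modular (\<lambda>x. wg \<phi> x + wg v x) < \<infinity>"
    "\<And>w. w \<in> V0 \<Omega> p \<Longrightarrow> modular (\<lambda>x. wg \<phi> x + wg v x) \<le> modular (\<lambda>x. wg \<phi> x + wg w x)"
    using minimiser_exists[OF assms(9)] by blast
  show ?thesis
  proof (intro bexI conjI)
    show "weak_p_harmonic \<Omega> p (\<lambda>x. \<phi> x + v x)"
      by (rule minimiser_weak_p_harmonic[OF assms(9) v])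
    show "(\<lambda>x. \<phi> x + v x - \<phi> x) \<in> V0 \<Omega> p" using v(1) by simp
    show "(\<lambda>x. \<phi> x + v x) \<in> sobolev \<Omega> p" by (rule sobolev_add[OF assms(9) V0_sobolev[OF v(1)]])
  qed
qed

end
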